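(* Let $G=L\wr\Gamma$ be a finitely generated discrete lamplighter group with base group $\Gamma$ and lamps in $L$. Let $\mu$ be a generating probability measure on $G$ with finite entropy, such that the projected random walk on $\Gamma$ (the random walk with step distribution $\bar\mu=\pi_*\mu$) has a trivial Poisson boundary. Assume that the lamp configuration of the $\mu$ random walk stabilizes almost surely, so that the entropy $h_{\mathrm{conf}}(G,\mu)$ of the limit configuration boundary is defined. Then there exists a dense set $H\subseteq[0,h_{\mathrm{conf}}(G,\mu)]$ such that for each $h\in H$ there exists an ergodic $(G,\mu)$-stationary space with Furstenberg entropy $h$.
   Context: Groups are countable and discrete. A probability measure $\mu$ on $G$ is generating if $G$ is the semigroup generated by $\operatorname{supp}\mu$; its entropy is $H(\mu)=-\sum_g\mu(g)\log\mu(g)$. The $\mu$ random walk is $Z_n=X_1\cdots X_n$ with $X_i$ i.i.d. of law $\mu$. The Poisson boundary of a random walk is trivial iff all bounded harmonic functions are constant. A $(G,\mu)$-stationary space is a Lebesgue probability space $(X,\nu)$ with a measurable $G$-action such that $\sum_{g}\mu(g)\,g\nu=\nu$, where $(g\nu)(E)=\nu(g^{-1}E)$. It is ergodic if every $G$-invariant measurable set has measure $0$ or $1$. Its Furstenberg entropy is $h_\mu(X,\nu)=\sum_{g\in G}\mu(g)\int_X-\log\frac{d\nu}{dg\nu}(x)\,dg\nu(x)$. Lamplighter group: $C_C(L,\Gamma)$ is the group of finitely supported functions $\Gamma\to L$ under pointwise multiplication, on which $\Gamma$ acts by $[\gamma f](\gamma')=f(\gamma^{-1}\gamma')$; $L\wr\Gamma=C_C(L,\Gamma)\rtimes\Gamma$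 with $(f_1,\gamma_1)(f_2,\gamma_2)=(f_1(\gamma_1f_2),\gamma_1\gamma_2)$. The projection is $\pi(f,\gamma)=\gamma$. Limit configuration boundary: write $Z_n=(f_n,\gamma_n)$. The lamp configuration stabilizes almost surely if for each $\gamma\in\Gamma$ the sequence $f_n(\gamma)$ is almost surely eventually constant (this holds, for instance, if $\mu$ has finite first moment and the $\bar\mu$ random walk is transient). Then $\gamma\mapsto\lim_nf_n(\gamma)$ is a random element of $L^\Gamma$; its law on $L^\Gamma$, with the $G$-action $[(f,\gamma)\phi](x)=f(x)\phi(\gamma^{-1}x)$, is a $(G,\mu)$-stationary space called the limit configuration boundary, and $h_{\mathrm{conf}}(G,\mu)$ is its Furstenberg entropy. *)

theory Defs
  imports "HOL-Probability.Probability" "HOL-Algebra.Algebra"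
begin

text \<open>The lamplighter group. Functions on a group are extensional (undefined off the carrier),
  so that they are determined by their values on the carrier.\<close>

definition lamp_configs :: "('l, 'a) monoid_scheme \<Rightarrow> ('g, 'b) monoid_scheme \<Rightarrow> ('g \<Rightarrow> 'l) set" where
  "lamp_configs L \<Gamma> =
     {f \<in> carrier \<Gamma> \<rightarrow>\<^sub>E carrier L. finite {x \<in> carrier \<Gamma>. f x \<noteq> \<one>\<^bsub>L\<^esub>}}"

definition translate ::
  "('l, 'a) monoid_scheme \<Rightarrow> ('g, 'b) monoid_scheme \<Rightarrow> ('g \<Rightarrow> 'l) \<times> 'g \<Rightarrow> ('g \<Rightarrow> 'l) \<Rightarrow> 'g \<Rightarrow> 'l" where
  "translate L \<Gamma> = (\<lambda>(f, \<gamma>) \<phi>. \<lambda>x\<in>carrier \<Gamma>. f x \<otimes>\<^bsub>L\<^esub> \<phi> (inv\<^bsub>\<Gamma>\<^esub> \<gamma> \<otimes>\<^bsub>\<Gamma>\<^esub> x))"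

definition lamplighter ::
  "('l, 'a) monoid_scheme \<Rightarrow> ('g, 'b) monoid_scheme \<Rightarrow> (('g \<Rightarrow> 'l) \<times> 'g) monoid" where
  "lamplighter L \<Gamma> =
     \<lparr>carrier = lamp_configs L \<Gamma> \<times> carrier \<Gamma>,
      mult = (\<lambda>(f1, \<gamma>1) (f2, \<gamma>2). (translate L \<Gamma> (f1, \<gamma>1) f2, \<gamma>1 \<otimes>\<^bsub>\<Gamma>\<^esub> \<gamma>2)),
      one = (\<lambda>x\<in>carrier \<Gamma>. \<one>\<^bsub>L\<^esub>, \<one>\<^bsub>\<Gamma>\<^esub>)\<rparr>"

lemma group_lamplighter:
  assumes "group L" "group \<Gamma>"
  shows "group (lamplighter L \<Gamma>)"
proof -
  interpret L: group L by fact
  interpret \<Gamma>: group \<Gamma> by fact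
  have shift_finite: "finite {x \<in> carrier \<Gamma>. f (c \<otimes>\<^bsub>\<Gamma>\<^esub> x) \<noteq> \<one>\<^bsub>L\<^esub>}"
    if "f \<in> lamp_configs L \<Gamma>" "c \<in> carrier \<Gamma>" for f c
  proof (rule inj_on_finite)
    show "inj_on (\<lambda>x. c \<otimes>\<^bsub>\<Gamma>\<^esub> x) {x \<in> carrier \<Gamma>. f (c \<otimes>\<^bsub>\<Gamma>\<^esub> x) \<noteq> \<one>\<^bsub>L\<^esub>}"
      using that by (auto simp: inj_on_def)
    show "(\<lambda>x. c \<otimes>\<^bsub>\<Gamma>\<^esub> x) ` {x \<in> carrier \<Gamma>. f (c \<otimes>\<^bsub>\<Gamma>\<^esub> x) \<noteq> \<one>\<^bsub>L\<^esub>} \<subseteq>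
        {x \<in> carrier \<Gamma>. f x \<noteq> \<one>\<^bsub>L\<^esub>}"
      using that by auto
    show "finite {x \<in> carrier \<Gamma>. f x \<noteq> \<one>\<^bsub>L\<^esub>}"
      using that by (simp add: lamp_configs_def)
  qed
  have closed: "translate L \<Gamma> (f, c) h \<in> lamp_configs L \<Gamma>"
    if "f \<in> lamp_configs L \<Gamma>" "h \<in> lamp_configs L \<Gamma>" "c \<in> carrier \<Gamma>" for f h c
  proof -
    have "finite ({x \<in> carrier \<Gamma>. f x \<noteq> \<one>\<^bsub>L\<^esub>} \<union>
        {x \<in> carrier \<Gamma>. h (inv\<^bsub>\<Gamma>\<^esub> c \<otimes>\<^bsub>\<Gamma>\<^esub> x) \<noteq> \<one>\<^bsub>L\<^esub>})"
      using that shift_finite[of h "inv\<^bsub>\<Gamma>\<^esub> c"] by (auto simp: lamp_configs_def)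
    then have "finite {x \<in> carrier \<Gamma>. translate L \<Gamma> (f, c) h x \<noteq> \<one>\<^bsub>L\<^esub>}"
      by (rule rev_finite_subset) (auto simp: translate_def)
    moreover have "translate L \<Gamma> (f, c) h \<in> carrier \<Gamma> \<rightarrow>\<^sub>E carrier L"
      using that by (auto simp: translate_def lamp_configs_def PiE_iff)
    ultimately show ?thesis
      by (simp add: lamp_configs_def)
  qed
  show ?thesis
  proof (rule groupI)
    fix x y assume "x \<in> carrier (lamplighter L \<Gamma>)" "y \<in> carrier (lamplighter L \<Gamma>)"
    then show "x \<otimes>\<^bsub>lamplighter L \<Gamma>\<^esub> y \<in> carrier (lamplighter L \<Gamma>)"
      by (auto simp: lamplighter_def closed)
  next
    show "\<one>\<^bsub>lamplighter L \<Gamma>\<^esub> \<in> carrier (lamplighter L \<Gamma>)"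
      by (auto simp: lamplighter_def lamp_configs_def)
  next
    fix x y z
    assume "x \<in> carrier (lamplighter L \<Gamma>)" "y \<in> carrier (lamplighter L \<Gamma>)"
      "z \<in> carrier (lamplighter L \<Gamma>)"
    then show "x \<otimes>\<^bsub>lamplighter L \<Gamma>\<^esub> y \<otimes>\<^bsub>lamplighter L \<Gamma>\<^esub> z =
        x \<otimes>\<^bsub>lamplighter L \<Gamma>\<^esub> (y \<otimes>\<^bsub>lamplighter L \<Gamma>\<^esub> z)"
      by (auto simp: lamplighter_def translate_def lamp_configs_def PiE_iff fun_eq_iff
          L.m_assoc \<Gamma>.m_assoc \<Gamma>.inv_mult_group)
  next
    fix x assume "x \<in> carrier (lamplighter L \<Gamma>)"
    then show "\<one>\<^bsub>lamplighter L \<Gamma>\<^esub> \<otimes>\<^bsub>lamplighter L \<Gamma>\<^esub> x = x"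
      by (auto simp: lamplighter_def translate_def lamp_configs_def PiE_iff fun_eq_iff
          extensional_def)
  next
    fix x assume "x \<in> carrier (lamplighter L \<Gamma>)"
    then obtain f c where x: "x = (f, c)" "f \<in> lamp_configs L \<Gamma>" "c \<in> carrier \<Gamma>"
      by (auto simp: lamplighter_def)
    define h where "h = (\<lambda>u\<in>carrier \<Gamma>. inv\<^bsub>L\<^esub> f (c \<otimes>\<^bsub>\<Gamma>\<^esub> u))"
    have fc: "f u \<in> carrier L" if "u \<in> carrier \<Gamma>" for u
      using x that by (auto simp: lamp_configs_def)
    have "{u \<in> carrier \<Gamma>. h u \<noteq> \<one>\<^bsub>L\<^esub>} \<subseteq> {u \<in> carrier \<Gamma>. f (c \<otimes>\<^bsub>\<Gamma>\<^esub> u) \<noteq> \<one>\<^bsub>L\<^esub>}"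
      by (auto simp: h_def)
    then have "finite {u \<in> carrier \<Gamma>. h u \<noteq> \<one>\<^bsub>L\<^esub>}"
      using shift_finite[OF x(2,3)] by (rule finite_subset)
    then have "h \<in> lamp_configs L \<Gamma>"
      using x fc by (auto simp: h_def lamp_configs_def)
    moreover have "translate L \<Gamma> (h, inv\<^bsub>\<Gamma>\<^esub> c) f = (\<lambda>u\<in>carrier \<Gamma>. \<one>\<^bsub>L\<^esub>)"
      using x fc by (auto simp: translate_def h_def fun_eq_iff)
    ultimately show "\<exists>y\<in>carrier (lamplighter L \<Gamma>). y \<otimes>\<^bsub>lamplighter L \<Gamma>\<^esub> x = \<one>\<^bsub>lamplighter L \<Gamma>\<^esub>"
      using x by (intro bexI[of _ "(h, inv\<^bsub>\<Gamma>\<^esub> c)"]) (auto simp: lamplighter_def)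
  qed
qed

definition finitely_generated :: "('a, 'b) monoid_scheme \<Rightarrow> bool" where
  "finitely_generated G \<longleftrightarrow> (\<exists>S. finite S \<and> S \<subseteq> carrier G \<and> generate G S = carrier G)"


text \<open>Probability measures on a countable group.\<close>

inductive_set semigroup_generate :: "('a, 'b) monoid_scheme \<Rightarrow> 'a set \<Rightarrow> 'a set"
  for G and S where
    incl: "s \<in> S \<Longrightarrow> s \<in> semigroup_generate G S"
  | mult: "a \<in> semigroup_generate G S \<Longrightarrow> b \<in> semigroup_generate G S \<Longrightarrow>
           a \<otimes>\<^bsub>G\<^esub> b \<in> semigroup_generate G S"

text \<open>This includes that \<open>\<mu>\<close> lives on the carrier.\<close>

definition generating :: "('a, 'b) monoid_scheme \<Rightarrow> 'a pmf \<Rightarrow> bool" where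
  "generating G \<mu> \<longleftrightarrow> semigroup_generate G (set_pmf \<mu>) = carrier G"

definition pmf_entropy :: "'a pmf \<Rightarrow> ennreal" where
  "pmf_entropy \<mu> = (\<integral>\<^sup>+ g. ennreal (- (pmf \<mu> g * ln (pmf \<mu> g))) \<partial>count_space UNIV)"

text \<open>The walk multiplies its increments on the right, so harmonicity averages over
  right translates.\<close>

definition bounded_harmonic :: "('a, 'b) monoid_scheme \<Rightarrow> 'a pmf \<Rightarrow> ('a \<Rightarrow> real) \<Rightarrow> bool" where
  "bounded_harmonic G \<mu> h \<longleftrightarrow>
     (\<exists>B. \<forall>x\<in>carrier G. \<bar>h x\<bar> \<le> B) \<and>
     (\<forall>x\<in>carrier G. h x = (\<Sum>\<^sub>\<infinity>s\<in>carrier G. pmf \<mu> s * h (x \<otimes>\<^bsub>G\<^esub> s)))"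

definition trivial_Poisson_boundary :: "('a, 'b) monoid_scheme \<Rightarrow> 'a pmf \<Rightarrow> bool" where
  "trivial_Poisson_boundary G \<mu> \<longleftrightarrow>
     (\<forall>h. bounded_harmonic G \<mu> h \<longrightarrow> (\<exists>c. \<forall>x\<in>carrier G. h x = c))"


text \<open>Stationary spaces.\<close>

definition standard_borel :: "'x measure \<Rightarrow> bool" where
  "standard_borel M \<longleftrightarrow>
     (\<exists>T. completely_metrizable_space T \<and> second_countable T \<and>
          space M = topspace T \<and> sets M = sigma_sets (topspace T) {U. openin T U})"

text \<open>Lebesgue spaces are standard Borel probability spaces up to completion. We keep the Borel
  sigma-algebra. An action on it extends to the completion, since stationarity for a generating
  measure makes the action nonsingular, and entropy and ergodicity do not change.\<close>

definition push :: "('a \<Rightarrow> 'x \<Rightarrow> 'x) \<Rightarrow> 'a \<Rightarrow> 'x measure \<Rightarrow> 'x measure" where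
  "push act g \<nu> = distr \<nu> \<nu> (act g)"

definition stationary_space ::
  "('a, 'b) monoid_scheme \<Rightarrow> 'a pmf \<Rightarrow> 'x measure \<Rightarrow> ('a \<Rightarrow> 'x \<Rightarrow> 'x) \<Rightarrow> bool" where
  "stationary_space G \<mu> \<nu> act \<longleftrightarrow>
     standard_borel \<nu> \<and> prob_space \<nu> \<and>
     group_action G (space \<nu>) act \<and> (\<forall>g\<in>carrier G. act g \<in> \<nu> \<rightarrow>\<^sub>M \<nu>) \<and>
     (\<forall>E\<in>sets \<nu>. (\<Sum>\<^sub>\<infinity>g\<in>carrier G. pmf \<mu> g * measure (push act g \<nu>) E) = measure \<nu> E)"

definition ergodic_action ::
  "('a, 'b) monoid_scheme \<Rightarrow> 'x measure \<Rightarrow> ('a \<Rightarrow> 'x \<Rightarrow> 'x) \<Rightarrow> bool" where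
  "ergodic_action G \<nu> act \<longleftrightarrow>
     (\<forall>E\<in>sets \<nu>. (\<forall>g\<in>carrier G. act g ` E = E) \<longrightarrow> measure \<nu> E = 0 \<or> measure \<nu> E = 1)"

text \<open>\<^term>\<open>RN_deriv M N\<close> is the derivative of \<open>N\<close> with respect to \<open>M\<close>.
  If \<open>\<nu>\<close> is stationary for a generating \<open>\<mu>\<close> of finite entropy, then the measures \<open>g\<nu>\<close> are mutually
  absolutely continuous and \<open>\<mu>(g) g\<nu> \<le> \<nu>\<close>. Hence the integrand is almost everywhere at
  most \<open>-ln \<mu>(g)\<close>, its negative part is integrable, and the sum is at most the entropy of \<open>\<mu>\<close>:
  the integrals and the sum below converge and take no default values.\<close>

definition furstenberg_entropy ::
  "('a, 'b) monoid_scheme \<Rightarrow> 'a pmf \<Rightarrow> 'x measure \<Rightarrow> ('a \<Rightarrow> 'x \<Rightarrow> 'x) \<Rightarrow> real" where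
  "furstenberg_entropy G \<mu> \<nu> act =
     (\<Sum>\<^sub>\<infinity>g\<in>carrier G. pmf \<mu> g *
        (\<integral>x. - ln (enn2real (RN_deriv (push act g \<nu>) \<nu> x)) \<partial>(push act g \<nu>)))"


text \<open>The random walk and its limit configuration. The increments are restricted to the carrier:
  over the whole (possibly uncountable) type the group operation need not be measurable for the
  product of discrete sigma-algebras. The \<open>n\<close>-th increment has index \<open>n - 1\<close>.\<close>

definition increments :: "('a, 'b) monoid_scheme \<Rightarrow> 'a pmf \<Rightarrow> (nat \<Rightarrow> 'a) measure" where
  "increments G \<mu> = Pi\<^sub>M UNIV (\<lambda>_. restrict_space (measure_pmf \<mu>) (carrier G))"

primrec walk :: "('a, 'b) monoid_scheme \<Rightarrow> (nat \<Rightarrow> 'a) \<Rightarrow> nat \<Rightarrow> 'a" where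
  "walk G \<omega> 0 = \<one>\<^bsub>G\<^esub>"
| "walk G \<omega> (Suc n) = walk G \<omega> n \<otimes>\<^bsub>G\<^esub> \<omega> n"

definition lamps_stabilize ::
  "('l, 'a) monoid_scheme \<Rightarrow> ('g, 'b) monoid_scheme \<Rightarrow> (('g \<Rightarrow> 'l) \<times> 'g) pmf \<Rightarrow> bool" where
  "lamps_stabilize L \<Gamma> \<mu> \<longleftrightarrow>
     (\<forall>\<gamma>\<in>carrier \<Gamma>. AE \<omega> in increments (lamplighter L \<Gamma>) \<mu>.
        \<exists>c. \<forall>\<^sub>F n in sequentially. fst (walk (lamplighter L \<Gamma>) \<omega> n) \<gamma> = c)"

text \<open>Lamps that do not stabilize (a null event wherever this is used) are set to the identity.\<close>

definition limit_config ::
  "('l, 'a) monoid_scheme \<Rightarrow> ('g, 'b) monoid_scheme \<Rightarrow> (nat \<Rightarrow> ('g \<Rightarrow> 'l) \<times> 'g) \<Rightarrow> 'g \<Rightarrow> 'l" where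
  "limit_config L \<Gamma> \<omega> = (\<lambda>\<gamma>\<in>carrier \<Gamma>.
     if \<exists>c. \<forall>\<^sub>F n in sequentially. fst (walk (lamplighter L \<Gamma>) \<omega> n) \<gamma> = c
     then THE c. \<forall>\<^sub>F n in sequentially. fst (walk (lamplighter L \<Gamma>) \<omega> n) \<gamma> = c
     else \<one>\<^bsub>L\<^esub>)"

definition config_measure ::
  "('l, 'a) monoid_scheme \<Rightarrow> ('g, 'b) monoid_scheme \<Rightarrow> (('g \<Rightarrow> 'l) \<times> 'g) pmf \<Rightarrow> ('g \<Rightarrow> 'l) measure" where
  "config_measure L \<Gamma> \<mu> =
     distr (increments (lamplighter L \<Gamma>) \<mu>) (Pi\<^sub>M (carrier \<Gamma>) (\<lambda>_. count_space (carrier L)))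
       (limit_config L \<Gamma>)"

definition config_action ::
  "('l, 'a) monoid_scheme \<Rightarrow> ('g, 'b) monoid_scheme \<Rightarrow> ('g \<Rightarrow> 'l) \<times> 'g \<Rightarrow> ('g \<Rightarrow> 'l) \<Rightarrow> 'g \<Rightarrow> 'l" where
  "config_action L \<Gamma> g = (\<lambda>\<phi>\<in>carrier \<Gamma> \<rightarrow>\<^sub>E carrier L. translate L \<Gamma> g \<phi>)"

definition config_entropy ::
  "('l, 'a) monoid_scheme \<Rightarrow> ('g, 'b) monoid_scheme \<Rightarrow> (('g \<Rightarrow> 'l) \<times> 'g) pmf \<Rightarrow> real" where
  "config_entropy L \<Gamma> \<mu> =
     furstenberg_entropy (lamplighter L \<Gamma>) \<mu> (config_measure L \<Gamma> \<mu>) (config_action L \<Gamma>)"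

end

theory Submission
  imports Defs "HOL-Complex_Analysis.Great_Picard"
begin

text \<open>The limit configuration \<open>\<phi>\<close> is masked by an independent random subset \<open>S\<close> of \<open>\<Gamma>\<close>, a
  \<open>\<Gamma>\<close>-factor of i.i.d. exponential labels \<open>U\<close>: a position \<open>x\<close> lies in \<open>S\<close> iff
  \<open>U (x k) \<le> t m(k)\<close> for some \<open>k\<close> in the finite support of a weight \<open>m\<close> of total mass about \<open>1\<close>.
  The pair of \<open>S\<close> and \<open>\<phi>\<close> restricted to \<open>S\<close> is stationary. It is ergodic, since i.i.d. labels are mixing over
  an infinite \<open>\<Gamma>\<close> and the limit configuration is itself a boundary.

  As bounded harmonic functions on \<open>\<Gamma>\<close> are constant, Cesaro means of convolution powers provide
  weights \<open>m\<close> that are almost invariant under translation by a given finite set \<open>B\<close>. A union bound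
  for minima of exponentials then degenerates: \<open>B\<close> is contained in \<open>S\<close> with probability close to
  \<open>q = 1 - exp (-t)\<close> and is disjoint from \<open>S\<close> with probability close to \<open>1 - q\<close>. By the same
  triviality the law of \<open>\<phi>\<close> and its translate by \<open>g\<close> are indistinguishable outside a large \<open>B\<close>. So the
  relative entropy of the translate is nearly that of \<open>\<phi>\<close> in the first case and nearly zero in the
  second. Being bounded by \<open>- ln \<mu>(g)\<close>, which is integrable, these relative entropies can be averaged
  over \<open>g\<close>, so that the Furstenberg entropy tends to \<open>q\<close> times that of the limit configuration boundary.
  Over a finite \<open>\<Gamma>\<close> the latter is zero.\<close>

section \<open>Relative entropy and approximation by cylinder functions\<close>

text \<open>A single coin, tossed once, that shows all of \<phi> with probability q and nothing
  otherwise would give exactly q times the entropy, but not ergodically. The mask imitates this coin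
  on a prescribed finite set, yet is built from a mixing process; a mask independent from site to
  site would leave B partly visible, with entropy out of control. Exponential labels are chosen
  because B is unmarked iff each label exceeds the largest of the thresholds that B imposes on it,
  which has probability exp of -t times a sum of maxima. Almost invariance keeps this sum near 1 for
  every nonempty subset of B, so singletons, pairs and B are unmarked with nearly the same
  probability. The labels are preserved in law by \<Gamma> and add no entropy. The other obstacle is
  that the densities of masked translates are not computed, and that entropy is not continuous in
  L1. These densities are bounded by 1/\<mu>(g), and x ln x is uniformly continuous on their range,
  so L1 estimates suffice; they come by duality from bounded test functions.\<close>

lemma infsum_pmf_mult:
  fixes f :: "'a \<Rightarrow> real"
  assumes "set_pmf p \<subseteq> A" "integrable (measure_pmf p) f"
  shows "(\<Sum>\<^sub>\<infinity>x\<in>A. pmf p x * f x) = measure_pmf.expectation p f"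
proof -
  have int: "integrable (count_space UNIV) (\<lambda>x. pmf p x *\<^sub>R f x)"
    using assms(2) unfolding measure_pmf_eq_density
    by (subst (asm) integrable_density) auto
  have "(\<Sum>\<^sub>\<infinity>x\<in>A. pmf p x * f x) = (\<Sum>\<^sub>\<infinity>x\<in>UNIV. pmf p x * f x)"
    using assms(1) by (intro infsum_cong_neutral) (auto simp: set_pmf_eq)
  also have "\<dots> = infsetsum (\<lambda>x. pmf p x * f x) UNIV"
    by (rule infsetsum_infsum[symmetric])
      (use int in \<open>simp add: Infinite_Set_Sum.abs_summable_on_def\<close>)
  also have "\<dots> = measure_pmf.expectation p f"
    by (simp add: pmf_expectation_eq_infsetsum)
  finally show ?thesis .
qed

text \<open>The lower bound is \<open>ln y \<le> y - 1\<close> at \<open>y = 1 / x\<close>.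
  Integrated over a density of mass one, the two bounds give the nonnegativity of relative entropy
  and its bound by \<open>ln M\<close>.\<close>

lemma mult_ln_bounds:
  fixes x :: real
  assumes "0 < x" "x \<le> M"
  shows "x - 1 \<le> x * ln x" "x * ln x \<le> x * ln M"
proof -
  have "ln (1 / x) \<le> 1 / x - 1"
    using assms by (intro ln_le_minus_one) auto
  then have "1 - 1 / x \<le> ln x"
    using assms by (simp add: ln_div)
  then have "x * (1 - 1 / x) \<le> x * ln x"
    using assms by (intro mult_left_mono) auto
  then show "x - 1 \<le> x * ln x"
    using assms by (simp add: algebra_simps)
  show "x * ln x \<le> x * ln M"
    using assms by (intro mult_left_mono) auto
qed

text \<open>Only the point 0 is in question; the value there is 0, which is also the one-sided
  limit.\<close>

lemma continuous_on_mult_ln: "continuous_on {0..} (\<lambda>x::real. x * ln x)"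
proof -
  have "((\<lambda>x::real. x * ln x) \<longlongrightarrow> 0) (at_right 0)"
    by real_asymp
  then have 0: "((\<lambda>x::real. x * ln x) \<longlongrightarrow> 0) (at 0 within {0..})"
    unfolding at_within_def by (rule filterlim_mono) (auto simp: le_inf_iff intro!: le_infI2)
  show ?thesis
    unfolding continuous_on_def
  proof
    fix x :: real assume "x \<in> {0..}"
    then consider "x = 0" | "x > 0" by fastforce
    then show "((\<lambda>x. x * ln x) \<longlongrightarrow> x * ln x) (at x within {0..})"
      by cases (use 0 in \<open>auto intro!: tendsto_intros\<close>)
  qed
qed

text \<open>The slope of \<open>x * ln x\<close> is unbounded at 0, so there is no Lipschitz bound.
  Uniform continuity gives \<eta> for points closer than \<open>d\<close>; for points farther apart
  the difference, at most \<open>2 * K\<close>, is absorbed by the linear term.\<close>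

lemma mult_ln_modulus:
  fixes M \<eta> :: real
  assumes "\<eta> > 0"
  obtains C where "C \<ge> 0"
    "\<And>x y. x \<in> {0..M} \<Longrightarrow> y \<in> {0..M} \<Longrightarrow> \<bar>x * ln x - y * ln y\<bar> \<le> \<eta> + C * \<bar>x - y\<bar>"
proof -
  let ?f = "\<lambda>x::real. x * ln x"
  have cont: "continuous_on {0..M} ?f"
    by (rule continuous_on_subset[OF continuous_on_mult_ln]) auto
  have "uniformly_continuous_on {0..M} ?f"
    by (rule compact_uniformly_continuous[OF cont]) simp
  then obtain d where d: "d > 0" "\<And>x y. x \<in> {0..M} \<Longrightarrow> y \<in> {0..M} \<Longrightarrow> \<bar>x - y\<bar> < d \<Longrightarrow> \<bar>?f x - ?f y\<bar> < \<eta>"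
    unfolding uniformly_continuous_on_def dist_real_def using assms by metis
  have "bounded (?f ` {0..M})"
    by (intro compact_imp_bounded compact_continuous_image cont) simp
  then obtain K where "K > 0" "\<forall>y\<in>?f ` {0..M}. norm y \<le> K"
    unfolding bounded_pos by blast
  then have K: "\<And>x. x \<in> {0..M} \<Longrightarrow> \<bar>?f x\<bar> \<le> K" "K > 0"
    by auto
  show ?thesis
  proof (rule that[of "2 * K / d"])
    show "0 \<le> 2 * K / d" using d K by simp
    fix x y assume xy: "x \<in> {0..M}" "y \<in> {0..M}"
    show "\<bar>?f x - ?f y\<bar> \<le> \<eta> + 2 * K / d * \<bar>x - y\<bar>"
    proof (cases "\<bar>x - y\<bar> < d")
      case True
      then show ?thesis using d(2)[OF xy] d(1) K by (smt (verit) divide_nonneg_pos mult_nonneg_nonneg)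
    next
      case False
      have "\<bar>?f x - ?f y\<bar> \<le> 2 * K" using K(1)[OF xy(1)] K(1)[OF xy(2)] by linarith
      also have "\<dots> = 2 * K / d * d" using d by simp
      also have "\<dots> \<le> 2 * K / d * \<bar>x - y\<bar>" using False d K by (intro mult_left_mono) auto
      finally show ?thesis using assms by linarith
    qed
  qed
qed

text \<open>Furstenberg entropy integrates minus the logarithm of dN/dP against P, while the
  estimates are made with the density r of P. As r is positive, dN/dP is
  \<open>1 / r\<close>.\<close>

lemma integral_neg_ln_RN_deriv:
  assumes "sigma_finite_measure N" and [measurable]: "r \<in> borel_measurable N"
    and pos: "\<And>x. x \<in> space N \<Longrightarrow> 0 < r x"
    and P: "P = density N (\<lambda>x. ennreal (r x))"
  shows "(\<integral>x. - ln (enn2real (RN_deriv P N x)) \<partial>P) = (\<integral>x. r x * ln (r x) \<partial>N)"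
proof -
  interpret N: sigma_finite_measure N by fact
  have sets[measurable_cong]: "sets P = sets N" by (simp add: P)
  have "sigma_finite_measure P"
    unfolding P by (subst N.sigma_finite_iff_density_finite) auto
  then interpret P: sigma_finite_measure P .
  have "density P (\<lambda>x. ennreal (1 / r x)) = density N (\<lambda>x. ennreal (r x) * ennreal (1 / r x))"
    unfolding P by (rule density_density_eq) auto
  also have "\<dots> = density N (\<lambda>_. 1)"
    using pos by (intro density_cong) (auto intro!: AE_I2 simp: ennreal_mult'[symmetric] less_imp_neq[symmetric] less_imp_le)
  finally have N: "density P (\<lambda>x. ennreal (1 / r x)) = N" by (simp add: density_1)
  have "AE x in P. ennreal (1 / r x) = RN_deriv P N x"
    by (rule P.RN_deriv_unique[OF _ N]) (simp add: P)
  then have "(\<integral>x. - ln (enn2real (RN_deriv P N x)) \<partial>P) = (\<integral>x. ln (r x) \<partial>P)"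
  proof (intro integral_cong_AE)
    show "(\<lambda>x. - ln (enn2real (RN_deriv P N x))) \<in> borel_measurable P" by measurable
    show "(\<lambda>x. ln (r x)) \<in> borel_measurable P" by measurable
    show "AE x in P. - ln (enn2real (RN_deriv P N x)) = ln (r x)"
      using \<open>AE x in P. ennreal (1 / r x) = RN_deriv P N x\<close> AE_space
    proof eventually_elim
      case (elim x)
      then have "r x > 0" using pos by (simp add: P)
      have "RN_deriv P N x = ennreal (1 / r x)" using elim by simp
      then show ?case using \<open>r x > 0\<close> by (simp add: ln_div)
    qed
  qed
  also have "\<dots> = (\<integral>x. r x * ln (r x) \<partial>N)"
    unfolding P using pos by (subst integral_density) (auto intro!: AE_I2 less_imp_le)
  finally show ?thesis .
qed

text \<open>The approximant is a function on the finite product rather than on the space of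
  \<open>M\<close>, so that it can also be evaluated on finite patterns of other origin: a shifted
  label field, or the visible part of a masked configuration.\<close>

definition cylinder_approximable :: "'i set \<Rightarrow> 'b measure \<Rightarrow> ('i \<Rightarrow> 'b) measure \<Rightarrow> (('i \<Rightarrow> 'b) \<Rightarrow> real) \<Rightarrow> bool" where
  "cylinder_approximable I N M f \<longleftrightarrow> (\<forall>\<epsilon>>0. \<exists>B h. finite B \<and> B \<subseteq> I \<and>
     h \<in> borel_measurable (Pi\<^sub>M B (\<lambda>_. N)) \<and> integrable M (\<lambda>x. h (restrict x B)) \<and>
     (\<integral>x. \<bar>f x - h (restrict x B)\<bar> \<partial>M) < \<epsilon>)"

context
  fixes I :: "'i set" and N :: "'b measure" and M :: "('i \<Rightarrow> 'b) measure"
  assumes fin: "finite_measure M" and sets_M: "sets M = sets (Pi\<^sub>M I (\<lambda>_. N))"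
begin

interpretation finite_measure M by (fact fin)

lemma cylinder_approximable_cong:
  assumes "cylinder_approximable I N M f" "\<And>x. x \<in> space M \<Longrightarrow> f x = g x"
  shows "cylinder_approximable I N M g"
proof -
  have "(\<integral>x. \<bar>f x - h (restrict x B)\<bar> \<partial>M) = (\<integral>x. \<bar>g x - h (restrict x B)\<bar> \<partial>M)" for h B
    by (intro Bochner_Integration.integral_cong) (simp_all add: assms(2))
  then show ?thesis
    using assms(1) unfolding cylinder_approximable_def by simp
qed

lemma cylinder_approximable_limit:
  assumes f: "integrable M f"
    and g: "\<And>\<epsilon>. \<epsilon> > 0 \<Longrightarrow> \<exists>g. cylinder_approximable I N M g \<and> integrable M g \<and> (\<integral>x. \<bar>f x - g x\<bar> \<partial>M) < \<epsilon>"
  shows "cylinder_approximable I N M f"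
  unfolding cylinder_approximable_def
proof (intro allI impI)
  fix \<epsilon> :: real assume "\<epsilon> > 0"
  then obtain g where g: "cylinder_approximable I N M g" "integrable M g" "(\<integral>x. \<bar>f x - g x\<bar> \<partial>M) < \<epsilon> / 2"
    using g[of "\<epsilon> / 2"] by auto
  from g(1) \<open>\<epsilon> > 0\<close> obtain B h where h: "finite B" "B \<subseteq> I" "h \<in> borel_measurable (Pi\<^sub>M B (\<lambda>_. N))"
    "integrable M (\<lambda>x. h (restrict x B))" "(\<integral>x. \<bar>g x - h (restrict x B)\<bar> \<partial>M) < \<epsilon> / 2"
    unfolding cylinder_approximable_def by (meson half_gt_zero)
  have "(\<integral>x. \<bar>f x - h (restrict x B)\<bar> \<partial>M) \<le> (\<integral>x. \<bar>f x - g x\<bar> + \<bar>g x - h (restrict x B)\<bar> \<partial>M)"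
    using f g h by (intro integral_mono) auto
  also have "\<dots> = (\<integral>x. \<bar>f x - g x\<bar> \<partial>M) + (\<integral>x. \<bar>g x - h (restrict x B)\<bar> \<partial>M)"
    using f g h by (intro Bochner_Integration.integral_add) auto
  also have "\<dots> < \<epsilon>" using g h by simp
  finally show "\<exists>B h. finite B \<and> B \<subseteq> I \<and> h \<in> borel_measurable (Pi\<^sub>M B (\<lambda>_. N)) \<and>
      integrable M (\<lambda>x. h (restrict x B)) \<and> (\<integral>x. \<bar>f x - h (restrict x B)\<bar> \<partial>M) < \<epsilon>"
    using h by blast
qed

lemma cylinder_approximable_add:
  assumes f: "integrable M f" "cylinder_approximable I N M f"
    and g: "integrable M g" "cylinder_approximable I N M g"
  shows "cylinder_approximable I N M (\<lambda>x. f x + g x)"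
  unfolding cylinder_approximable_def
proof (intro allI impI)
  fix \<epsilon> :: real assume "\<epsilon> > 0"
  from f(2) \<open>\<epsilon> > 0\<close> obtain B h where h: "finite B" "B \<subseteq> I" "h \<in> borel_measurable (Pi\<^sub>M B (\<lambda>_. N))"
    "integrable M (\<lambda>x. h (restrict x B))" "(\<integral>x. \<bar>f x - h (restrict x B)\<bar> \<partial>M) < \<epsilon> / 2"
    unfolding cylinder_approximable_def by (meson half_gt_zero)
  from g(2) \<open>\<epsilon> > 0\<close> obtain B' h' where h': "finite B'" "B' \<subseteq> I" "h' \<in> borel_measurable (Pi\<^sub>M B' (\<lambda>_. N))"
    "integrable M (\<lambda>x. h' (restrict x B'))" "(\<integral>x. \<bar>g x - h' (restrict x B')\<bar> \<partial>M) < \<epsilon> / 2"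
    unfolding cylinder_approximable_def by (meson half_gt_zero)
  let ?C = "B \<union> B'" and ?k = "\<lambda>x. h (restrict x B) + h' (restrict x B')"
  have k: "?k (restrict x ?C) = ?k x" for x
    by (simp add: Int_absorb1 Int_absorb2 restrict_restrict)
  have "(\<integral>x. \<bar>f x + g x - ?k (restrict x ?C)\<bar> \<partial>M) \<le> (\<integral>x. \<bar>f x - h (restrict x B)\<bar> + \<bar>g x - h' (restrict x B')\<bar> \<partial>M)"
    unfolding k using f g h h' by (intro integral_mono) auto
  also have "\<dots> = (\<integral>x. \<bar>f x - h (restrict x B)\<bar> \<partial>M) + (\<integral>x. \<bar>g x - h' (restrict x B')\<bar> \<partial>M)"
    using f g h h' by (intro Bochner_Integration.integral_add) auto
  also have "\<dots> < \<epsilon>" using h' h by simp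
  finally have "(\<integral>x. \<bar>f x + g x - ?k (restrict x ?C)\<bar> \<partial>M) < \<epsilon>" .
  moreover have "?k \<in> borel_measurable (Pi\<^sub>M ?C (\<lambda>_. N))"
    by (intro borel_measurable_add measurable_compose[OF measurable_restrict_subset h(3)]
        measurable_compose[OF measurable_restrict_subset h'(3)]) auto
  moreover have "integrable M (\<lambda>x. ?k (restrict x ?C))"
    unfolding k using h h' by simp
  ultimately show "\<exists>B h. finite B \<and> B \<subseteq> I \<and> h \<in> borel_measurable (Pi\<^sub>M B (\<lambda>_. N)) \<and>
      integrable M (\<lambda>x. h (restrict x B)) \<and> (\<integral>x. \<bar>f x + g x - h (restrict x B)\<bar> \<partial>M) < \<epsilon>"
    using h h' by (intro exI[of _ ?C] exI[of _ ?k]) auto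
qed

lemma cylinder_approximable_scale:
  assumes f: "integrable M f" "cylinder_approximable I N M f"
  shows "cylinder_approximable I N M (\<lambda>x. c * f x)"
  unfolding cylinder_approximable_def
proof (intro allI impI)
  fix \<epsilon> :: real assume "\<epsilon> > 0"
  then have "\<epsilon> / (\<bar>c\<bar> + 1) > 0" by simp
  with f(2) obtain B h where h: "finite B" "B \<subseteq> I" "h \<in> borel_measurable (Pi\<^sub>M B (\<lambda>_. N))"
    "integrable M (\<lambda>x. h (restrict x B))" "(\<integral>x. \<bar>f x - h (restrict x B)\<bar> \<partial>M) < \<epsilon> / (\<bar>c\<bar> + 1)"
    unfolding cylinder_approximable_def by meson
  have "(\<integral>x. \<bar>c * f x - c * h (restrict x B)\<bar> \<partial>M) = \<bar>c\<bar> * (\<integral>x. \<bar>f x - h (restrict x B)\<bar> \<partial>M)"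
    by (simp add: right_diff_distrib[symmetric] abs_mult)
  also have "\<dots> \<le> (\<bar>c\<bar> + 1) * (\<integral>x. \<bar>f x - h (restrict x B)\<bar> \<partial>M)"
    by (intro mult_right_mono) auto
  also have "\<dots> < \<epsilon>"
    using h(5) by (simp add: field_simps)
  finally show "\<exists>B h. finite B \<and> B \<subseteq> I \<and> h \<in> borel_measurable (Pi\<^sub>M B (\<lambda>_. N)) \<and>
      integrable M (\<lambda>x. h (restrict x B)) \<and> (\<integral>x. \<bar>c * f x - h (restrict x B)\<bar> \<partial>M) < \<epsilon>"
    using h by (intro exI[of _ B] exI[of _ "\<lambda>x. c * h x"]) auto
qed

lemma cylinder_approximable_cylinder:
  assumes "finite B" "B \<subseteq> I" "h \<in> borel_measurable (Pi\<^sub>M B (\<lambda>_. N))" "integrable M f"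
    and "\<And>x. x \<in> space M \<Longrightarrow> f x = h (restrict x B)"
  shows "cylinder_approximable I N M f"
proof -
  have "integrable M (\<lambda>x. h (restrict x B))"
    using assms(4) by (subst Bochner_Integration.integrable_cong[OF refl, of _ _ f]) (auto simp: assms(5))
  moreover have "(\<integral>x. \<bar>f x - h (restrict x B)\<bar> \<partial>M) = (\<integral>x. 0 \<partial>M)"
    by (intro Bochner_Integration.integral_cong) (auto simp: assms(5))
  ultimately show ?thesis
    unfolding cylinder_approximable_def using assms(1-3) by (auto intro!: exI[of _ B] exI[of _ h])
qed

text \<open>Dynkin's argument: boxes depend on finitely many coordinates, complements are
  differences from 1, and for disjoint unions the partial sums converge in L1.\<close>

lemma cylinder_approximable_indicator:
  assumes "A \<in> sets M"
  shows "cylinder_approximable I N M (indicator A)"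
proof -
  have sp: "space M = (\<Pi>\<^sub>E i\<in>I. space N)"
    using sets_eq_imp_space_eq[OF sets_M] by (simp add: space_PiM)
  have A: "A \<in> sigma_sets (\<Pi>\<^sub>E i\<in>I. space N) (prod_algebra I (\<lambda>_. N))"
    using assms by (simp add: sets_M sets_PiM)
  have subM: "sigma_sets (\<Pi>\<^sub>E i\<in>I. space N) (prod_algebra I (\<lambda>_. N)) = sets M"
    by (simp add: sets_M sets_PiM)
  show ?thesis
    using Int_stable_prod_algebra prod_algebra_sets_into_space A
  proof (induction rule: sigma_sets_induct_disjoint)
    case (basic A)
    then obtain J E where JE: "A = prod_emb I (\<lambda>_. N) J (Pi\<^sub>E J E)" "finite J" "J \<subseteq> I" "\<And>i. i \<in> J \<Longrightarrow> E i \<in> sets N"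
      by (elim prod_algebraE) auto
    have AM: "A \<in> sets M"
      using basic subM by blast
    show ?case
    proof (rule cylinder_approximable_cylinder[OF JE(2,3)])
      show "(indicator (Pi\<^sub>E J E) :: _ \<Rightarrow> real) \<in> borel_measurable (Pi\<^sub>M J (\<lambda>_. N))"
        using JE by (intro borel_measurable_indicator sets_PiM_I_finite) auto
      show "integrable M (indicator A :: _ \<Rightarrow> real)"
        using AM by (simp add: integrable_indicator_iff less_top[symmetric])
      show "indicator A x = indicator (Pi\<^sub>E J E) (restrict x J)" if "x \<in> space M" for x
        using that by (auto simp: JE(1) prod_emb_def sp indicator_def)
    qed
  next
    case empty
    show ?case
      by (rule cylinder_approximable_cylinder[of "{}" "\<lambda>_. 0"]) auto
  next
    case (compl A)
    then have AM: "A \<in> sets M" using subM by simp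
    have "cylinder_approximable I N M (\<lambda>x. 1 + (-1) * indicator A x)"
    proof (intro cylinder_approximable_add cylinder_approximable_scale compl)
      show "cylinder_approximable I N M (\<lambda>x. 1)"
        by (rule cylinder_approximable_cylinder[of "{}" "\<lambda>_. 1"]) auto
    qed (use AM in \<open>simp_all add: integrable_indicator_iff less_top[symmetric]\<close>)
    then show ?case
      by (rule cylinder_approximable_cong) (auto simp: sp indicator_def)
  next
    case (union A)
    then have AM: "A i \<in> sets M" for i using subM by blast
    have UM: "(\<Union>i. A i) \<in> sets M" using AM by blast
    have int: "integrable M (indicator C :: _ \<Rightarrow> real)" if "C \<in> sets M" for C
      using that by (simp add: integrable_indicator_iff less_top[symmetric])
    define s :: "nat \<Rightarrow> _ \<Rightarrow> real" where "s n x = (\<Sum>i<n. indicator (A i) x)" for n x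
    have s: "cylinder_approximable I N M (s n) \<and> integrable M (s n)" for n
    proof (induction n)
      case 0
      then show ?case
        unfolding s_def by (auto intro!: cylinder_approximable_cylinder[of "{}" "\<lambda>_. 0"])
    next
      case (Suc n)
      then show ?case
        unfolding s_def using union(3)[of n] int[OF AM, of n] by (auto intro: cylinder_approximable_add)
    qed
    have s_eq: "s n x = indicator (\<Union>i<n. A i) x" for n x
      unfolding s_def using union(1)
      by (subst indicator_UN_disjoint) (auto simp: disjoint_family_on_def)
    have "(\<lambda>n. \<integral>x. \<bar>indicator (\<Union>i. A i) x - s n x\<bar> \<partial>M) \<longlonglongrightarrow> (\<integral>x. 0 \<partial>M)"
    proof (rule integral_dominated_convergence[where w="\<lambda>_. 1"])
      show "AE x in M. (\<lambda>n. \<bar>indicator (\<Union>i. A i) x - s n x\<bar>) \<longlonglongrightarrow> 0"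
      proof (intro AE_I2)
        fix x
        show "(\<lambda>n. \<bar>indicator (\<Union>i. A i) x - s n x\<bar>) \<longlonglongrightarrow> 0"
        proof (cases "x \<in> (\<Union>i. A i)")
          case True
          then obtain i where "x \<in> A i" by blast
          then have "\<forall>\<^sub>F n in sequentially. \<bar>indicator (\<Union>i. A i) x - s n x\<bar> = 0"
            unfolding eventually_sequentially s_eq by (intro exI[of _ "Suc i"]) (auto simp: indicator_def)
          then show ?thesis by (rule tendsto_eventually)
        next
          case False
          then show ?thesis by (simp add: s_eq)
        qed
      qed
      show "AE x in M. norm \<bar>indicator (\<Union>i. A i) x - s n x\<bar> \<le> 1" for n
        unfolding s_eq by (intro AE_I2) (auto simp: indicator_def)
      show "(\<lambda>x. \<bar>indicator (\<Union>i. A i) x - s n x\<bar>) \<in> borel_measurable M" for n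
        using borel_measurable_integrable[OF s[of n, THEN conjunct2]] UM by measurable
    qed simp_all
    then have lim: "(\<lambda>n. \<integral>x. \<bar>indicator (\<Union>i. A i) x - s n x\<bar> \<partial>M) \<longlonglongrightarrow> 0" by simp
    show ?case
    proof (rule cylinder_approximable_limit[OF int[OF UM]])
      fix \<epsilon> :: real assume "\<epsilon> > 0"
      from order_tendstoD(2)[OF lim this] obtain n where "(\<integral>x. \<bar>indicator (\<Union>i. A i) x - s n x\<bar> \<partial>M) < \<epsilon>"
        by (auto simp: eventually_sequentially)
      then show "\<exists>g. cylinder_approximable I N M g \<and> integrable M g \<and> (\<integral>x. \<bar>indicator (\<Union>i. A i) x - g x\<bar> \<partial>M) < \<epsilon>"
        using s[of n] by blast
    qed
  qed
qed

text \<open>Combinations of indicators are settled, and an integrable function is an L1 limit of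
  simple ones.\<close>

lemma cylinder_approximableI:
  assumes "integrable M f"
  shows "cylinder_approximable I N M f"
  using assms
proof (induction rule: integrable_induct)
  case (base A c)
  have "cylinder_approximable I N M (\<lambda>x. c * indicator A x)"
    using base by (intro cylinder_approximable_scale cylinder_approximable_indicator)
      (auto simp: integrable_indicator_iff less_top[symmetric])
  then show ?case by (simp add: mult.commute)
next
  case (add f g)
  then show ?case by (intro cylinder_approximable_add)
next
  case (lim f s)
  have "(\<lambda>n. \<integral>x. \<bar>f x - s n x\<bar> \<partial>M) \<longlonglongrightarrow> (\<integral>x. 0 \<partial>M)"
  \<comment> \<open>The simple functions satisfy
    \<open>\<bar>s n x\<bar> \<le> 2 * \<bar>f x\<bar>\<close>, hence the factor 3.\<close>
  proof (rule integral_dominated_convergence[where w="\<lambda>x. 3 * \<bar>f x\<bar>"])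
    show "AE x in M. (\<lambda>n. \<bar>f x - s n x\<bar>) \<longlonglongrightarrow> 0"
    proof (intro AE_I2)
      fix x assume "x \<in> space M"
      then have "(\<lambda>n. \<bar>f x - s n x\<bar>) \<longlonglongrightarrow> \<bar>f x - f x\<bar>"
        by (intro tendsto_intros lim.hyps(2))
      then show "(\<lambda>n. \<bar>f x - s n x\<bar>) \<longlonglongrightarrow> 0" by simp
    qed
    show "AE x in M. norm \<bar>f x - s n x\<bar> \<le> 3 * \<bar>f x\<bar>" for n
    proof (intro AE_I2)
      fix x assume "x \<in> space M"
      from lim.hyps(3)[OF this, of n] show "norm \<bar>f x - s n x\<bar> \<le> 3 * \<bar>f x\<bar>" by simp
    qed
    show "(\<lambda>x. \<bar>f x - s n x\<bar>) \<in> borel_measurable M" for n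
      using borel_measurable_integrable[OF lim.hyps(1)[of n]] borel_measurable_integrable[OF lim.hyps(4)] by measurable
    show "integrable M (\<lambda>x. 3 * \<bar>f x\<bar>)" using lim.hyps(4) by simp
  qed simp
  then have l: "(\<lambda>n. \<integral>x. \<bar>f x - s n x\<bar> \<partial>M) \<longlonglongrightarrow> 0" by simp
  show ?case
  proof (rule cylinder_approximable_limit[OF lim.hyps(4)])
    fix \<epsilon> :: real assume "\<epsilon> > 0"
    from order_tendstoD(2)[OF l this] obtain n where "(\<integral>x. \<bar>f x - s n x\<bar> \<partial>M) < \<epsilon>"
      by (auto simp: eventually_sequentially)
    then show "\<exists>g. cylinder_approximable I N M g \<and> integrable M g \<and> (\<integral>x. \<bar>f x - g x\<bar> \<partial>M) < \<epsilon>"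
      using lim.hyps(1)[of n] lim.IH[of n] by blast
  qed
qed

end

text \<open>The test function \<open>indicator A x * sgn (f x)\<close> attains the L1 norm of
  \<open>f\<close> on \<open>A\<close>. This compares densities that are known only through their
  integrals against bounded functions.\<close>

lemma integral_abs_le_dual:
  fixes f :: "'a \<Rightarrow> real"
  assumes [measurable]: "f \<in> borel_measurable M" "A \<in> sets M"
    and le: "\<And>s. s \<in> borel_measurable M \<Longrightarrow> (\<And>x. \<bar>s x\<bar> \<le> 1) \<Longrightarrow> (\<And>x. x \<notin> A \<Longrightarrow> s x = 0) \<Longrightarrow> (\<integral>x. s x * f x \<partial>M) \<le> c"
  shows "(\<integral>x. indicator A x * \<bar>f x\<bar> \<partial>M) \<le> c"
proof -
  have [measurable]: "(\<lambda>x. sgn (f x)) \<in> borel_measurable M"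
    using borel_measurable_sgn assms(1) by measurable
  have "(\<integral>x. indicator A x * \<bar>f x\<bar> \<partial>M) = (\<integral>x. (indicator A x * sgn (f x)) * f x \<partial>M)"
    by (intro Bochner_Integration.integral_cong) (auto simp: abs_sgn mult_ac)
  also have "\<dots> \<le> c"
    by (rule le) (auto simp: abs_mult indicator_def sgn_if)
  finally show ?thesis .
qed

section \<open>Stationary actions\<close>

text \<open>The semigroup is exhausted in countably many stages, each adding all products of two
  earlier elements. As the support of a pmf is countable, a generating measure makes the group
  countable.\<close>

lemma countable_semigroup_generate:
  assumes "countable S"
  shows "countable (semigroup_generate G S)"
proof -
  define T where "T = rec_nat S (\<lambda>n A. A \<union> (\<lambda>(a, b). a \<otimes>\<^bsub>G\<^esub> b) ` (A \<times> A))"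
  have T_Suc: "T (Suc n) = T n \<union> (\<lambda>(a, b). a \<otimes>\<^bsub>G\<^esub> b) ` (T n \<times> T n)" and T_0: "T 0 = S" for n
    by (simp_all add: T_def)
  have mono: "T n \<subseteq> T m" if "n \<le> m" for n m
    using that by (induction rule: dec_induct) (auto simp: T_Suc)
  have "semigroup_generate G S \<subseteq> (\<Union>n. T n)"
  proof
    fix x assume "x \<in> semigroup_generate G S"
    then show "x \<in> (\<Union>n. T n)"
    proof induction
      case (incl s)
      then show ?case using T_0 by blast
    next
      case (mult a b)
      then obtain n m where "a \<in> T n" "b \<in> T m" by blast
      then have "a \<in> T (max n m)" "b \<in> T (max n m)"
        using mono[of n "max n m"] mono[of m "max n m"] by auto
      then have "a \<otimes>\<^bsub>G\<^esub> b \<in> T (Suc (max n m))" by (auto simp: T_Suc)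
      then show ?case by blast
    qed
  qed
  moreover have "countable (T n)" for n
    by (induction n) (use assms in \<open>auto simp: T_0 T_Suc\<close>)
  ultimately show ?thesis
    by (meson countable_UN countable_subset uncountable_def countableI_type)
qed

lemma standard_borelI:
  assumes "completely_metrizable_space T" "second_countable T" "space M = topspace T"
    "sets M = sigma_sets (topspace T) {U. openin T U}"
  shows "standard_borel M"
  using assms unfolding standard_borel_def by blast

text \<open>Here \<open>g\<nu>\<close> enters through preimages and the average over
  \<open>g\<close> as a Bochner expectation, which suits integration better than the
  \<open>push\<close> and the infinite sum of \<open>stationary_space\<close>;
  \<open>stationary_spaceI\<close> converts back.\<close>

locale stationary_action = group_action G "space \<nu>" act + prob_space \<nu>
  for G :: "('a, 'b) monoid_scheme" (structure) and \<mu> :: "'a pmf"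
    and \<nu> :: "'x measure" and act :: "'a \<Rightarrow> 'x \<Rightarrow> 'x" +
  assumes gen: "generating G \<mu>"
    and meas_act: "g \<in> carrier G \<Longrightarrow> act g \<in> \<nu> \<rightarrow>\<^sub>M \<nu>"
    and stationary: "E \<in> sets \<nu> \<Longrightarrow>
      measure_pmf.expectation \<mu> (\<lambda>g. measure \<nu> (act g -` E \<inter> space \<nu>)) = measure \<nu> E"
begin

sublocale group G
  using group_hom by (simp add: group_hom_def)

lemma set_pmf_subset: "set_pmf \<mu> \<subseteq> carrier G"
  using gen semigroup_generate.incl[of _ "set_pmf \<mu>" G] by (auto simp: generating_def)

lemma AE_carrier: "AE g in measure_pmf \<mu>. g \<in> carrier G"
  using set_pmf_subset by (auto simp: AE_measure_pmf_iff)

lemma generating_induct [consumes 1, case_names incl mult]: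
  assumes "g \<in> carrier G" "\<And>s. s \<in> set_pmf \<mu> \<Longrightarrow> P s"
    and "\<And>a b. a \<in> carrier G \<Longrightarrow> b \<in> carrier G \<Longrightarrow> P a \<Longrightarrow> P b \<Longrightarrow> P (a \<otimes> b)"
  shows "P g"
proof -
  have "g \<in> semigroup_generate G (set_pmf \<mu>)"
    using assms(1) gen by (simp add: generating_def)
  then show ?thesis
  proof induction
    case (mult a b)
    then show ?case using assms(3) gen by (simp add: generating_def)
  qed (rule assms(2))
qed

lemma act_space: "g \<in> carrier G \<Longrightarrow> x \<in> space \<nu> \<Longrightarrow> act g x \<in> space \<nu>"
  using meas_act measurable_space by metis

lemma act_mult: "g \<in> carrier G \<Longrightarrow> h \<in> carrier G \<Longrightarrow> x \<in> space \<nu> \<Longrightarrow> act (g \<otimes> h) x = act g (act h x)"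
  by (rule composition_rule)

lemma act_one: "x \<in> space \<nu> \<Longrightarrow> act \<one> x = x"
  using id_eq_one by (metis restrict_apply')

lemma act_inv: "g \<in> carrier G \<Longrightarrow> x \<in> space \<nu> \<Longrightarrow> act (inv g) (act g x) = x"
  by (simp add: act_mult[symmetric] act_one)

lemma act_inv': "g \<in> carrier G \<Longrightarrow> x \<in> space \<nu> \<Longrightarrow> act g (act (inv g) x) = x"
  by (simp add: act_mult[symmetric] act_one)

lemma prob_space_push: "g \<in> carrier G \<Longrightarrow> prob_space (push act g \<nu>)"
  unfolding push_def by (intro prob_space_distr meas_act)

lemma sets_push [simp, measurable_cong]: "sets (push act g \<nu>) = sets \<nu>"
  by (simp add: push_def)

lemma space_push [simp]: "space (push act g \<nu>) = space \<nu>"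
  by (simp add: push_def)

lemma measure_push:
  "g \<in> carrier G \<Longrightarrow> E \<in> sets \<nu> \<Longrightarrow> measure (push act g \<nu>) E = measure \<nu> (act g -` E \<inter> space \<nu>)"
  unfolding push_def by (intro measure_distr meas_act)

lemma vimage_act_sets: "g \<in> carrier G \<Longrightarrow> E \<in> sets \<nu> \<Longrightarrow> act g -` E \<inter> space \<nu> \<in> sets \<nu>"
  using measurable_sets[OF meas_act] .

lemma integrable_measure_act: "integrable (measure_pmf \<mu>) (\<lambda>g. measure \<nu> (act g -` E \<inter> space \<nu>))"
  by (intro measure_pmf.integrable_const_bound[where B=1]) auto

text \<open>One term of the stationarity average is at most the whole. All bounds on densities come
  from this.\<close>

lemma mult_measure_push_le:
  assumes "g \<in> set_pmf \<mu>" "E \<in> sets \<nu>"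
  shows "pmf \<mu> g * measure (push act g \<nu>) E \<le> measure \<nu> E"
proof -
  have g: "g \<in> carrier G" using assms set_pmf_subset by blast
  have "pmf \<mu> g * measure (push act g \<nu>) E = measure_pmf.expectation \<mu> (\<lambda>h. indicator {g} h * measure \<nu> (act g -` E \<inter> space \<nu>))"
    unfolding measure_push[OF g assms(2)]
    by (subst integral_measure_pmf_real[of "{g}"]) (auto simp: indicator_def split: if_splits)
  also have "\<dots> \<le> measure_pmf.expectation \<mu> (\<lambda>g. measure \<nu> (act g -` E \<inter> space \<nu>))"
    by (intro integral_mono integrable_measure_act measure_pmf.integrable_const_bound[where B=1])
      (auto simp: indicator_def)
  finally show ?thesis using stationary[OF assms(2)] by simp
qed

text \<open>By stationarity a \<nu>-null set is null for \<open>g\<nu>\<close> if \<open>g\<close>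
  lies in the support, hence for all \<open>g\<close>, since the support generates the group as a
  semigroup. Applied to the inverse of \<open>g\<close> this is the claim.\<close>

lemma null_of_push_null:
  assumes g: "g \<in> carrier G" and E: "E \<in> sets \<nu>" and null: "measure \<nu> (act g -` E \<inter> space \<nu>) = 0"
  shows "measure \<nu> E = 0"
proof -
  have *: "measure \<nu> (act h -` N \<inter> space \<nu>) = 0" if "h \<in> carrier G" "N \<in> sets \<nu>" "measure \<nu> N = 0" for h N
    using that
  proof (induction arbitrary: N rule: generating_induct)
    case (incl s)
    then have "pmf \<mu> s * measure \<nu> (act s -` N \<inter> space \<nu>) \<le> 0"
      using mult_measure_push_le[of s N] measure_push[of s N] set_pmf_subset by auto
    then show ?case
      using incl by (simp add: mult_le_0_iff set_pmf_iff order.antisym measure_le_0_iff pmf_le_0_iff)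
  next
    case (mult a b)
    have "act (a \<otimes> b) -` N \<inter> space \<nu> = act b -` (act a -` N \<inter> space \<nu>) \<inter> space \<nu>"
      using mult by (auto simp: act_mult act_space)
    moreover have "measure \<nu> (act b -` (act a -` N \<inter> space \<nu>) \<inter> space \<nu>) = 0"
      using mult by (intro mult.IH(2) vimage_act_sets mult.IH(1))
    ultimately show ?case by (simp only:)
  qed
  have "E = act (inv g) -` (act g -` E \<inter> space \<nu>) \<inter> space \<nu>"
    using g sets.sets_into_space[OF E] by (auto simp: act_inv' act_space)
  then show ?thesis
    using *[of "inv g" "act g -` E \<inter> space \<nu>"] g E null vimage_act_sets by simp
qed

text \<open>The bound on the derivative is \<open>\<mu>(g) g\<nu> \<le> \<nu>\<close>; it is positive since all translates are equivalent.\<close>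

lemma push_density:
  assumes g: "g \<in> set_pmf \<mu>"
  obtains r where "r \<in> borel_measurable \<nu>" "\<And>x. 0 < r x" "\<And>x. r x \<le> 1 / pmf \<mu> g"
    "push act g \<nu> = density \<nu> (\<lambda>x. ennreal (r x))"
proof -
  let ?P = "push act g \<nu>" and ?c = "1 / pmf \<mu> g"
  have gG: "g \<in> carrier G" using g set_pmf_subset by blast
  have pos: "pmf \<mu> g > 0" using g by (simp add: pmf_positive)
  interpret P: prob_space ?P by (rule prob_space_push[OF gG])
  have le: "emeasure ?P E \<le> ennreal ?c * emeasure \<nu> E" if "E \<in> sets \<nu>" for E
    using mult_measure_push_le[OF g that] pos
    by (simp add: P.emeasure_eq_measure emeasure_eq_measure ennreal_mult[symmetric] field_simps)
  have "absolutely_continuous \<nu> ?P"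
    unfolding absolutely_continuous_def null_sets_def using le by (fastforce simp: le_zero_eq)
  then have dens: "density \<nu> (RN_deriv \<nu> ?P) = ?P"
    by (intro density_RN_deriv) simp_all
  let ?f = "RN_deriv \<nu> ?P"
  have em: "emeasure ?P E = (\<integral>\<^sup>+x. ?f x * indicator E x \<partial>\<nu>)" if "E \<in> sets \<nu>" for E
    by (subst dens[symmetric]) (simp add: emeasure_density that)
  have fin: "AE x in \<nu>. ?f x \<noteq> \<infinity>"
    by (rule RN_deriv_finite) (use \<open>absolutely_continuous \<nu> ?P\<close> in \<open>simp_all add: P.sigma_finite_measure_axioms\<close>)
  have up: "AE x in \<nu>. ?f x \<le> ennreal ?c"
  proof -
    \<comment> \<open>With a slack \<open>e\<close> the chain below reads
      \<open>(?c + e) * measure \<nu> ?E \<le> ?c * measure \<nu> ?E\<close>, which forces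
      \<open>?E\<close> to be null; the slack is then removed along
      \<open>1 / Suc n\<close>.\<close>
    have "AE x in \<nu>. ?f x \<le> ennreal ?c + ennreal e" if "e > 0" for e
    proof -
      let ?E = "{x \<in> space \<nu>. \<not> ?f x \<le> ennreal ?c + ennreal e}"
      have E: "?E \<in> sets \<nu>" by measurable
      have "(ennreal ?c + ennreal e) * emeasure \<nu> ?E = (\<integral>\<^sup>+x. (ennreal ?c + ennreal e) * indicator ?E x \<partial>\<nu>)"
        using E by (simp add: nn_integral_cmult_indicator)
      also have "\<dots> \<le> (\<integral>\<^sup>+x. ?f x * indicator ?E x \<partial>\<nu>)"
        by (intro nn_integral_mono) (auto simp: indicator_def not_le)
      also have "\<dots> \<le> ennreal ?c * emeasure \<nu> ?E"
        using em[OF E] le[OF E] by simp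
      finally have "(?c + e) * measure \<nu> ?E \<le> ?c * measure \<nu> ?E"
        using pos that by (simp add: emeasure_eq_measure ennreal_plus[symmetric] ennreal_mult[symmetric] del: ennreal_plus)
      then have "measure \<nu> ?E = 0"
        using that by (simp add: distrib_right mult_le_0_iff order.antisym measure_le_0_iff)
      then show ?thesis
        using E by (subst AE_iff_measurable[OF _ refl]) (simp_all add: emeasure_eq_measure)
    qed
    then have "AE x in \<nu>. \<forall>n::nat. ?f x \<le> ennreal ?c + ennreal (1 / Suc n)"
      by (subst AE_all_countable) simp
    then show ?thesis
    proof eventually_elim
      case (elim x)
      have "(\<lambda>n. ennreal ?c + ennreal (1 / Suc n)) \<longlonglongrightarrow> ennreal ?c + ennreal 0"
        by (intro tendsto_add tendsto_const tendsto_ennrealI LIMSEQ_Suc lim_1_over_n)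
      then show ?case
        using elim by (intro LIMSEQ_le_const[of _ "ennreal ?c"]) auto
    qed
  qed
  have low: "AE x in \<nu>. ?f x \<noteq> 0"
  proof -
    let ?E = "{x \<in> space \<nu>. \<not> ?f x \<noteq> 0}"
    have E: "?E \<in> sets \<nu>" by measurable
    have "emeasure ?P ?E = (\<integral>\<^sup>+x. 0 \<partial>\<nu>)"
      unfolding em[OF E] by (intro nn_integral_cong) (auto simp: indicator_def)
    then have "measure \<nu> ?E = 0"
      using null_of_push_null[OF gG E] measure_push[OF gG E] by (simp add: P.emeasure_eq_measure)
    then show ?thesis
      using E by (subst AE_iff_measurable[OF _ refl]) (simp_all add: emeasure_eq_measure)
  qed
  \<comment> \<open>The derivative is changed on a null set, to the admissible value
    \<open>?c\<close>, so that positivity and the upper bound hold everywhere.\<close>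
  define r where "r x = (if ?f x \<noteq> 0 \<and> ?f x \<le> ennreal ?c then enn2real (?f x) else ?c)" for x
  have r_eq: "ennreal (r x) = ?f x" if "?f x \<noteq> 0" "?f x \<le> ennreal ?c" for x
    using that le_less_trans[OF that(2) ennreal_less_top] by (simp add: r_def)
  from low up have "AE x in \<nu>. ?f x = ennreal (r x)"
  proof eventually_elim
    case (elim x)
    then show ?case using r_eq[of x] by simp
  qed
  then have "density \<nu> ?f = density \<nu> (\<lambda>x. ennreal (r x))"
    by (intro density_cong) (simp_all add: r_def)
  then have "?P = density \<nu> (\<lambda>x. ennreal (r x))" using dens by simp
  moreover have "r \<in> borel_measurable \<nu>" unfolding r_def by measurable
  moreover have "0 < r x \<and> r x \<le> ?c" for x
  proof (cases "?f x \<noteq> 0 \<and> ?f x \<le> ennreal ?c")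
    case True
    then have "enn2real (?f x) \<le> ?c" using pos by (intro enn2real_leI) auto
    moreover have "0 < enn2real (?f x)"
      using True by (auto simp: enn2real_positive_iff top_unique less_top[symmetric] zero_less_iff_neq_zero le_less_trans)
    ultimately show ?thesis using True by (simp add: r_def)
  qed (use pos in \<open>auto simp: r_def\<close>)
  ultimately show ?thesis using that by blast
qed

text \<open>The Kullback-Leibler divergence of \<open>g\<nu>\<close> from \<nu>: the Furstenberg
  entropy is its \<mu>-average.\<close>

definition kl :: "'a \<Rightarrow> real" where
  "kl g = (\<integral>x. - ln (enn2real (RN_deriv (push act g \<nu>) \<nu> x)) \<partial>(push act g \<nu>))"

lemma kl_eq:
  assumes "r \<in> borel_measurable \<nu>" "\<And>x. x \<in> space \<nu> \<Longrightarrow> 0 < r x"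
    "push act g \<nu> = density \<nu> (\<lambda>x. ennreal (r x))"
  shows "kl g = (\<integral>x. r x * ln (r x) \<partial>\<nu>)"
  unfolding kl_def by (rule integral_neg_ln_RN_deriv[OF sigma_finite_measure_axioms assms])

lemma density_integral_1:
  assumes "g \<in> carrier G" "r \<in> borel_measurable \<nu>" "\<And>x. 0 \<le> r x"
    "push act g \<nu> = density \<nu> (\<lambda>x. ennreal (r x))"
  shows "integrable \<nu> r" "(\<integral>x. r x \<partial>\<nu>) = 1"
proof -
  interpret P: prob_space "push act g \<nu>" by (rule prob_space_push[OF assms(1)])
  have "(\<integral>\<^sup>+x. ennreal (r x) \<partial>\<nu>) = 1"
    using P.emeasure_space_1 assms(2,3) by (simp add: assms(4) emeasure_density cong: nn_integral_cong)
  then have "has_bochner_integral \<nu> r 1"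
    using assms by (intro has_bochner_integral_nn_integral) auto
  then show "integrable \<nu> r" "(\<integral>x. r x \<partial>\<nu>) = 1"
    by (auto simp: has_bochner_integral_iff)
qed

text \<open>Integrate \<open>mult_ln_bounds\<close> for the density of \<open>g\<nu>\<close>, which
  is at most \<open>1 / pmf \<mu> g\<close> and has integral 1.\<close>

lemma kl_bounds:
  assumes g: "g \<in> set_pmf \<mu>"
  shows "0 \<le> kl g" "kl g \<le> - ln (pmf \<mu> g)"
proof -
  obtain r where r[measurable]: "r \<in> borel_measurable \<nu>" and r': "\<And>x. 0 < r x" "\<And>x. r x \<le> 1 / pmf \<mu> g"
    "push act g \<nu> = density \<nu> (\<lambda>x. ennreal (r x))"
    using push_density[OF g] by blast
  have gG: "g \<in> carrier G" using g set_pmf_subset by blast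
  note 1 = density_integral_1[OF gG r less_imp_le[OF r'(1)] r'(3)]
  have kl: "kl g = (\<integral>x. r x * ln (r x) \<partial>\<nu>)" using r r' by (intro kl_eq) auto
  have b: "r x - 1 \<le> r x * ln (r x)" "r x * ln (r x) \<le> r x * ln (1 / pmf \<mu> g)" for x
    using mult_ln_bounds[OF r'(1,2)] by auto
  have int: "integrable \<nu> (\<lambda>x. r x * ln (r x))"
  proof (rule Bochner_Integration.integrable_bound)
    show "integrable \<nu> (\<lambda>x. \<bar>r x - 1\<bar> + \<bar>r x * ln (1 / pmf \<mu> g)\<bar>)" using 1 by auto
    show "AE x in \<nu>. norm (r x * ln (r x)) \<le> norm (\<bar>r x - 1\<bar> + \<bar>r x * ln (1 / pmf \<mu> g)\<bar>)"
      using b by (intro AE_I2) (smt (verit, best) real_norm_def)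
  qed simp
  have "(\<integral>x. r x - 1 \<partial>\<nu>) \<le> kl g"
    unfolding kl using 1 int b by (intro integral_mono) auto
  then show "0 \<le> kl g" using 1 prob_space by simp
  have "kl g \<le> (\<integral>x. r x * ln (1 / pmf \<mu> g) \<partial>\<nu>)"
    unfolding kl using 1 int b by (intro integral_mono) auto
  then show "kl g \<le> - ln (pmf \<mu> g)"
    using 1 pmf_positive[OF g] by (simp add: ln_div)
qed

text \<open>The bound \<open>- ln (pmf \<mu> g)\<close> of \<open>kl g\<close> has the entropy of
  \<mu> as its integral, so finite entropy makes the defining sum absolutely convergent.\<close>

lemma furstenberg_entropy_eq:
  assumes fin: "pmf_entropy \<mu> < \<infinity>"
  shows "integrable (measure_pmf \<mu>) (\<lambda>g. - ln (pmf \<mu> g))"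
    and "furstenberg_entropy G \<mu> \<nu> act = measure_pmf.expectation \<mu> kl"
proof -
  have "(\<integral>\<^sup>+g. ennreal (- ln (pmf \<mu> g)) \<partial>measure_pmf \<mu>) = pmf_entropy \<mu>"
    unfolding pmf_entropy_def nn_integral_measure_pmf
    by (intro nn_integral_cong) (simp add: ennreal_mult'[symmetric])
  moreover have "AE g in measure_pmf \<mu>. 0 \<le> - ln (pmf \<mu> g)"
    by (auto simp: AE_measure_pmf_iff pmf_le_1 pmf_positive)
  ultimately show ent: "integrable (measure_pmf \<mu>) (\<lambda>g. - ln (pmf \<mu> g))"
    using fin by (intro integrableI_nonneg) auto
  have "integrable (measure_pmf \<mu>) kl"
  proof (rule Bochner_Integration.integrable_bound[OF ent])
    show "AE g in measure_pmf \<mu>. norm (kl g) \<le> norm (- ln (pmf \<mu> g))"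
      using kl_bounds by (fastforce simp: AE_measure_pmf_iff)
  qed simp
  then show "furstenberg_entropy G \<mu> \<nu> act = measure_pmf.expectation \<mu> kl"
    unfolding furstenberg_entropy_def kl_def[symmetric]
    by (intro infsum_pmf_mult set_pmf_subset)
qed

lemma stationary_spaceI:
  assumes "standard_borel \<nu>"
  shows "stationary_space G \<mu> \<nu> act"
  unfolding stationary_space_def
proof (intro conjI ballI)
  fix E assume E: "E \<in> sets \<nu>"
  have "(\<Sum>\<^sub>\<infinity>g\<in>carrier G. pmf \<mu> g * measure (push act g \<nu>) E) =
      (\<Sum>\<^sub>\<infinity>g\<in>carrier G. pmf \<mu> g * measure \<nu> (act g -` E \<inter> space \<nu>))"
    using E by (intro infsum_cong) (simp add: measure_push)
  also have "\<dots> = measure \<nu> E"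
    using E by (simp add: infsum_pmf_mult[OF set_pmf_subset integrable_measure_act] stationary)
  finally show "(\<Sum>\<^sub>\<infinity>g\<in>carrier G. pmf \<mu> g * measure (push act g \<nu>) E) = measure \<nu> E" .
qed (use assms meas_act prob_space_axioms group_action_axioms in auto)

text \<open>Stationarity says that \<nu> is the mixture of its translates, a monadic bind, against
  which bounded functions are integrated iteratedly.\<close>

lemma integral_stationary:
  fixes f :: "'x \<Rightarrow> real"
  assumes [measurable]: "f \<in> borel_measurable \<nu>" and bound: "\<And>x. x \<in> space \<nu> \<Longrightarrow> \<bar>f x\<bar> \<le> C"
  shows "(\<integral>x. f x \<partial>\<nu>) = measure_pmf.expectation \<mu> (\<lambda>g. \<integral>x. f (act g x) \<partial>\<nu>)"
proof -
  \<comment> \<open>Nothing is known of \<open>act g\<close> outside the carrier; the value \<nu>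
    there makes \<open>K\<close> a probability kernel everywhere.\<close>
  define K where "K g = (if g \<in> carrier G then push act g \<nu> else \<nu>)" for g
  have K: "prob_space (K g)" "sets (K g) = sets \<nu>" for g
    using prob_space_push prob_space_axioms by (auto simp: K_def)
  have meas: "K \<in> measure_pmf \<mu> \<rightarrow>\<^sub>M subprob_algebra \<nu>"
    using K by (auto simp: space_subprob_algebra prob_space_imp_subprob_space)
  have "\<nu> = measure_pmf \<mu> \<bind> K"
  proof (rule measure_eqI)
    show "sets \<nu> = sets (measure_pmf \<mu> \<bind> K)"
      using K by simp
    fix E assume E: "E \<in> sets \<nu>"
    have "emeasure (measure_pmf \<mu> \<bind> K) E = (\<integral>\<^sup>+g. emeasure (K g) E \<partial>measure_pmf \<mu>)"
      by (rule emeasure_bind[OF _ meas E]) simp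
    also have "\<dots> = (\<integral>\<^sup>+g. ennreal (measure \<nu> (act g -` E \<inter> space \<nu>)) \<partial>measure_pmf \<mu>)"
      using AE_carrier
    proof (intro nn_integral_cong_AE, eventually_elim)
      case (elim g)
      then interpret P: prob_space "push act g \<nu>" by (intro prob_space_push)
      show ?case using elim E by (simp add: K_def measure_push P.emeasure_eq_measure)
    qed
    also have "\<dots> = ennreal (measure \<nu> E)"
      using stationary[OF E] integrable_measure_act by (subst nn_integral_eq_integral) auto
    finally show "emeasure \<nu> E = emeasure (measure_pmf \<mu> \<bind> K) E"
      by (simp add: emeasure_eq_measure)
  qed
  then have "(\<integral>x. f x \<partial>\<nu>) = (\<integral>x. f x \<partial>(measure_pmf \<mu> \<bind> K))" by simp
  also have "\<dots> = measure_pmf.expectation \<mu> (\<lambda>g. \<integral>x. f x \<partial>K g)"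
    by (rule integral_bind[OF _ bound meas, where B'=1])
      (use K in \<open>auto simp: prob_space.emeasure_space_1 measure_pmf.finite_measure_axioms\<close>)
  also have "\<dots> = measure_pmf.expectation \<mu> (\<lambda>g. \<integral>x. f (act g x) \<partial>\<nu>)"
    using AE_carrier
  proof (intro integral_cong_AE, simp, simp, eventually_elim)
    case (elim g)
    then show ?case
      unfolding K_def push_def by (simp add: integral_distr[OF meas_act])
  qed
  finally show ?thesis .
qed

end

text \<open>The topology is the product of the discrete ones. Its cylinders form a countable base of
  measurable sets, so open sets are measurable; conversely the boxes generating the product
  sigma-algebra are open.\<close>

lemma standard_borel_PiM_count_space:
  assumes I: "countable I" and Y: "countable Y" and M: "sets M = sets (Pi\<^sub>M I (\<lambda>_. count_space Y))"
  shows "standard_borel M"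
proof -
  let ?T = "product_topology (\<lambda>_. discrete_topology Y) I"
  let ?X = "\<Pi>\<^sub>E i\<in>I. Y"
  have top: "topspace ?T = ?X" by simp
  have space: "space M = ?X"
    using sets_eq_imp_space_eq[OF M] by (simp add: space_PiM)
  define cyl where "cyl J y = {x \<in> ?X. \<forall>i\<in>J. x i = y i}" for J and y :: "'a \<Rightarrow> 'b"
  define \<B> where "\<B> = (\<lambda>(J, y). cyl J y) ` (SIGMA J : {J. finite J \<and> J \<subseteq> I}. \<Pi>\<^sub>E i\<in>J. Y)"
  have count: "countable \<B>"
    unfolding \<B>_def using I Y
    by (intro countable_image countable_SIGMA countable_Collect_finite_subset countable_PiE) auto
  have cyl_PiE: "cyl J y = (\<Pi>\<^sub>E i\<in>I. if i \<in> J then {y i} else Y)" if "J \<subseteq> I" "\<forall>i\<in>J. y i \<in> Y" for J y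
    using that unfolding cyl_def by (auto simp: PiE_iff extensional_def split: if_splits)
  have \<B>_D: "\<exists>J y. V = cyl J y \<and> finite J \<and> J \<subseteq> I \<and> (\<forall>i\<in>J. y i \<in> Y)" if "V \<in> \<B>" for V
    using that unfolding \<B>_def by (auto simp: PiE_iff)
  have cyl_open: "openin ?T V" if "V \<in> \<B>" for V
  proof -
    obtain J y where Jy: "V = cyl J y" "finite J" "J \<subseteq> I" "\<forall>i\<in>J. y i \<in> Y"
      using \<B>_D[OF \<open>V \<in> \<B>\<close>] by blast
    have "openin ?T (\<Pi>\<^sub>E i\<in>I. if i \<in> J then {y i} else Y)"
    proof (rule product_topology_basis)
      show "finite {i. (if i \<in> J then {y i} else Y) \<noteq> topspace (discrete_topology Y)}"
        by (rule finite_subset[OF _ Jy(2)]) auto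
    qed (use Jy in auto)
    then show ?thesis using Jy cyl_PiE by simp
  qed
  have cyl_sets: "V \<in> sets M" if "V \<in> \<B>" for V
  proof -
    obtain J y where Jy: "V = cyl J y" "finite J" "J \<subseteq> I" "\<forall>i\<in>J. y i \<in> Y"
      using \<B>_D[OF \<open>V \<in> \<B>\<close>] by blast
    have "V = prod_emb I (\<lambda>_. count_space Y) J (\<Pi>\<^sub>E i\<in>J. {y i})"
      using Jy unfolding cyl_def by (auto simp: prod_emb_def PiE_iff extensional_def)
    then show ?thesis
      unfolding M using Jy by (auto intro!: sets_PiM_I)
  qed
  have base: "\<exists>V\<in>\<B>. x \<in> V \<and> V \<subseteq> U" if "openin ?T U" "x \<in> U" for U x
  proof -
    from that obtain W where W: "finite {i \<in> I. W i \<noteq> Y}" "x \<in> Pi\<^sub>E I W" "Pi\<^sub>E I W \<subseteq> U"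
      unfolding openin_product_topology_alt by (auto simp: Collect_conj_eq)
    let ?J = "{i \<in> I. W i \<noteq> Y}"
    have xX: "x \<in> ?X" using that openin_subset top by blast
    have "cyl ?J (restrict x ?J) \<in> \<B>"
      unfolding \<B>_def using W(1) xX by (intro image_eqI[of _ _ "(?J, restrict x ?J)"]) auto
    moreover have "x \<in> cyl ?J (restrict x ?J)"
      using xX by (auto simp: cyl_def)
    moreover have "cyl ?J (restrict x ?J) \<subseteq> Pi\<^sub>E I W"
    proof
      fix z assume z: "z \<in> cyl ?J (restrict x ?J)"
      have "z i \<in> W i" if "i \<in> I" for i
        using z W(2) that by (cases "W i = Y") (auto simp: cyl_def PiE_iff)
      then show "z \<in> Pi\<^sub>E I W" using z by (auto simp: cyl_def PiE_iff)
    qed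
    ultimately show ?thesis
      using W(3) by (intro bexI[of _ "cyl ?J (restrict x ?J)"] conjI subset_trans[OF _ W(3)])
  qed
  show ?thesis
  proof (rule standard_borelI)
    show "completely_metrizable_space ?T"
      unfolding completely_metrizable_space_product_topology
      using I by (auto intro: countable_subset[of _ I] completely_metrizable_space_discrete_topology)
    show "second_countable ?T"
      unfolding second_countable_def using count cyl_open base by (intro exI[of _ \<B>]) simp
    show "space M = topspace ?T" by (simp add: space)
    show "sets M = sigma_sets (topspace ?T) {U. openin ?T U}"
    proof
      have "U \<in> sets M" if "openin ?T U" for U
      proof -
        have "U \<subseteq> \<Union>{V \<in> \<B>. V \<subseteq> U}"
        proof
          fix x assume "x \<in> U"
          then obtain V where "V \<in> \<B>" "x \<in> V" "V \<subseteq> U" using base[OF \<open>openin ?T U\<close>] by metis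
          then show "x \<in> \<Union>{V \<in> \<B>. V \<subseteq> U}" by auto
        qed
        then have "U = \<Union>{V \<in> \<B>. V \<subseteq> U}" by auto
        moreover have "\<Union>{V \<in> \<B>. V \<subseteq> U} \<in> sets M"
          using cyl_sets count by (intro sets.countable_Union) (auto intro: countable_subset)
        ultimately show ?thesis by simp
      qed
      then show "sigma_sets (topspace ?T) {U. openin ?T U} \<subseteq> sets M"
        unfolding top space[symmetric] by (intro sets.sigma_sets_subset) auto
      have "prod_algebra I (\<lambda>_. count_space Y) \<subseteq> {U. openin ?T U}"
      proof
        fix A assume "A \<in> prod_algebra I (\<lambda>_. count_space Y)"
        then obtain J E where JE: "A = prod_emb I (\<lambda>_. count_space Y) J (Pi\<^sub>E J E)" "finite J" "J \<subseteq> I"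
          "\<And>i. i \<in> J \<Longrightarrow> E i \<in> sets (count_space Y)"
          by (elim prod_algebraE) auto
        have "A = (\<Pi>\<^sub>E i\<in>I. if i \<in> J then E i else Y)"
        proof (rule Set.set_eqI)
          fix x
          have "((\<forall>i\<in>I. x i \<in> Y) \<and> (\<forall>i\<in>J. x i \<in> E i)) = (\<forall>i\<in>I. x i \<in> (if i \<in> J then E i else Y))"
            using JE(3) JE(4) by (auto split: if_split_asm; meson subsetD)
          moreover have "x \<in> A \<longleftrightarrow> (\<forall>i\<in>I. x i \<in> Y) \<and> (\<forall>i\<in>J. x i \<in> E i) \<and> x \<in> extensional I"
            unfolding JE(1) by (auto simp: prod_emb_def PiE_iff)
          ultimately show "x \<in> A \<longleftrightarrow> x \<in> (\<Pi>\<^sub>E i\<in>I. if i \<in> J then E i else Y)"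
            unfolding PiE_iff by metis
        qed
        moreover have "openin ?T (\<Pi>\<^sub>E i\<in>I. if i \<in> J then E i else Y)"
        proof (rule product_topology_basis)
          show "finite {i. (if i \<in> J then E i else Y) \<noteq> topspace (discrete_topology Y)}"
            by (rule finite_subset[OF _ JE(2)]) auto
        qed (use JE in auto)
        ultimately show "A \<in> {U. openin ?T U}" by simp
      qed
      then show "sets M \<subseteq> sigma_sets (topspace ?T) {U. openin ?T U}"
        unfolding M sets_PiM by (simp add: sigma_sets_mono')
    qed
  qed
qed

text \<open>A function is coded by its graph, which becomes a set of naturals once both sides are
  numbered, and sets of naturals inject into the reals. Injectivity is enough, as the measurable
  structure is transported along the map.\<close>

lemma PiE_countable_embedding:
  assumes I: "countable I" and Y: "countable Y"
  obtains e :: "('i \<Rightarrow> 'y) \<Rightarrow> real" where "inj_on e (I \<rightarrow>\<^sub>E Y)"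
proof -
  obtain h :: "nat set \<Rightarrow> real" where h: "bij_betw h UNIV UNIV"
    using nat_sets_eqpoll_reals unfolding eqpoll_def by blast
  define G where "G x = (\<lambda>i. prod_encode (to_nat_on I i, to_nat_on Y (x i))) ` I" for x :: "'i \<Rightarrow> 'y"
  have "inj_on G (I \<rightarrow>\<^sub>E Y)"
  proof (rule inj_onI)
    fix x y assume xy: "x \<in> I \<rightarrow>\<^sub>E Y" "y \<in> I \<rightarrow>\<^sub>E Y" "G x = G y"
    show "x = y"
    proof (rule PiE_ext[OF xy(1,2)])
      fix i assume i: "i \<in> I"
      then have "prod_encode (to_nat_on I i, to_nat_on Y (x i)) \<in> G y"
        using xy(3) by (auto simp: G_def)
      then obtain j where "j \<in> I" "to_nat_on I i = to_nat_on I j" "to_nat_on Y (x i) = to_nat_on Y (y j)"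
        by (auto simp: G_def)
      moreover from this have "j = i"
        using i I by (metis inj_on_to_nat_on inj_onD)
      ultimately show "x i = y i"
        using xy i Y by (metis inj_on_to_nat_on inj_onD PiE_mem)
    qed
  qed
  then have "inj_on (h \<circ> G) (I \<rightarrow>\<^sub>E Y)"
    by (intro comp_inj_on) (use h in \<open>auto simp: bij_betw_def intro: inj_on_subset\<close>)
  then show ?thesis by (rule that)
qed

text \<open>The image receives the pullback topology along the inverse of \<open>e\<close>, which
  makes \<open>e\<close> a homeomorphism onto it, whatever topology the target type may
  carry.\<close>

lemma standard_borel_embed_measure:
  assumes M: "standard_borel M" and inj: "inj_on e (space M)"
  shows "standard_borel (embed_measure M e)"
proof -
  obtain T where T: "completely_metrizable_space T" "second_countable T" "space M = topspace T"
    "sets M = sigma_sets (topspace T) {U. openin T U}"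
    using M unfolding standard_borel_def by blast
  let ?E = "e ` space M" and ?k = "the_inv_into (space M) e"
  let ?T = "pullback_topology ?E ?k T"
  have k: "?k (e x) = x" if "x \<in> topspace T" for x
    using the_inv_into_f_f[OF inj] that T(3) by simp
  have kE: "?k \<in> ?E \<rightarrow> space M"
    using k T(3) by auto
  have topE: "topspace ?T = ?E"
    unfolding topspace_pullback_topology using kE T(3) by auto
  have im: "?k -` U \<inter> ?E = e ` U" if "U \<subseteq> topspace T" for U
    using that k T(3) by (auto simp: image_iff)
  have "homeomorphic_maps T ?T e ?k"
    unfolding homeomorphic_maps_def
  proof (intro conjI)
    show "continuous_map T ?T e"
    proof (rule continuous_map_pullback')
      show "continuous_map T T (?k \<circ> e)"
        by (rule continuous_map_eq[OF continuous_map_id]) (simp add: k)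
      show "topspace T \<subseteq> e -` ?E" using T(3) by auto
    qed
    show "continuous_map ?T T ?k"
      using continuous_map_pullback[OF continuous_map_id] by simp
  qed (use k T(3) topE in auto)
  then have homeo: "T homeomorphic_space ?T"
    using homeomorphic_space_def by blast
  have "sets (embed_measure M e) = sets (vimage_algebra ?E ?k M)"
    by (rule sets_embed_eq_vimage_algebra[OF inj])
  also have "\<dots> = {?k -` A \<inter> ?E |A. A \<in> sigma_sets (topspace T) {U. openin T U}}"
    using kE by (simp add: sets_vimage_algebra2 T(4))
  also have "\<dots> = sigma_sets ?E {?k -` A \<inter> ?E |A. A \<in> {U. openin T U}}"
    using kE T(3) by (intro sigma_sets_vimage_commute) simp
  also have "{?k -` A \<inter> ?E |A. A \<in> {U. openin T U}} = {U. openin ?T U}"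
    by (auto simp: openin_pullback_topology)
  finally have "sets (embed_measure M e) = sigma_sets (topspace ?T) {U. openin ?T U}"
    by (simp add: topE)
  moreover have "completely_metrizable_space ?T"
    using homeomorphic_completely_metrizable_space[OF homeo] T(1) by blast
  moreover have "second_countable ?T"
    using homeomorphic_space_second_countability[OF homeo] T(2) by blast
  moreover have "space (embed_measure M e) = topspace ?T"
    using topE by (simp only: space_embed_measure)
  ultimately show ?thesis
    by (intro standard_borelI)
qed

text \<open>Bijectivity comes from acting with the inverse element. Extensionality makes both sides
  of the homomorphism law agree off \<open>E\<close> too, as equality in \<open>BijGroup\<close>
  demands.\<close>

lemma group_actionI:
  assumes "group G" "\<And>g. g \<in> carrier G \<Longrightarrow> \<phi> g \<in> extensional E"
    "\<And>g x. g \<in> carrier G \<Longrightarrow> x \<in> E \<Longrightarrow> \<phi> g x \<in> E"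
    "\<And>x. x \<in> E \<Longrightarrow> \<phi> \<one>\<^bsub>G\<^esub> x = x"
    "\<And>g h x. g \<in> carrier G \<Longrightarrow> h \<in> carrier G \<Longrightarrow> x \<in> E \<Longrightarrow> \<phi> (g \<otimes>\<^bsub>G\<^esub> h) x = \<phi> g (\<phi> h x)"
  shows "group_action G E \<phi>"
proof -
  interpret group G by fact
  have Bij: "\<phi> g \<in> Bij E" if g: "g \<in> carrier G" for g
  proof -
    have "\<phi> (inv\<^bsub>G\<^esub> g) (\<phi> g x) = x" "\<phi> g (\<phi> (inv\<^bsub>G\<^esub> g) x) = x" if "x \<in> E" for x
      using assms(4)[OF that] assms(5)[of "inv\<^bsub>G\<^esub> g" g x] assms(5)[of g "inv\<^bsub>G\<^esub> g" x] g that by auto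
    then have "bij_betw (\<phi> g) E E"
      using assms(3) g by (intro bij_betwI[of _ _ _ "\<phi> (inv\<^bsub>G\<^esub> g)"]) auto
    then show ?thesis using assms(2)[OF g] by (simp add: Bij_def)
  qed
  have "\<phi> \<in> hom G (BijGroup E)"
  proof (rule homI)
    fix g h assume gh: "g \<in> carrier G" "h \<in> carrier G"
    have "\<phi> (g \<otimes>\<^bsub>G\<^esub> h) = compose E (\<phi> g) (\<phi> h)"
    proof
      fix x show "\<phi> (g \<otimes>\<^bsub>G\<^esub> h) x = compose E (\<phi> g) (\<phi> h) x"
        using assms(5)[OF gh] extensional_arb[OF assms(2)] gh by (cases "x \<in> E") (auto simp: compose_def)
    qed
    then show "\<phi> (g \<otimes>\<^bsub>G\<^esub> h) = \<phi> g \<otimes>\<^bsub>BijGroup E\<^esub> \<phi> h"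
      using gh Bij by (simp add: BijGroup_def)
  qed (use Bij in \<open>simp add: BijGroup_def\<close>)
  then have "group_hom G (BijGroup E) \<phi>"
    by (intro group_hom.intro group_hom_axioms.intro group_BijGroup) (simp_all add: assms(1))
  then show ?thesis by (simp add: group_action_def)
qed

section \<open>Transport of stationary spaces to the real numbers\<close>

context stationary_action
begin

text \<open>The theorem asks for spaces over the type of reals. Everything is conjugated by the
  embedding: densities are composed with its inverse, which preserves the relative entropies, and
  invariant sets correspond to invariant sets.\<close>

lemma embed_real:
  fixes e :: "'x \<Rightarrow> real"
  assumes sb: "standard_borel \<nu>" and inj: "inj_on e (space \<nu>)" and erg: "ergodic_action G \<nu> act"
    and fin: "pmf_entropy \<mu> < \<infinity>"
  shows "\<exists>(\<nu>' :: real measure) act'. stationary_space G \<mu> \<nu>' act' \<and> ergodic_action G \<nu>' act' \<and>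
     furstenberg_entropy G \<mu> \<nu>' act' = furstenberg_entropy G \<mu> \<nu> act"
proof -
  let ?N = "embed_measure \<nu> e" and ?k = "the_inv_into (space \<nu>) e"
  define act' where "act' g = (\<lambda>y\<in>e ` space \<nu>. e (act g (?k y)))" for g
  have k: "?k (e x) = x" if "x \<in> space \<nu>" for x
    using the_inv_into_f_f[OF inj that] .
  have sp: "space ?N = e ` space \<nu>" by (rule space_embed_measure)
  have N: "?N = distr \<nu> ?N e" by (rule embed_measure_eq_distr'[OF inj])
  have e[measurable]: "e \<in> \<nu> \<rightarrow>\<^sub>M ?N" by (rule measurable_embed_measure2'[OF inj])
  have km[measurable]: "?k \<in> ?N \<rightarrow>\<^sub>M \<nu>"
    by (rule measurable_embed_measure1) (simp add: k cong: measurable_cong)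
  have act'_e: "act' g (e x) = e (act g x)" if "x \<in> space \<nu>" for g x
    using that by (simp add: act'_def k)
  have act': "act' g \<in> ?N \<rightarrow>\<^sub>M ?N" if "g \<in> carrier G" for g
  proof (rule measurable_embed_measure1)
    have "(\<lambda>x. e (act g x)) \<in> \<nu> \<rightarrow>\<^sub>M ?N"
      by (intro measurable_compose[OF meas_act[OF that]]) measurable
    then show "(\<lambda>x. act' g (e x)) \<in> \<nu> \<rightarrow>\<^sub>M ?N"
      by (simp add: act'_e cong: measurable_cong)
  qed
  have meas: "measure ?N A = measure \<nu> (e -` A \<inter> space \<nu>)" if "A \<in> sets ?N" for A
    by (subst N) (simp add: measure_distr that)
  have "group_action G (e ` space \<nu>) act'"
  proof (rule group_actionI)
    show "group G" by (rule is_group)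
  next
    fix g h y assume g: "g \<in> carrier G" "h \<in> carrier G" "y \<in> e ` space \<nu>"
    then obtain x where x: "y = e x" "x \<in> space \<nu>" by blast
    then show "act' (g \<otimes> h) y = act' g (act' h y)"
      using g by (simp add: act'_e act_mult act_space)
  next
    fix y assume "y \<in> e ` space \<nu>"
    then show "act' \<one> y = y" by (auto simp: act'_e act_one)
  next
    fix g y assume "g \<in> carrier G" "y \<in> e ` space \<nu>"
    then show "act' g y \<in> e ` space \<nu>" by (auto simp: act'_e act_space)
  qed (simp add: act'_def)
  then have ga: "group_action G (space ?N) act'" by (simp add: sp)
  have pN: "prob_space ?N" by (subst N) (rule prob_space_distr[OF e])
  interpret N: stationary_action G \<mu> ?N act'
  proof (intro stationary_action.intro ga pN stationary_action_axioms.intro gen)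
    fix E assume E: "E \<in> sets ?N"
    have E': "e -` E \<inter> space \<nu> \<in> sets \<nu>" using measurable_sets[OF e E] .
    have "measure_pmf.expectation \<mu> (\<lambda>g. measure ?N (act' g -` E \<inter> space ?N)) =
        measure_pmf.expectation \<mu> (\<lambda>g. measure \<nu> (act g -` (e -` E \<inter> space \<nu>) \<inter> space \<nu>))"
    proof (intro integral_cong_AE, simp, simp, use AE_carrier in eventually_elim)
      fix g assume g: "g \<in> carrier G"
      have "e -` (act' g -` E \<inter> space ?N) \<inter> space \<nu> = act g -` (e -` E \<inter> space \<nu>) \<inter> space \<nu>"
      proof (rule Set.set_eqI)
        fix x
        show "x \<in> e -` (act' g -` E \<inter> space ?N) \<inter> space \<nu> \<longleftrightarrow> x \<in> act g -` (e -` E \<inter> space \<nu>) \<inter> space \<nu>"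
          using g act'_e[of x g] act_space[of g x] by (auto simp: sp)
      qed
      then show "measure ?N (act' g -` E \<inter> space ?N) = measure \<nu> (act g -` (e -` E \<inter> space \<nu>) \<inter> space \<nu>)"
        using meas[OF measurable_sets[OF act'[OF g] E]] by simp
    qed
    also have "\<dots> = measure ?N E"
      using stationary[OF E'] by (simp add: meas[OF E])
    finally show "measure_pmf.expectation \<mu> (\<lambda>g. measure ?N (act' g -` E \<inter> space ?N)) = measure ?N E" .
  qed (fact act')
  have kl: "N.kl g = kl g" if g: "g \<in> set_pmf \<mu>" for g
  proof -
    have gG: "g \<in> carrier G" using g set_pmf_subset by blast
    obtain r where r[measurable]: "r \<in> borel_measurable \<nu>" and r': "\<And>x. 0 < r x"
      "push act g \<nu> = density \<nu> (\<lambda>x. ennreal (r x))"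
      using push_density[OF g] by metis
    have "push act' g ?N = distr (push act g \<nu>) ?N e"
    proof -
      have "push act' g ?N = distr (distr \<nu> ?N e) ?N (act' g)"
        unfolding push_def using N by simp
      also have "\<dots> = distr \<nu> ?N (act' g \<circ> e)"
        by (intro distr_distr act'[OF gG]) measurable
      also have "\<dots> = distr \<nu> ?N (e \<circ> act g)"
        by (intro distr_cong) (simp_all add: act'_e)
      also have "\<dots> = distr (push act g \<nu>) ?N e"
        unfolding push_def by (intro distr_distr[symmetric] meas_act[OF gG]) measurable
      finally show ?thesis .
    qed
    \<comment> \<open>The density is rewritten as a function of \<open>e x\<close>, the form needed
      to move it past \<open>distr\<close>.\<close>
    also have "\<dots> = distr (density \<nu> (\<lambda>x. ennreal (r (?k (e x))))) ?N e"
      unfolding r' by (intro arg_cong[where f="\<lambda>M. distr M ?N e"] density_cong) (auto simp: k)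
    also have "\<dots> = density (distr \<nu> ?N e) (\<lambda>y. ennreal (r (?k y)))"
      by (rule density_distr[symmetric]) measurable
    finally have push: "push act' g ?N = density ?N (\<lambda>y. ennreal (r (?k y)))"
      using N by simp
    have "N.kl g = (\<integral>y. r (?k y) * ln (r (?k y)) \<partial>?N)"
    proof (rule N.kl_eq[OF _ _ push])
      show "(\<lambda>y. r (?k y)) \<in> borel_measurable ?N" by measurable
    qed (use r' in simp)
    also have "\<dots> = (\<integral>y. r (?k y) * ln (r (?k y)) \<partial>(distr \<nu> ?N e))"
      using N by simp
    also have "\<dots> = (\<integral>x. r (?k (e x)) * ln (r (?k (e x))) \<partial>\<nu>)"
      by (intro integral_distr) measurable
    also have "\<dots> = (\<integral>x. r x * ln (r x) \<partial>\<nu>)"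
      by (intro Bochner_Integration.integral_cong) (simp_all add: k)
    also have "\<dots> = kl g"
      using r' by (intro kl_eq[symmetric]) simp_all
    finally show ?thesis .
  qed
  have "furstenberg_entropy G \<mu> ?N act' = furstenberg_entropy G \<mu> \<nu> act"
    unfolding N.furstenberg_entropy_eq(2)[OF fin] furstenberg_entropy_eq(2)[OF fin]
    by (intro integral_cong_AE) (auto simp: AE_measure_pmf_iff kl)
  moreover have "stationary_space G \<mu> ?N act'"
    by (rule N.stationary_spaceI[OF standard_borel_embed_measure[OF sb inj]])
  moreover have "ergodic_action G ?N act'"
    unfolding ergodic_action_def
  proof (intro ballI impI)
    fix E assume E: "E \<in> sets ?N" and inv: "\<forall>g\<in>carrier G. act' g ` E = E"
    let ?F = "e -` E \<inter> space \<nu>"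
    have EF: "E = e ` ?F" using sets.sets_into_space[OF E] by (auto simp: sp)
    have "act g ` ?F = ?F" if g: "g \<in> carrier G" for g
    proof -
      have "e ` (act g ` ?F) = act' g ` (e ` ?F)"
        by (auto simp: image_image act'_e intro!: image_cong)
      also have "\<dots> = e ` ?F" using inv g EF by simp
      finally have *: "e ` (act g ` ?F) = e ` ?F" .
      have "act g ` ?F \<subseteq> space \<nu>" using g act_space by auto
      then show ?thesis
        using inj_on_image_eq_iff[OF inj, of "act g ` ?F" ?F] * by auto
    qed
    then have "measure \<nu> ?F = 0 \<or> measure \<nu> ?F = 1"
      using erg[unfolded ergodic_action_def, rule_format, OF measurable_sets[OF e E]] by simp
    then show "measure ?N E = 0 \<or> measure ?N E = 1"
      by (simp add: meas[OF E])
  qed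
  ultimately show ?thesis by blast
qed

end

section \<open>The limit configuration boundary\<close>

locale lamplighter_walk =
  fixes L :: "('l, 'a) monoid_scheme" and \<Gamma> :: "('g, 'b) monoid_scheme"
    and \<mu> :: "(('g \<Rightarrow> 'l) \<times> 'g) pmf"
  assumes L: "group L" and \<Gamma>: "group \<Gamma>" and gen: "generating (lamplighter L \<Gamma>) \<mu>"
    and stab: "lamps_stabilize L \<Gamma> \<mu>"
begin

abbreviation "G \<equiv> lamplighter L \<Gamma>"
abbreviation "conf \<equiv> carrier \<Gamma> \<rightarrow>\<^sub>E carrier L"
abbreviation "CX \<equiv> Pi\<^sub>M (carrier \<Gamma>) (\<lambda>_. count_space (carrier L))"
abbreviation "\<nu> \<equiv> config_measure L \<Gamma> \<mu>"
abbreviation "act \<equiv> config_action L \<Gamma>"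

sublocale L: group L by (fact L)
sublocale \<Gamma>: group \<Gamma> by (fact \<Gamma>)
sublocale G: group G by (intro group_lamplighter L \<Gamma>)

lemma set_pmf_carrier: "set_pmf \<mu> \<subseteq> carrier G"
  using gen semigroup_generate.incl[of _ "set_pmf \<mu>" G] by (auto simp: generating_def)

lemma countable_G: "countable (carrier G)"
  using gen countable_semigroup_generate[of "set_pmf \<mu>" G] unfolding generating_def by simp

lemma carrier_G: "carrier G = lamp_configs L \<Gamma> \<times> carrier \<Gamma>"
  by (simp add: lamplighter_def)

lemma mult_G: "(f, a) \<otimes>\<^bsub>G\<^esub> (h, b) = (translate L \<Gamma> (f, a) h, a \<otimes>\<^bsub>\<Gamma>\<^esub> b)"
  by (simp add: lamplighter_def)

lemma lamp_configs_conf: "lamp_configs L \<Gamma> \<subseteq> conf"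
  by (auto simp: lamp_configs_def)

lemma lamp_closed: "f \<in> lamp_configs L \<Gamma> \<Longrightarrow> x \<in> carrier \<Gamma> \<Longrightarrow> f x \<in> carrier L"
  using lamp_configs_conf by (auto simp: PiE_iff)

lemma one_lamp_configs: "(\<lambda>x\<in>carrier \<Gamma>. \<one>\<^bsub>L\<^esub>) \<in> lamp_configs L \<Gamma>"
  by (auto simp: lamp_configs_def)

lemma countable_\<Gamma>: "countable (carrier \<Gamma>)"
proof -
  have "carrier \<Gamma> = snd ` carrier G"
    using one_lamp_configs by (auto simp: carrier_G)
  then show ?thesis using countable_G by simp
qed

text \<open>Each lamp value is the value at the identity of a configuration lit only there.\<close>

lemma countable_L: "countable (carrier L)"
proof -
  have "carrier L \<subseteq> (\<lambda>g. fst g \<one>\<^bsub>\<Gamma>\<^esub>) ` carrier G"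
  proof
    fix l assume l: "l \<in> carrier L"
    let ?f = "\<lambda>x\<in>carrier \<Gamma>. if x = \<one>\<^bsub>\<Gamma>\<^esub> then l else \<one>\<^bsub>L\<^esub>"
    have "{x \<in> carrier \<Gamma>. ?f x \<noteq> \<one>\<^bsub>L\<^esub>} \<subseteq> {\<one>\<^bsub>\<Gamma>\<^esub>}" by auto
    then have "finite {x \<in> carrier \<Gamma>. ?f x \<noteq> \<one>\<^bsub>L\<^esub>}" by (rule finite_subset) simp
    then have "?f \<in> lamp_configs L \<Gamma>" using l by (auto simp: lamp_configs_def)
    then show "l \<in> (\<lambda>g. fst g \<one>\<^bsub>\<Gamma>\<^esub>) ` carrier G"
      by (intro image_eqI[of _ _ "(?f, \<one>\<^bsub>\<Gamma>\<^esub>)"]) (auto simp: carrier_G)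
  qed
  then show ?thesis using countable_G by (meson countable_image countable_subset)
qed

lemma translate_conf: "(f, a) \<in> carrier G \<Longrightarrow> \<phi> \<in> conf \<Longrightarrow> translate L \<Gamma> (f, a) \<phi> \<in> conf"
  using lamp_configs_conf by (auto simp: translate_def carrier_G PiE_iff)

lemma translate_mult:
  assumes "g \<in> carrier G" "h \<in> carrier G" "\<phi> \<in> conf"
  shows "translate L \<Gamma> (g \<otimes>\<^bsub>G\<^esub> h) \<phi> = translate L \<Gamma> g (translate L \<Gamma> h \<phi>)"
proof -
  obtain f1 a1 f2 a2 where gh: "g = (f1, a1)" "h = (f2, a2)" by fastforce
  show ?thesis
    using assms unfolding gh
    by (auto simp: carrier_G mult_G translate_def PiE_iff fun_eq_iff lamp_closed L.m_assoc \<Gamma>.m_assoc \<Gamma>.inv_mult_group)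
qed

lemma act_eq: "\<phi> \<in> conf \<Longrightarrow> act g \<phi> = translate L \<Gamma> g \<phi>"
  by (simp add: config_action_def)

lemma group_action_conf: "group_action G conf act"
proof (rule group_actionI)
  show "group G" by (rule G.is_group)
next
  fix g \<phi> assume "g \<in> carrier G" "\<phi> \<in> conf"
  then show "act g \<phi> \<in> conf" using translate_conf by (cases g) (simp add: act_eq)
next
  fix \<phi> assume "\<phi> \<in> conf"
  then show "act \<one>\<^bsub>G\<^esub> \<phi> = \<phi>"
    by (auto simp: act_eq lamplighter_def translate_def fun_eq_iff PiE_iff extensional_def)
next
  fix g h \<phi> assume gh: "g \<in> carrier G" "h \<in> carrier G" "\<phi> \<in> conf"
  then have "translate L \<Gamma> h \<phi> \<in> conf" using translate_conf by (cases h) simp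
  then show "act (g \<otimes>\<^bsub>G\<^esub> h) \<phi> = act g (act h \<phi>)"
    using gh by (simp add: act_eq translate_mult)
qed (simp add: config_action_def)

lemma space_CX: "space CX = conf" by (simp add: space_PiM)

lemma measurable_act: 
  assumes g: "g \<in> carrier G"
  shows "act g \<in> CX \<rightarrow>\<^sub>M CX"
proof -
  obtain f a where fa: "g = (f, a)" by fastforce
  have f: "f \<in> conf" "a \<in> carrier \<Gamma>" using g lamp_configs_conf by (auto simp: fa carrier_G)
  have "(\<lambda>\<phi>. \<lambda>x\<in>carrier \<Gamma>. f x \<otimes>\<^bsub>L\<^esub> \<phi> (inv\<^bsub>\<Gamma>\<^esub> a \<otimes>\<^bsub>\<Gamma>\<^esub> x)) \<in> CX \<rightarrow>\<^sub>M CX"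
  proof (rule measurable_restrict)
    fix x assume x: "x \<in> carrier \<Gamma>"
    have "(\<lambda>\<phi>. \<phi> (inv\<^bsub>\<Gamma>\<^esub> a \<otimes>\<^bsub>\<Gamma>\<^esub> x)) \<in> CX \<rightarrow>\<^sub>M count_space (carrier L)"
      using f x by (intro measurable_component_singleton) auto
    then show "(\<lambda>\<phi>. f x \<otimes>\<^bsub>L\<^esub> \<phi> (inv\<^bsub>\<Gamma>\<^esub> a \<otimes>\<^bsub>\<Gamma>\<^esub> x)) \<in> CX \<rightarrow>\<^sub>M count_space (carrier L)"
      by (rule measurable_compose) (use f x in \<open>auto simp: PiE_iff\<close>)
  qed
  then show ?thesis
    by (rule subst[OF measurable_cong, rotated]) (simp add: space_CX act_eq fa translate_def restrict_def)
qed

section \<open>The random walk, its limit configuration and the stationarity of the limit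
  law\<close>

abbreviation "R \<equiv> restrict_space (measure_pmf \<mu>) (carrier G)"
abbreviation "incr \<equiv> increments G \<mu>"
abbreviation "Z \<equiv> walk G"

lemma space_R: "space R = carrier G" by (simp add: space_restrict_space)

lemma sets_R: "sets R = Pow (carrier G)"
  by (auto simp: sets_restrict_space)

lemma prob_space_R: "prob_space R"
proof
  have "emeasure R (carrier G) = emeasure (measure_pmf \<mu>) (carrier G)"
    by (rule emeasure_restrict_space) auto
  also have "\<dots> = 1"
    using set_pmf_carrier by (intro measure_pmf.emeasure_eq_1_AE) (auto simp: AE_measure_pmf_iff)
  finally show "emeasure R (space R) = 1" by (simp add: space_R)
qed

sublocale R: prob_space R by (rule prob_space_R)
sublocale product_prob_space "\<lambda>_::nat. R" UNIV by unfold_locales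
sublocale sequence_space R by unfold_locales

lemma incr_eq: "incr = S" by (simp add: increments_def)

sublocale incr: prob_space incr unfolding incr_eq by (rule P.prob_space_axioms)

lemma integral_R: "(\<integral>x. f x \<partial>R) = measure_pmf.expectation \<mu> f" for f :: "_ \<Rightarrow> real"
proof -
  have "(\<integral>x. f x \<partial>R) = (\<integral>x. indicator (carrier G) x *\<^sub>R f x \<partial>measure_pmf \<mu>)"
    by (rule integral_restrict_space) simp
  also have "\<dots> = measure_pmf.expectation \<mu> f"
    using set_pmf_carrier by (intro integral_cong_AE) (auto simp: AE_measure_pmf_iff)
  finally show ?thesis .
qed

lemma space_incr: "\<omega> \<in> space incr \<longleftrightarrow> (\<forall>n. \<omega> n \<in> carrier G)"
  by (auto simp: incr_eq space_PiM space_R)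

lemma walk_closed: "\<omega> \<in> space incr \<Longrightarrow> Z \<omega> n \<in> carrier G"
  by (induction n) (auto simp: space_incr)

text \<open>As the group is countable, the product can be split over the values of
  \<open>Z \<omega> n\<close>; left multiplication by a fixed element is measurable on the discrete
  space \<open>R\<close>.\<close>

lemma walk_measurable: "(\<lambda>\<omega>. Z \<omega> n) \<in> incr \<rightarrow>\<^sub>M count_space (carrier G)"
proof (induction n)
  case 0
  then show ?case by simp
next
  case (Suc n)
  have "(\<lambda>\<omega>. Z \<omega> n \<otimes>\<^bsub>G\<^esub> \<omega> n) \<in> incr \<rightarrow>\<^sub>M count_space (carrier G)"
  proof (rule measurable_compose_countable'[OF _ Suc countable_G])
    fix z assume z: "z \<in> carrier G"
    have "(\<lambda>\<omega>. \<omega> n) \<in> incr \<rightarrow>\<^sub>M R" unfolding incr_eq by (rule measurable_component_singleton) simp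
    moreover have "(\<lambda>y. z \<otimes>\<^bsub>G\<^esub> y) \<in> R \<rightarrow>\<^sub>M count_space (carrier G)"
      using z by (auto simp: measurable_def space_R sets_R)
    ultimately show "(\<lambda>\<omega>. z \<otimes>\<^bsub>G\<^esub> \<omega> n) \<in> incr \<rightarrow>\<^sub>M count_space (carrier G)"
      by (rule measurable_compose)
  qed
  then show ?case by simp
qed

lemma walk_lamp_measurable:
  assumes "x \<in> carrier \<Gamma>"
  shows "(\<lambda>\<omega>. fst (Z \<omega> n) x) \<in> incr \<rightarrow>\<^sub>M count_space (carrier L)"
  by (rule measurable_compose[OF walk_measurable]) (use assms lamp_configs_conf in \<open>auto simp: carrier_G PiE_iff\<close>)

definition settled :: "(nat \<Rightarrow> ('g \<Rightarrow> 'l) \<times> 'g) \<Rightarrow> 'g \<Rightarrow> 'l \<Rightarrow> bool" where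
  "settled \<omega> x c \<longleftrightarrow> (\<forall>\<^sub>F n in sequentially. fst (Z \<omega> n) x = c)"

lemma settled_unique:
  assumes "settled \<omega> x c" "settled \<omega> x d"
  shows "c = d"
proof -
  have "\<forall>\<^sub>F n in sequentially. c = d"
    using assms unfolding settled_def by eventually_elim simp
  then show ?thesis by simp
qed

lemma limit_config_settled:
  assumes "x \<in> carrier \<Gamma>" "settled \<omega> x c"
  shows "limit_config L \<Gamma> \<omega> x = c"
proof -
  have "(THE c. settled \<omega> x c) = c"
    using assms settled_unique by blast
  then show ?thesis
    using assms unfolding limit_config_def settled_def[symmetric] by auto
qed

lemma settled_closed:
  assumes "\<omega> \<in> space incr" "x \<in> carrier \<Gamma>" "settled \<omega> x c"
  shows "c \<in> carrier L"
proof -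
  obtain n where "fst (Z \<omega> n) x = c"
    using assms(3) unfolding settled_def by (auto simp: eventually_sequentially)
  then show ?thesis
    using walk_closed[OF assms(1), of n] assms(2) lamp_configs_conf by (auto simp: carrier_G PiE_iff)
qed

lemma limit_config_conf:
  assumes "\<omega> \<in> space incr"
  shows "limit_config L \<Gamma> \<omega> \<in> conf"
proof -
  have "limit_config L \<Gamma> \<omega> x \<in> carrier L" if x: "x \<in> carrier \<Gamma>" for x
  proof (cases "\<exists>c. settled \<omega> x c")
    case True
    then obtain c where "settled \<omega> x c" by blast
    then show ?thesis using limit_config_settled[OF x] settled_closed[OF assms x] by simp
  next
    case False
    then show ?thesis using x unfolding limit_config_def settled_def[symmetric] by auto
  qed
  then show ?thesis by (auto simp: PiE_iff limit_config_def)
qed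

lemma limit_config_measurable: "limit_config L \<Gamma> \<in> incr \<rightarrow>\<^sub>M CX"
proof -
  have settled_sets: "{\<omega> \<in> space incr. settled \<omega> x c} \<in> sets incr" if x: "x \<in> carrier \<Gamma>" for x c
  proof -
    have [measurable]: "(\<lambda>\<omega>. fst (Z \<omega> n) x) \<in> incr \<rightarrow>\<^sub>M count_space (carrier L)" for n
      by (rule walk_lamp_measurable[OF x])
    have "{\<omega> \<in> space incr. settled \<omega> x c} = (\<Union>N. \<Inter>n\<in>{N..}. {\<omega> \<in> space incr. fst (Z \<omega> n) x = c})"
      by (auto simp: settled_def eventually_sequentially)
    moreover have "{\<omega> \<in> space incr. fst (Z \<omega> n) x = c} \<in> sets incr" for n
    proof -
      have "{\<omega> \<in> space incr. fst (Z \<omega> n) x = c} = (\<lambda>\<omega>. fst (Z \<omega> n) x) -` ({c} \<inter> carrier L) \<inter> space incr"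
        using measurable_space[OF walk_lamp_measurable[OF x, of n]] by auto
      then show ?thesis
        by (simp only:) (rule measurable_sets[OF walk_lamp_measurable[OF x]], simp)
    qed
    ultimately show ?thesis by (auto intro!: sets.countable_UN sets.countable_INT'')
  qed
  have "(\<lambda>\<omega>. \<lambda>x\<in>carrier \<Gamma>. limit_config L \<Gamma> \<omega> x) \<in> incr \<rightarrow>\<^sub>M CX"
  proof (rule measurable_restrict)
    fix x assume x: "x \<in> carrier \<Gamma>"
    show "(\<lambda>\<omega>. limit_config L \<Gamma> \<omega> x) \<in> incr \<rightarrow>\<^sub>M count_space (carrier L)"
      unfolding measurable_count_space_eq_countable[OF countable_L]
    proof (intro conjI ballI)
      show "(\<lambda>\<omega>. limit_config L \<Gamma> \<omega> x) \<in> space incr \<rightarrow> carrier L"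
        using limit_config_conf x by (auto simp: PiE_iff)
      fix c assume c: "c \<in> carrier L"
      \<comment> \<open>The identity is also the default for lamps that never settle, which accounts
        for the second set.\<close>
      have eq: "(\<lambda>\<omega>. limit_config L \<Gamma> \<omega> x) -` {c} \<inter> space incr =
          {\<omega> \<in> space incr. settled \<omega> x c} \<union>
          (if c = \<one>\<^bsub>L\<^esub> then space incr - (\<Union>d\<in>carrier L. {\<omega> \<in> space incr. settled \<omega> x d}) else {})"
      proof (rule Set.set_eqI)
        fix \<omega>
        show "\<omega> \<in> (\<lambda>\<omega>. limit_config L \<Gamma> \<omega> x) -` {c} \<inter> space incr \<longleftrightarrow> \<omega> \<in> {\<omega> \<in> space incr. settled \<omega> x c} \<union>
          (if c = \<one>\<^bsub>L\<^esub> then space incr - (\<Union>d\<in>carrier L. {\<omega> \<in> space incr. settled \<omega> x d}) else {})"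
        proof (cases "\<exists>d. settled \<omega> x d")
          case True
          then obtain d where d: "settled \<omega> x d" by blast
          then have iff: "settled \<omega> x e \<longleftrightarrow> e = d" for e
            using settled_unique[of \<omega> x] by metis
          have "limit_config L \<Gamma> \<omega> x = d" "\<omega> \<in> space incr \<longrightarrow> d \<in> carrier L"
            using limit_config_settled[OF x d] settled_closed[OF _ x d] by auto
          then show ?thesis by (auto simp: iff)
        next
          case False
          then have "limit_config L \<Gamma> \<omega> x = \<one>\<^bsub>L\<^esub>"
            using x unfolding limit_config_def settled_def[symmetric] by auto
          then show ?thesis using False by auto
        qed
      qed
      show "(\<lambda>\<omega>. limit_config L \<Gamma> \<omega> x) -` {c} \<inter> space incr \<in> sets incr"
        unfolding eq using settled_sets[OF x] countable_L by auto
    qed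
  qed
  moreover have "(\<lambda>\<omega>. \<lambda>x\<in>carrier \<Gamma>. limit_config L \<Gamma> \<omega> x) = limit_config L \<Gamma>"
    by (simp add: limit_config_def fun_eq_iff restrict_def)
  ultimately show ?thesis by (simp only:)
qed

lemma sets_\<nu>: "sets \<nu> = sets CX" and space_\<nu>: "space \<nu> = conf"
  by (simp_all add: config_measure_def space_PiM)

lemma prob_space_\<nu>: "prob_space \<nu>"
  unfolding config_measure_def by (rule incr.prob_space_distr[OF limit_config_measurable])

lemma AE_settled: "AE \<omega> in incr. \<forall>x\<in>carrier \<Gamma>. \<exists>c. settled \<omega> x c"
  using stab countable_\<Gamma> unfolding lamps_stabilize_def settled_def by (subst AE_ball_countable) auto

text \<open>\<open>comb_seq n\<close> takes its first \<open>n\<close> increments from \<omega> and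
  the later ones from \<omega>', and associativity splits the product there. This is the algebraic
  half of the Markov property.\<close>

lemma walk_comb_seq:
  assumes "\<omega> \<in> space incr" "\<omega>' \<in> space incr"
  shows "Z (comb_seq n \<omega> \<omega>') (m + n) = Z \<omega> n \<otimes>\<^bsub>G\<^esub> Z \<omega>' m"
proof (induction m)
  case 0
  have "Z (comb_seq n \<omega> \<omega>') k = Z \<omega> k" if "k \<le> n" for k
    using that by (induction k) (auto simp: comb_seq_less)
  then show ?case using walk_closed[OF assms(1)] by simp
next
  case (Suc m)
  then show ?case
    using assms walk_closed[OF assms(1), of n] walk_closed[OF assms(2), of m]
    by (auto simp: comb_seq_add G.m_assoc space_incr)
qed

text \<open>A lamp of \<open>Z \<omega> n\<close> times \<open>Z \<omega>' m\<close> involves a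
  single lamp of the second factor, at the translated position, and that one settles as
  \<open>m\<close> grows.\<close>

lemma limit_config_comb_seq:
  assumes \<omega>: "\<omega> \<in> space incr" "\<omega>' \<in> space incr" and set: "\<forall>x\<in>carrier \<Gamma>. \<exists>c. settled \<omega>' x c"
  shows "limit_config L \<Gamma> (comb_seq n \<omega> \<omega>') = act (Z \<omega> n) (limit_config L \<Gamma> \<omega>')"
proof -
  obtain f a where fa: "Z \<omega> n = (f, a)" by fastforce
  have fa': "f \<in> lamp_configs L \<Gamma>" "a \<in> carrier \<Gamma>"
    using walk_closed[OF \<omega>(1), of n] by (auto simp: fa carrier_G)
  have "limit_config L \<Gamma> (comb_seq n \<omega> \<omega>') x = translate L \<Gamma> (f, a) (limit_config L \<Gamma> \<omega>') x" for x
  proof (cases "x \<in> carrier \<Gamma>")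
    case True
    let ?y = "inv\<^bsub>\<Gamma>\<^esub> a \<otimes>\<^bsub>\<Gamma>\<^esub> x"
    have y: "?y \<in> carrier \<Gamma>" using fa' True by simp
    then obtain c where c: "settled \<omega>' ?y c" using set by blast
    have Zx: "fst (Z (comb_seq n \<omega> \<omega>') (m + n)) x = f x \<otimes>\<^bsub>L\<^esub> fst (Z \<omega>' m) ?y" for m
      unfolding walk_comb_seq[OF \<omega>] fa using True
      by (cases "Z \<omega>' m") (simp add: mult_G translate_def)
    have "\<forall>\<^sub>F m in sequentially. fst (Z (comb_seq n \<omega> \<omega>') (m + n)) x = f x \<otimes>\<^bsub>L\<^esub> c"
      using c unfolding settled_def Zx by (rule eventually_mono) simp
    then have "settled (comb_seq n \<omega> \<omega>') x (f x \<otimes>\<^bsub>L\<^esub> c)"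
      unfolding settled_def by (subst (asm) eventually_sequentially_seg)
    then show ?thesis
      using True limit_config_settled[OF y c] by (simp add: limit_config_settled translate_def)
  qed (simp_all add: limit_config_def translate_def)
  then show ?thesis
    using limit_config_conf[OF \<omega>(2)] by (auto simp: act_eq fa)
qed

text \<open>The Markov property: replacing the increments after time \<open>n\<close> by an
  independent sequence preserves their law, and the limit then becomes \<open>Z \<omega> n\<close>
  applied to a fresh limit configuration. Fubini gives the formula.\<close>

lemma measure_walk_limit:
  assumes D: "D \<in> sets CX" and W: "W \<subseteq> carrier G"
  shows "measure incr {\<omega> \<in> space incr. Z \<omega> n \<in> W \<and> limit_config L \<Gamma> \<omega> \<in> D} =
    (\<integral>\<omega>. indicator W (Z \<omega> n) * measure \<nu> (act (Z \<omega> n) -` D \<inter> conf) \<partial>incr)"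
proof -
  let ?l = "limit_config L \<Gamma>"
  define f :: "_ \<Rightarrow> real" where "f \<omega> = indicator W (Z \<omega> n) * indicator D (?l \<omega>)" for \<omega>
  have Zm: "(\<lambda>\<omega>. indicator W (Z \<omega> n) :: real) \<in> borel_measurable incr"
    by (rule measurable_compose[OF walk_measurable]) simp
  have fm[measurable]: "f \<in> borel_measurable incr"
    unfolding f_def using D
    by (intro borel_measurable_times Zm measurable_compose[OF limit_config_measurable]) simp
  have cm: "(\<lambda>(\<omega>, \<omega>'). comb_seq n \<omega> \<omega>') \<in> incr \<Otimes>\<^sub>M incr \<rightarrow>\<^sub>M incr"
    unfolding incr_eq by (rule measurable_comb_seq)
  interpret pair: pair_prob_space incr incr by unfold_locales
  have fc: "(\<lambda>x. f (case x of (\<omega>, \<omega>') \<Rightarrow> comb_seq n \<omega> \<omega>')) \<in> borel_measurable (incr \<Otimes>\<^sub>M incr)"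
    by (rule measurable_compose[OF cm fm])
  have "measure incr {\<omega> \<in> space incr. Z \<omega> n \<in> W \<and> ?l \<omega> \<in> D} = (\<integral>\<omega>. indicator {\<omega> \<in> space incr. Z \<omega> n \<in> W \<and> ?l \<omega> \<in> D} \<omega> \<partial>incr)"
    by (simp add: Int_absorb2 Collect_restrict)
  also have "\<dots> = (\<integral>\<omega>. f \<omega> \<partial>incr)"
    by (intro Bochner_Integration.integral_cong) (auto simp: f_def indicator_def)
  also have "\<dots> = (\<integral>\<omega>. f \<omega> \<partial>distr (incr \<Otimes>\<^sub>M incr) incr (\<lambda>(\<omega>, \<omega>'). comb_seq n \<omega> \<omega>'))"
    unfolding incr_eq PiM_comb_seq ..
  also have "\<dots> = (\<integral>x. f (case x of (\<omega>, \<omega>') \<Rightarrow> comb_seq n \<omega> \<omega>') \<partial>(incr \<Otimes>\<^sub>M incr))"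
    by (rule integral_distr[OF cm fm])
  also have "\<dots> = (\<integral>\<omega>. (\<integral>\<omega>'. f (comb_seq n \<omega> \<omega>') \<partial>incr) \<partial>incr)"
  proof (subst pair.integral_fst'[symmetric])
    show "integrable (incr \<Otimes>\<^sub>M incr) (\<lambda>x. f (case x of (\<omega>, \<omega>') \<Rightarrow> comb_seq n \<omega> \<omega>'))"
      by (rule pair.integrable_const_bound[where B=1, OF _ fc]) (auto simp: f_def indicator_def)
  qed simp
  also have "\<dots> = (\<integral>\<omega>. indicator W (Z \<omega> n) * measure \<nu> (act (Z \<omega> n) -` D \<inter> conf) \<partial>incr)"
  proof (rule Bochner_Integration.integral_cong[OF refl])
    fix \<omega> assume \<omega>: "\<omega> \<in> space incr"
    let ?A = "act (Z \<omega> n) -` D \<inter> conf"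
    have A: "?A \<in> sets CX"
      using measurable_sets[OF measurable_act[OF walk_closed[OF \<omega>]] D] by (simp add: space_CX)
    have "(\<integral>\<omega>'. f (comb_seq n \<omega> \<omega>') \<partial>incr) = (\<integral>\<omega>'. indicator W (Z \<omega> n) * indicator ?A (?l \<omega>') \<partial>incr)"
    proof (rule integral_cong_AE)
      show "AE \<omega>' in incr. f (comb_seq n \<omega> \<omega>') = indicator W (Z \<omega> n) * indicator ?A (?l \<omega>')"
        using AE_settled AE_space
      proof eventually_elim
        case (elim \<omega>')
        have "Z (comb_seq n \<omega> \<omega>') n = Z \<omega> n"
          using walk_comb_seq[OF \<omega> elim(2), of n 0] walk_closed[OF \<omega>] by simp
        then show ?case
          using limit_config_comb_seq[OF \<omega> elim(2,1), of n] limit_config_conf[OF elim(2)]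
          by (auto simp: f_def indicator_def)
      qed
      show "(\<lambda>\<omega>'. f (comb_seq n \<omega> \<omega>')) \<in> borel_measurable incr"
        using measurable_compose[OF measurable_Pair1'[OF \<omega>] fc] by simp
      show "(\<lambda>\<omega>'. indicator W (Z \<omega> n) * indicator ?A (?l \<omega>') :: real) \<in> borel_measurable incr"
        by (rule measurable_compose[OF limit_config_measurable])
          (intro borel_measurable_times borel_measurable_const borel_measurable_indicator A)
    qed
    also have "\<dots> = indicator W (Z \<omega> n) * (\<integral>\<phi>. indicator ?A \<phi> \<partial>\<nu>)"
      unfolding config_measure_def using A
      by (subst integral_distr[OF limit_config_measurable]) simp_all
    also have "(\<integral>\<phi>. indicator ?A \<phi> \<partial>\<nu>) = measure \<nu> ?A"
      by (simp add: space_\<nu> Int_absorb2)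
    finally show "(\<integral>\<omega>'. f (comb_seq n \<omega> \<omega>') \<partial>incr) = indicator W (Z \<omega> n) * measure \<nu> ?A" .
  qed
  finally show ?thesis .
qed

lemma measure_limit:
  assumes "D \<in> sets CX"
  shows "measure \<nu> D = measure incr {\<omega> \<in> space incr. limit_config L \<Gamma> \<omega> \<in> D}"
  unfolding config_measure_def using assms
  by (subst measure_distr[OF limit_config_measurable]) (auto simp: vimage_def Int_def conj_commute)

text \<open>This is \<open>measure_walk_limit\<close> for \<open>n = 1\<close> without restriction
  on \<open>Z \<omega> 1\<close>, which has law \<mu>.\<close>

sublocale conf: stationary_action G \<mu> \<nu> act
proof (intro stationary_action.intro stationary_action_axioms.intro gen prob_space_\<nu>)
  show "group_action G (space \<nu>) act" unfolding space_\<nu> by (rule group_action_conf)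
  show "act g \<in> \<nu> \<rightarrow>\<^sub>M \<nu>" if "g \<in> carrier G" for g
    using measurable_act[OF that] by (simp add: measurable_cong_sets[OF sets_\<nu> sets_\<nu>])
  fix D assume "D \<in> sets \<nu>"
  then have D: "D \<in> sets CX" by (simp add: sets_\<nu>)
  have "measure \<nu> D = measure incr {\<omega> \<in> space incr. Z \<omega> 1 \<in> carrier G \<and> limit_config L \<Gamma> \<omega> \<in> D}"
    using measure_limit[OF D] walk_closed[of _ 1] by (metis (mono_tags, lifting) Collect_cong)
  also have "\<dots> = (\<integral>\<omega>. indicator (carrier G) (Z \<omega> 1) * measure \<nu> (act (Z \<omega> 1) -` D \<inter> conf) \<partial>incr)"
    by (rule measure_walk_limit[OF D order_refl])
  also have "\<dots> = (\<integral>\<omega>. measure \<nu> (act (\<omega> 0) -` D \<inter> conf) \<partial>incr)"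
    by (intro Bochner_Integration.integral_cong) (auto simp: space_incr)
  also have "\<dots> = (\<integral>g. measure \<nu> (act g -` D \<inter> conf) \<partial>distr incr R (\<lambda>\<omega>. \<omega> 0))"
    unfolding incr_eq
    by (rule integral_distr[symmetric], rule measurable_component_singleton)
      (auto simp: measurable_def space_R sets_R)
  also have "\<dots> = (\<integral>g. measure \<nu> (act g -` D \<inter> conf) \<partial>R)"
    unfolding incr_eq by (subst distr_PiM_component) (simp_all add: prob_space_R)
  also have "\<dots> = measure_pmf.expectation \<mu> (\<lambda>g. measure \<nu> (act g -` D \<inter> conf))"
    by (rule integral_R)
  finally show "measure_pmf.expectation \<mu> (\<lambda>g. measure \<nu> (act g -` D \<inter> space \<nu>)) = measure \<nu> D"
    by (simp add: space_\<nu>)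
qed

text \<open>The conditional probability of the limit being in \<open>D\<close> given \<open>Z\<^sub>n\<close> is \<open>Z\<^sub>n\<nu>(D)\<close>. If it is constant,
  then \<open>D\<close> is independent of the past, hence of itself.\<close>

lemma constant_translates_imp_trivial:
  assumes D: "D \<in> sets CX" and c: "\<And>g. g \<in> carrier G \<Longrightarrow> measure \<nu> (act g -` D \<inter> conf) = c"
  shows "c = 0 \<or> c = 1"
proof -
  let ?l = "limit_config L \<Gamma>"
  have c0: "0 \<le> c" using c[OF G.one_closed] by (metis measure_nonneg)
  have \<nu>D: "measure \<nu> D = c"
  proof -
    have "act \<one>\<^bsub>G\<^esub> -` D \<inter> conf = D"
      using conf.act_one sets.sets_into_space[OF D] by (auto simp: space_\<nu> space_CX)
    then show ?thesis using c[OF G.one_closed] by simp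
  qed
  \<comment> \<open>Independence of \<open>D\<close> from every cylinder \<open>A\<close>: the limit
    lies in \<open>A\<close> iff \<open>Z \<omega> n\<close> lies in \<open>W\<close> for all large
    \<open>n\<close>, since finitely many lamps settle, and given \<open>Z \<omega> n\<close> the
    set \<open>D\<close> has the constant probability \<open>c\<close>.\<close>
  have gen_eq: "measure \<nu> (D \<inter> A) = c * measure \<nu> A"
    if "finite J" "J \<subseteq> carrier \<Gamma>" "\<And>j. j \<in> J \<Longrightarrow> E j \<subseteq> carrier L"
      "A = prod_emb (carrier \<Gamma>) (\<lambda>_. count_space (carrier L)) J (Pi\<^sub>E J E)" for J E A
  proof -
    define W where "W = {g \<in> carrier G. \<forall>j\<in>J. fst g j \<in> E j}"
    have A: "A \<in> sets CX" unfolding that(4) using that by (intro sets_PiM_I) auto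
    have Aiff: "\<phi> \<in> A \<longleftrightarrow> (\<forall>j\<in>J. \<phi> j \<in> E j)" if "\<phi> \<in> conf" for \<phi>
      using \<open>J \<subseteq> carrier \<Gamma>\<close> that unfolding \<open>A = _\<close> by (auto simp: prod_emb_def PiE_iff)
    have ev: "AE \<omega> in incr. \<forall>\<^sub>F n in sequentially. Z \<omega> n \<in> W \<longleftrightarrow> ?l \<omega> \<in> A"
      using AE_settled AE_space
    proof eventually_elim
      case (elim \<omega>)
      have "\<forall>\<^sub>F n in sequentially. \<forall>j\<in>J. fst (Z \<omega> n) j = ?l \<omega> j"
      proof (subst eventually_ball_finite_distrib[OF that(1)], intro ballI)
        fix j assume "j \<in> J"
        then have j: "j \<in> carrier \<Gamma>" using that by blast
        then obtain d where "settled \<omega> j d" using elim by blast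
        then show "\<forall>\<^sub>F n in sequentially. fst (Z \<omega> n) j = ?l \<omega> j"
          using limit_config_settled[OF j] by (auto simp: settled_def)
      qed
      then show ?case
      proof eventually_elim
        case (elim n)
        then show ?case
          using Aiff[OF limit_config_conf[OF \<open>\<omega> \<in> space incr\<close>]] walk_closed[OF \<open>\<omega> \<in> space incr\<close>, of n]
          by (auto simp: W_def)
      qed
    qed
    have conv: "(\<lambda>n. \<integral>\<omega>. (indicator W (Z \<omega> n) * indicator C (?l \<omega>) :: real) \<partial>incr) \<longlonglongrightarrow>
        (\<integral>\<omega>. indicator A (?l \<omega>) * indicator C (?l \<omega>) \<partial>incr)" if C: "C \<in> sets CX" for C :: "('g \<Rightarrow> 'l) set"
    proof (rule integral_dominated_convergence[where w="\<lambda>_. 1 :: real"])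
      show "(\<lambda>\<omega>. indicator A (?l \<omega>) * indicator C (?l \<omega>) :: real) \<in> borel_measurable incr"
        using A C by (intro borel_measurable_times measurable_compose[OF limit_config_measurable]) auto
      show "(\<lambda>\<omega>. indicator W (Z \<omega> n) * indicator C (?l \<omega>) :: real) \<in> borel_measurable incr" for n
        using C by (intro borel_measurable_times measurable_compose[OF limit_config_measurable]
            measurable_compose[OF walk_measurable]) auto
      from ev show "AE \<omega> in incr. (\<lambda>n. indicator W (Z \<omega> n) * indicator C (?l \<omega>) :: real) \<longlonglongrightarrow>
          indicator A (?l \<omega>) * indicator C (?l \<omega>)"
      proof eventually_elim
        case (elim \<omega>)
        then show ?case
          by (intro tendsto_eventually) (auto elim!: eventually_mono simp: indicator_def)
      qed
      show "AE \<omega> in incr. norm (indicator W (Z \<omega> n) * indicator C (?l \<omega>) :: real) \<le> 1" for n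
        by (intro AE_I2) (auto simp: indicator_def)
    qed simp
    have lim: "(\<integral>\<omega>. indicator A (?l \<omega>) * indicator C (?l \<omega>) \<partial>incr) = measure \<nu> (C \<inter> A)" if C: "C \<in> sets CX" for C
    proof -
      have "(\<integral>\<omega>. indicator A (?l \<omega>) * indicator C (?l \<omega>) \<partial>incr) =
          (\<integral>\<omega>. indicator {\<omega> \<in> space incr. ?l \<omega> \<in> C \<inter> A} \<omega> \<partial>incr :: real)"
        by (intro Bochner_Integration.integral_cong) (auto simp: indicator_def)
      also have "\<dots> = measure incr {\<omega> \<in> space incr. ?l \<omega> \<in> C \<inter> A}"
        by (simp add: Int_absorb2 Collect_restrict)
      finally show ?thesis using measure_limit[of "C \<inter> A"] A C by simp
    qed
    have "(\<integral>\<omega>. indicator W (Z \<omega> n) * indicator D (?l \<omega>) \<partial>incr) =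
        c * (\<integral>\<omega>. indicator W (Z \<omega> n) * indicator conf (?l \<omega>) \<partial>incr)" for n
    proof -
      have "(\<integral>\<omega>. indicator W (Z \<omega> n) * indicator D (?l \<omega>) \<partial>incr) =
          (\<integral>\<omega>. indicator {\<omega> \<in> space incr. Z \<omega> n \<in> W \<and> ?l \<omega> \<in> D} \<omega> \<partial>incr :: real)"
        by (intro Bochner_Integration.integral_cong) (auto simp: indicator_def)
      also have "\<dots> = measure incr {\<omega> \<in> space incr. Z \<omega> n \<in> W \<and> ?l \<omega> \<in> D}"
        by (simp add: Int_absorb2 Collect_restrict)
      also have "\<dots> = (\<integral>\<omega>. indicator W (Z \<omega> n) * measure \<nu> (act (Z \<omega> n) -` D \<inter> conf) \<partial>incr)"
        by (rule measure_walk_limit[OF D]) (auto simp: W_def)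
      also have "\<dots> = (\<integral>\<omega>. c * (indicator W (Z \<omega> n) * indicator conf (?l \<omega>)) \<partial>incr)"
        using c walk_closed limit_config_conf by (intro Bochner_Integration.integral_cong) auto
      finally show ?thesis by simp
    qed
    moreover have conf: "conf \<in> sets CX" using sets.top[of CX] unfolding space_CX .
    ultimately have "measure \<nu> (D \<inter> A) = c * measure \<nu> (conf \<inter> A)"
      using LIMSEQ_unique[OF conv[OF D]] tendsto_mult_left[OF conv[OF conf], of c]
      by (simp add: lim[OF D] lim[OF conf])
    moreover have "conf \<inter> A = A"
      using sets.sets_into_space[OF A] by (auto simp: space_CX)
    ultimately show ?thesis by simp
  qed
  have D': "D \<in> sets \<nu>" using D by (simp add: sets_\<nu>)
  have em: "emeasure (density \<nu> (indicator D)) A = ennreal (measure \<nu> (D \<inter> A))"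
    "emeasure (density \<nu> (\<lambda>_. ennreal c)) A = ennreal (c * measure \<nu> A)" if "A \<in> sets \<nu>" for A
  proof -
    have "emeasure (density \<nu> (indicator D)) A = (\<integral>\<^sup>+x. indicator (D \<inter> A) x \<partial>\<nu>)"
      using that D' by (simp add: emeasure_density indicator_inter_arith)
    then show "emeasure (density \<nu> (indicator D)) A = ennreal (measure \<nu> (D \<inter> A))"
      using that D' by (simp add: conf.emeasure_eq_measure)
    show "emeasure (density \<nu> (\<lambda>_. ennreal c)) A = ennreal (c * measure \<nu> A)"
      using that c0 by (simp add: emeasure_density nn_integral_cmult_indicator conf.emeasure_eq_measure ennreal_mult)
  qed
  \<comment> \<open>The restriction of \<nu> to \<open>D\<close> and the multiple \<open>c\<close>
    of \<nu> agree on cylinders, hence everywhere; at \<open>D\<close> itself this reads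
    \<open>c = c * c\<close>.\<close>
  have "density \<nu> (indicator D) = density \<nu> (\<lambda>_. ennreal c)"
  proof (rule measure_eqI_PiM_infinite)
    show "sets (density \<nu> (indicator D)) = sets CX" "sets (density \<nu> (\<lambda>_. ennreal c)) = sets CX"
      by (simp_all add: sets_\<nu>)
    fix A J assume AJ: "finite J" "J \<subseteq> carrier \<Gamma>" "\<And>i. i \<in> J \<Longrightarrow> A i \<in> sets (count_space (carrier L))"
    let ?A = "prod_emb (carrier \<Gamma>) (\<lambda>_. count_space (carrier L)) J (Pi\<^sub>E J A)"
    have "?A \<in> sets \<nu>" unfolding sets_\<nu> using AJ by (intro sets_PiM_I) auto
    then show "density \<nu> (indicator D) ?A = density \<nu> (\<lambda>_. ennreal c) ?A"
      using em gen_eq[of J A ?A] AJ by simp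
  next
    show "finite_measure (density \<nu> (indicator D))"
      using em(1)[OF sets.top] by (intro finite_measureI) simp
  qed
  then have "measure \<nu> (D \<inter> D) = c * measure \<nu> D"
    using em[OF D'] c0 by (metis ennreal_inj measure_nonneg mult_nonneg_nonneg)
  then show ?thesis using \<nu>D by simp
qed

end

section \<open>Consequences of the Liouville property\<close>

lemma expectation_bind_pmf_bounded:
  fixes f :: "'b \<Rightarrow> real"
  assumes "\<And>x. \<bar>f x\<bar> \<le> C"
  shows "measure_pmf.expectation (bind_pmf p q) f = measure_pmf.expectation p (\<lambda>x. measure_pmf.expectation (q x) f)"
  unfolding measure_pmf_bind
proof (rule integral_bind[where K="count_space UNIV" and B'=1 and B=C])
  show "(\<lambda>x. measure_pmf (q x)) \<in> measure_pmf p \<rightarrow>\<^sub>M subprob_algebra (count_space UNIV)"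
    using measurable_measure_pmf[of q] by simp
qed (use assms in \<open>auto simp: measure_pmf.emeasure_space_1 measure_pmf.finite_measure_axioms\<close>)

lemma abs_expectation_le:
  fixes f :: "'b \<Rightarrow> real"
  assumes "\<And>x. \<bar>f x\<bar> \<le> C"
  shows "\<bar>measure_pmf.expectation p f\<bar> \<le> C"
proof -
  have int: "integrable (measure_pmf p) f"
    using assms by (intro measure_pmf.integrable_const_bound[where B=C]) auto
  have "measure_pmf.expectation p f \<le> measure_pmf.expectation p (\<lambda>_. C)"
    "measure_pmf.expectation p (\<lambda>_. - C) \<le> measure_pmf.expectation p f"
    using assms by (intro integral_mono int; simp add: abs_le_iff minus_le_iff)+
  then show ?thesis by (simp add: abs_le_iff)
qed

text \<open>Used to exhaust countable sets by increasing finite ones.\<close>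

lemma finite_to_nat_on_less:
  assumes "countable A"
  shows "finite {x \<in> A. to_nat_on A x < n}"
proof (rule inj_on_finite[of "to_nat_on A" _ "{..<n}"])
  show "inj_on (to_nat_on A) {x \<in> A. to_nat_on A x < n}"
    using inj_on_to_nat_on[OF assms] by (rule inj_on_subset) auto
qed auto

locale Liouville_walk = group \<Gamma> for \<Gamma> :: "('g, 'b) monoid_scheme" (structure) +
  fixes p :: "'g pmf"
  assumes p_carrier: "set_pmf p \<subseteq> carrier \<Gamma>"
    and countable_carrier: "countable (carrier \<Gamma>)"
    and Liouville: "trivial_Poisson_boundary \<Gamma> p"
begin

lemma AE_p: "AE s in measure_pmf p. s \<in> carrier \<Gamma>"
  using p_carrier by (auto simp: AE_measure_pmf_iff)

lemma harmonic_constant: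
  fixes H :: "'g \<Rightarrow> real"
  assumes bound: "\<And>x. x \<in> carrier \<Gamma> \<Longrightarrow> \<bar>H x\<bar> \<le> C"
    and harm: "\<And>x. x \<in> carrier \<Gamma> \<Longrightarrow> H x = measure_pmf.expectation p (\<lambda>s. H (x \<otimes> s))"
    and xy: "x \<in> carrier \<Gamma>" "y \<in> carrier \<Gamma>"
  shows "H x = H y"
proof -
  have "bounded_harmonic \<Gamma> p H"
    unfolding bounded_harmonic_def
  proof (intro conjI ballI)
    fix x assume x: "x \<in> carrier \<Gamma>"
    have "integrable (measure_pmf p) (\<lambda>s. H (x \<otimes> s))"
      using bound x p_carrier
      by (intro measure_pmf.integrable_const_bound[where B=C]) (auto simp: AE_measure_pmf_iff)
    then show "H x = (\<Sum>\<^sub>\<infinity>s\<in>carrier \<Gamma>. pmf p s * H (x \<otimes> s))"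
      using infsum_pmf_mult[OF p_carrier] harm[OF x] by simp
  qed (use bound in auto)
  then show ?thesis
    using Liouville xy unfolding trivial_Poisson_boundary_def by metis
qed

text \<open>The new step is put in front, so that averaging
  \<open>f (x \<otimes> s \<otimes> y)\<close> over the step \<open>s\<close> turns the k-th power
  into the next one.\<close>

primrec conv_pow :: "nat \<Rightarrow> 'g pmf" where
  "conv_pow 0 = return_pmf \<one>"
| "conv_pow (Suc k) = bind_pmf p (\<lambda>s. map_pmf (\<lambda>y. s \<otimes> y) (conv_pow k))"

lemma conv_pow_carrier: "set_pmf (conv_pow k) \<subseteq> carrier \<Gamma>"
  by (induction k) (use p_carrier in auto)

definition cesaro :: "nat \<Rightarrow> 'g pmf" where
  "cesaro n = bind_pmf (pmf_of_set {..n}) conv_pow"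

lemma cesaro_carrier: "set_pmf (cesaro n) \<subseteq> carrier \<Gamma>"
  using conv_pow_carrier by (auto simp: cesaro_def)

text \<open>Averaging over \<open>s\<close> raises each power by one, so the difference telescopes
  to two terms of size at most 1, divided by the \<open>n + 1\<close> terms of the mean.\<close>

lemma cesaro_almost_harmonic:
  fixes f :: "'g \<Rightarrow> real"
  assumes f: "\<And>x. \<bar>f x\<bar> \<le> 1" and x: "x \<in> carrier \<Gamma>"
  shows "\<bar>measure_pmf.expectation p (\<lambda>s. measure_pmf.expectation (cesaro n) (\<lambda>y. f (x \<otimes> s \<otimes> y)))
    - measure_pmf.expectation (cesaro n) (\<lambda>y. f (x \<otimes> y))\<bar> \<le> 2 / (real n + 1)"
proof -
  define A where "A k z = measure_pmf.expectation (conv_pow k) (\<lambda>y. f (z \<otimes> y))" for k z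
  have A_bound: "\<bar>A k z\<bar> \<le> 1" for k z
    unfolding A_def by (rule abs_expectation_le) (rule f)
  have A_int: "integrable (measure_pmf p) (\<lambda>s. A k (x \<otimes> s))" for k
    using A_bound by (intro measure_pmf.integrable_const_bound[where B=1]) auto
  have step: "measure_pmf.expectation p (\<lambda>s. A k (x \<otimes> s)) = A (Suc k) x" for k
  proof -
    have "A (Suc k) x = measure_pmf.expectation p (\<lambda>s. measure_pmf.expectation (conv_pow k) (\<lambda>y. f (x \<otimes> (s \<otimes> y))))"
      unfolding A_def conv_pow.simps by (subst expectation_bind_pmf_bounded[OF f]) simp
    also have "\<dots> = measure_pmf.expectation p (\<lambda>s. A k (x \<otimes> s))"
    proof (rule integral_cong_AE)
      show "AE s in measure_pmf p. measure_pmf.expectation (conv_pow k) (\<lambda>y. f (x \<otimes> (s \<otimes> y))) = A k (x \<otimes> s)"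
        using AE_p
      proof eventually_elim
        case (elim s)
        show ?case
          unfolding A_def using conv_pow_carrier[of k] x elim
          by (intro integral_cong_AE) (auto simp: AE_measure_pmf_iff m_assoc subset_iff)
      qed
    qed simp_all
    finally show ?thesis by simp
  qed
  have ces: "measure_pmf.expectation (cesaro n) (\<lambda>y. f (z \<otimes> y)) = (\<Sum>k\<le>n. A k z) / (real n + 1)" for z
    unfolding cesaro_def by (subst expectation_bind_pmf_bounded[OF f])
      (simp add: integral_pmf_of_set A_def add.commute)
  have "measure_pmf.expectation p (\<lambda>s. measure_pmf.expectation (cesaro n) (\<lambda>y. f (x \<otimes> s \<otimes> y)))
      = (\<Sum>k\<le>n. A (Suc k) x) / (real n + 1)"
    unfolding ces using A_int by (simp add: step)
  then have "measure_pmf.expectation p (\<lambda>s. measure_pmf.expectation (cesaro n) (\<lambda>y. f (x \<otimes> s \<otimes> y)))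
    - measure_pmf.expectation (cesaro n) (\<lambda>y. f (x \<otimes> y)) = (\<Sum>k\<le>n. A (Suc k) x - A k x) / (real n + 1)"
    by (simp add: ces sum_subtractf diff_divide_distrib)
  also have "(\<Sum>k\<le>n. A (Suc k) x - A k x) = A (Suc n) x - A 0 x"
    using sum_lessThan_telescope[of "\<lambda>k. A k x" "Suc n"] by (simp add: lessThan_Suc_atMost)
  also have "\<bar>(A (Suc n) x - A 0 x) / (real n + 1)\<bar> \<le> 2 / (real n + 1)"
    using A_bound[of "Suc n" x] A_bound[of 0 x] by (simp add: divide_right_mono)
  finally show ?thesis .
qed

text \<open>A sequence of test functions violating the conclusion would have a nonconstant bounded
  harmonic function as a pointwise limit point.\<close>

lemma cesaro_almost_invariant:
  fixes \<delta> :: real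
  assumes a: "a \<in> carrier \<Gamma>" and "\<delta> > 0"
  shows "\<forall>\<^sub>F n in sequentially. \<forall>f. (\<forall>x. \<bar>f x\<bar> \<le> 1) \<longrightarrow>
    \<bar>measure_pmf.expectation (cesaro n) (\<lambda>y. f (a \<otimes> y)) - measure_pmf.expectation (cesaro n) f\<bar> \<le> \<delta>"
proof (rule ccontr)
  assume "\<not> ?thesis"
  from not_eventually_sequentiallyD[OF this] obtain r :: "nat \<Rightarrow> nat" where r: "strict_mono r"
    and nr: "\<forall>n. \<not> (\<forall>f. (\<forall>x. \<bar>f x\<bar> \<le> 1) \<longrightarrow>
      \<bar>measure_pmf.expectation (cesaro (r n)) (\<lambda>y. f (a \<otimes> y)) - measure_pmf.expectation (cesaro (r n)) f\<bar> \<le> \<delta>)"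
    by blast
  have "\<exists>f. (\<forall>x. \<bar>f x\<bar> \<le> 1) \<and>
      \<bar>measure_pmf.expectation (cesaro (r n)) (\<lambda>y. f (a \<otimes> y)) - measure_pmf.expectation (cesaro (r n)) f\<bar> > \<delta>" for n
    using spec[OF nr, of n] unfolding not_all not_imp linorder_not_le .
  then obtain f where f: "\<And>n x. \<bar>f n x\<bar> \<le> 1" and
    bad: "\<And>n. \<bar>measure_pmf.expectation (cesaro (r n)) (\<lambda>y. f n (a \<otimes> y)) - measure_pmf.expectation (cesaro (r n)) (f n)\<bar> > \<delta>"
    by metis
  \<comment> \<open>Translating the test function turns the violated inequality into a gap between
    \<open>h n a\<close> and \<open>h n \<one>\<close>, which survives in a pointwise limit.\<close>
  define h where "h n x = measure_pmf.expectation (cesaro (r n)) (\<lambda>y. f n (x \<otimes> y))" for n x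
  have h_bound: "\<bar>h n x\<bar> \<le> 1" for n x
    unfolding h_def by (rule abs_expectation_le) (rule f)
  obtain k where k: "strict_mono k" "\<And>x. x \<in> carrier \<Gamma> \<Longrightarrow> \<exists>l. (\<lambda>n. h (k n) x) \<longlonglongrightarrow> l"
    using function_convergent_subsequence[OF countable_carrier, of h 1] h_bound by auto
  obtain H where lim: "\<And>x. x \<in> carrier \<Gamma> \<Longrightarrow> (\<lambda>n. h (k n) x) \<longlonglongrightarrow> H x"
    using k(2) by metis
  have H_bound: "\<bar>H x\<bar> \<le> 1" if "x \<in> carrier \<Gamma>" for x
    using tendsto_rabs[OF lim[OF that]] h_bound by (intro LIMSEQ_le_const2) auto
  have "H x = measure_pmf.expectation p (\<lambda>s. H (x \<otimes> s))" if x: "x \<in> carrier \<Gamma>" for x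
  proof -
    have 1: "(\<lambda>n. measure_pmf.expectation p (\<lambda>s. h (k n) (x \<otimes> s))) \<longlonglongrightarrow> measure_pmf.expectation p (\<lambda>s. H (x \<otimes> s))"
    proof (rule integral_dominated_convergence[where w="\<lambda>_. 1"])
      show "AE s in measure_pmf p. (\<lambda>n. h (k n) (x \<otimes> s)) \<longlonglongrightarrow> H (x \<otimes> s)"
        using AE_p by eventually_elim (use x lim in auto)
    qed (use h_bound in auto)
    have "(\<lambda>n. measure_pmf.expectation p (\<lambda>s. h (k n) (x \<otimes> s)) - h (k n) x) \<longlonglongrightarrow> 0"
    proof (rule Lim_null_comparison)
      show "\<forall>\<^sub>F n in sequentially. norm (measure_pmf.expectation p (\<lambda>s. h (k n) (x \<otimes> s)) - h (k n) x) \<le> 2 / (real n + 1)"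
      proof (intro always_eventually allI)
        fix n
        have "n \<le> r (k n)"
          \<comment> \<open>Both subsequences are strictly increasing, so the Cesaro index is at
            least \<open>n\<close> and the harmonicity defect tends to 0.\<close>
          using seq_suble[OF r] seq_suble[OF k(1)] le_trans by blast
        then have "2 / (real (r (k n)) + 1) \<le> 2 / (real n + 1)"
          by (intro divide_left_mono) auto
        then show "norm (measure_pmf.expectation p (\<lambda>s. h (k n) (x \<otimes> s)) - h (k n) x) \<le> 2 / (real n + 1)"
          using cesaro_almost_harmonic[of "f (k n)" x "r (k n)", OF f x] unfolding h_def real_norm_def by linarith
      qed
      show "(\<lambda>n. 2 / (real n + 1)) \<longlonglongrightarrow> 0" by real_asymp
    qed
    from tendsto_diff[OF 1 this] have "(\<lambda>n. h (k n) x) \<longlonglongrightarrow> measure_pmf.expectation p (\<lambda>s. H (x \<otimes> s))"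
      by simp
    then show ?thesis using lim[OF x] LIMSEQ_unique by blast
  qed
  then have eq: "H a = H \<one>"
    using H_bound a by (intro harmonic_constant[of H 1]) auto
  have h1: "h n \<one> = measure_pmf.expectation (cesaro (r n)) (f n)" for n
    unfolding h_def using cesaro_carrier[of "r n"]
    by (intro integral_cong_AE) (auto simp: AE_measure_pmf_iff subset_iff)
  have "(\<lambda>n. \<bar>h (k n) a - h (k n) \<one>\<bar>) \<longlonglongrightarrow> \<bar>H a - H \<one>\<bar>"
    using a by (intro tendsto_intros lim) auto
  moreover have "\<delta> \<le> \<bar>h (k n) a - h (k n) \<one>\<bar>" for n
    using bad[of "k n"] unfolding h1 by (simp add: h_def)
  ultimately have "\<delta> \<le> \<bar>H a - H \<one>\<bar>"
    by (intro LIMSEQ_le_const) auto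
  then show False using eq \<open>\<delta> > 0\<close> by simp
qed

text \<open>\<open>cesaro n\<close> is almost invariant for large \<open>n\<close>; the weight is
  its truncation to a finite set \<open>K\<close>, which can only lower the maxima. A maximum over
  translates exceeds \<open>q a\<close> by at most the sum over \<open>B\<close> of the differences
  \<open>\<bar>q (inv b \<otimes> a) - q a\<bar>\<close>, whose sums over \<open>a\<close> are
  small.\<close>

lemma almost_invariant_weights:
  assumes B: "finite B" "B \<subseteq> carrier \<Gamma>" and \<delta>: "\<delta> > 0"
  obtains K and m :: "'g \<Rightarrow> real" where "finite K" "K \<subseteq> carrier \<Gamma>" "\<And>x. 0 \<le> m x" "\<And>x. x \<notin> K \<Longrightarrow> m x = 0"
    "1 - \<delta> \<le> (\<Sum>x\<in>K. m x)"
    "\<And>J B'. finite J \<Longrightarrow> J \<subseteq> carrier \<Gamma> \<Longrightarrow> B' \<subseteq> B \<Longrightarrow> B' \<noteq> {} \<Longrightarrow>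
      (\<Sum>a\<in>J. MAX b\<in>B'. m (inv b \<otimes> a)) \<le> 1 + \<delta>"
proof -
  \<comment> \<open>One error \<epsilon> for each element of \<open>B\<close> adds up to at most
    \<delta>; the summand 1 avoids a division by zero.\<close>
  define \<epsilon> where "\<epsilon> = \<delta> / (card B + 1)"
  have \<epsilon>: "\<epsilon> > 0" using \<delta> by (simp add: \<epsilon>_def)
  have "\<forall>\<^sub>F n in sequentially. \<forall>b\<in>B. \<forall>f. (\<forall>x. \<bar>f x\<bar> \<le> 1) \<longrightarrow>
    \<bar>measure_pmf.expectation (cesaro n) (\<lambda>y. f (b \<otimes> y)) - measure_pmf.expectation (cesaro n) f\<bar> \<le> \<epsilon>"
    using B cesaro_almost_invariant[OF _ \<epsilon>] by (subst eventually_ball_finite_distrib) auto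
  then obtain n where n: "\<And>b f. b \<in> B \<Longrightarrow> (\<And>x. \<bar>f x\<bar> \<le> 1) \<Longrightarrow>
    \<bar>measure_pmf.expectation (cesaro n) (\<lambda>y. f (b \<otimes> y)) - measure_pmf.expectation (cesaro n) f\<bar> \<le> \<epsilon>"
    unfolding eventually_sequentially by blast
  define q where "q = pmf (cesaro n)"
  have q0: "0 \<le> q x" for x by (simp add: q_def)
  have shift: "(\<Sum>x\<in>J. \<bar>q (inv b \<otimes> x) - q x\<bar>) \<le> \<epsilon>" if b: "b \<in> B" and J: "finite J" "J \<subseteq> carrier \<Gamma>" for b J
  proof -
    have bG: "b \<in> carrier \<Gamma>" using b B by blast
    \<comment> \<open>Testing against signs turns almost invariance into an l1 bound between the
      weight and its translate.\<close>
    define f where "f x = (if x \<in> J then sgn (q (inv b \<otimes> x) - q x) else 0)" for x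
    have 1: "measure_pmf.expectation (cesaro n) f = (\<Sum>x\<in>J. f x * q x)"
      unfolding q_def by (rule integral_measure_pmf_real[OF J(1)]) (simp add: f_def split: if_split_asm)
    have "measure_pmf.expectation (cesaro n) (\<lambda>y. f (b \<otimes> y)) = (\<Sum>y\<in>(\<lambda>x. inv b \<otimes> x) ` J. f (b \<otimes> y) * q y)"
      unfolding q_def
    proof (rule integral_measure_pmf_real)
      fix y assume y: "y \<in> set_pmf (cesaro n)" "f (b \<otimes> y) \<noteq> 0"
      then have "y \<in> carrier \<Gamma>" "b \<otimes> y \<in> J" using cesaro_carrier[of n] by (auto simp: f_def split: if_split_asm)
      then show "y \<in> (\<lambda>x. inv b \<otimes> x) ` J"
        using bG by (intro image_eqI[of _ _ "b \<otimes> y"]) (auto simp: m_assoc[symmetric])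
    qed (use J in auto)
    also have "\<dots> = (\<Sum>x\<in>J. f (b \<otimes> (inv b \<otimes> x)) * q (inv b \<otimes> x))"
      using J bG by (subst sum.reindex) (auto simp: inj_on_def subset_iff)
    also have "\<dots> = (\<Sum>x\<in>J. f x * q (inv b \<otimes> x))"
      using J bG by (intro sum.cong) (auto simp: m_assoc[symmetric] subset_iff)
    finally have "measure_pmf.expectation (cesaro n) (\<lambda>y. f (b \<otimes> y)) - measure_pmf.expectation (cesaro n) f
        = (\<Sum>x\<in>J. f x * (q (inv b \<otimes> x) - q x))"
      unfolding 1 by (simp add: sum_subtractf right_diff_distrib)
    also have "\<dots> = (\<Sum>x\<in>J. \<bar>q (inv b \<otimes> x) - q x\<bar>)"
      by (intro sum.cong) (simp_all add: f_def abs_sgn mult.commute)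
    finally show ?thesis
      using n[OF b, of f] by (simp add: f_def sgn_if)
  qed
  obtain K where K: "finite K" "K \<subseteq> carrier \<Gamma>" "1 - \<delta> \<le> sum q K"
  proof -
    define A where "A i = {x \<in> carrier \<Gamma>. to_nat_on (carrier \<Gamma>) x < i}" for i
    have fin: "finite (A i)" for i
      unfolding A_def by (rule finite_to_nat_on_less[OF countable_carrier])
    have "(\<lambda>i. measure_pmf.prob (cesaro n) (A i)) \<longlonglongrightarrow> measure_pmf.prob (cesaro n) (\<Union>i. A i)"
      by (rule measure_pmf.finite_Lim_measure_incseq) (auto simp: A_def incseq_def)
    moreover have "(\<Union>i. A i) = carrier \<Gamma>" by (auto simp: A_def)
    moreover have "measure_pmf.prob (cesaro n) (carrier \<Gamma>) = 1"
      using cesaro_carrier[of n] by (subst measure_pmf.prob_eq_1) (auto simp: AE_measure_pmf_iff)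
    ultimately have "\<forall>\<^sub>F i in sequentially. 1 - \<delta> < measure_pmf.prob (cesaro n) (A i)"
      using \<delta> by (intro order_tendstoD(1)) auto
    then obtain i where "1 - \<delta> < measure_pmf.prob (cesaro n) (A i)"
      by (auto simp: eventually_sequentially)
    then show ?thesis
      using that[of "A i"] fin[of i] measure_measure_pmf_finite[OF fin, of "cesaro n" i] by (auto simp: A_def q_def)
  qed
  define m where "m x = (if x \<in> K then q x else 0)" for x
  show ?thesis
  proof (rule that[of K m])
    show "1 - \<delta> \<le> (\<Sum>x\<in>K. m x)" using K by (simp add: m_def)
    fix J B' assume J: "finite J" "J \<subseteq> carrier \<Gamma>" and B': "B' \<subseteq> B" "B' \<noteq> {}"
    have finB': "finite B'" using B' B finite_subset by blast
    have "(MAX b\<in>B'. m (inv b \<otimes> a)) \<le> q a + (\<Sum>b\<in>B. \<bar>q (inv b \<otimes> a) - q a\<bar>)" for a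
    proof -
      have "m (inv b \<otimes> a) \<le> q a + (\<Sum>b\<in>B. \<bar>q (inv b \<otimes> a) - q a\<bar>)" if "b \<in> B'" for b
      proof -
        have "m (inv b \<otimes> a) \<le> q (inv b \<otimes> a)" using q0 by (simp add: m_def)
        also have "\<dots> \<le> q a + \<bar>q (inv b \<otimes> a) - q a\<bar>" by linarith
        also have "\<bar>q (inv b \<otimes> a) - q a\<bar> \<le> (\<Sum>b\<in>B. \<bar>q (inv b \<otimes> a) - q a\<bar>)"
          using that B B' by (intro member_le_sum[of b]) auto
        finally show ?thesis by simp
      qed
      then show ?thesis using finB' B' by (subst Max_le_iff) auto
    qed
    then have "(\<Sum>a\<in>J. MAX b\<in>B'. m (inv b \<otimes> a)) \<le> (\<Sum>a\<in>J. q a + (\<Sum>b\<in>B. \<bar>q (inv b \<otimes> a) - q a\<bar>))"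
      by (intro sum_mono)
    also have "\<dots> = sum q J + (\<Sum>b\<in>B. \<Sum>a\<in>J. \<bar>q (inv b \<otimes> a) - q a\<bar>)"
      by (simp add: sum.distrib sum.swap[of _ B J])
    also have "\<dots> \<le> 1 + (\<Sum>b\<in>B. \<epsilon>)"
    proof (intro add_mono sum_mono shift J)
      show "sum q J \<le> 1"
        using measure_measure_pmf_finite[OF J(1), of "cesaro n"] measure_pmf.prob_le_1[of "cesaro n" J] by (simp add: q_def)
    qed
    also have "\<dots> \<le> 1 + \<delta>"
      using \<delta> by (simp add: \<epsilon>_def field_simps)
    finally show "(\<Sum>a\<in>J. MAX b\<in>B'. m (inv b \<otimes> a)) \<le> 1 + \<delta>" .
  qed (use K q0 in \<open>auto simp: m_def\<close>)
qed

end

locale Liouville_lamplighter = lamplighter_walk L \<Gamma> \<mu>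
  for L :: "('l, 'a) monoid_scheme" and \<Gamma> :: "('g, 'b) monoid_scheme"
    and \<mu> :: "(('g \<Rightarrow> 'l) \<times> 'g) pmf" +
  assumes base_Liouville: "trivial_Poisson_boundary \<Gamma> (map_pmf snd \<mu>)"
begin

sublocale base: Liouville_walk \<Gamma> "map_pmf snd \<mu>"
proof (intro Liouville_walk.intro Liouville_walk_axioms.intro \<Gamma> countable_\<Gamma> base_Liouville)
  show "set_pmf (map_pmf snd \<mu>) \<subseteq> carrier \<Gamma>"
    using set_pmf_carrier by (auto simp: carrier_G)
qed

text \<open>Far from the origin \<open>\<nu>\<close> and \<open>g\<nu>\<close> agree up to \<open>\<delta>\<close>: a limit point of the functions
  \<open>z \<mapsto> z\<nu>(f)\<close>, for \<open>f\<close> ignoring larger and larger finite sets, is harmonic and ignores lamps.\<close>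

lemma translates_agree_far_away:
  fixes \<delta> :: real
  assumes g: "g \<in> carrier G" and \<delta>: "\<delta> > 0"
  shows "\<exists>B. finite B \<and> B \<subseteq> carrier \<Gamma> \<and> (\<forall>f\<in>borel_measurable CX. (\<forall>\<phi>. \<bar>f \<phi>\<bar> \<le> 1) \<longrightarrow>
    (\<forall>\<phi>\<in>conf. \<forall>\<psi>\<in>conf. (\<forall>x\<in>carrier \<Gamma> - B. \<phi> x = \<psi> x) \<longrightarrow> f \<phi> = f \<psi>) \<longrightarrow>
    \<bar>(\<integral>\<phi>. f (act g \<phi>) \<partial>\<nu>) - (\<integral>\<phi>. f \<phi> \<partial>\<nu>)\<bar> \<le> \<delta>)"
proof (rule ccontr)
  define B where "B j = {x \<in> carrier \<Gamma>. to_nat_on (carrier \<Gamma>) x < j}" for j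
  have B: "finite (B j)" "B j \<subseteq> carrier \<Gamma>" for j
    using finite_to_nat_on_less[OF countable_\<Gamma>] by (auto simp: B_def)
  define P where "P j f \<longleftrightarrow> f \<in> borel_measurable CX \<and> (\<forall>\<phi>. \<bar>f \<phi>\<bar> \<le> 1) \<and>
    (\<forall>\<phi>\<in>conf. \<forall>\<psi>\<in>conf. (\<forall>x\<in>carrier \<Gamma> - B j. \<phi> x = \<psi> x) \<longrightarrow> f \<phi> = f \<psi>) \<and>
    \<bar>(\<integral>\<phi>. f (act g \<phi>) \<partial>\<nu>) - (\<integral>\<phi>. f \<phi> \<partial>\<nu>)\<bar> > \<delta>" for j and f :: "('g \<Rightarrow> 'l) \<Rightarrow> real"
  assume "\<not> ?thesis"
  then have "\<exists>f. P j f" for j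
    using B[of j] unfolding P_def by (metis not_le)
  then obtain f where P: "\<And>j. P j (f j)" by metis
  have f: "\<And>j. f j \<in> borel_measurable CX" "\<And>j \<phi>. \<bar>f j \<phi>\<bar> \<le> 1"
    "\<And>j. \<bar>(\<integral>\<phi>. f j (act g \<phi>) \<partial>\<nu>) - (\<integral>\<phi>. f j \<phi> \<partial>\<nu>)\<bar> > \<delta>"
    using P unfolding P_def by auto
  have f_far: "f j \<phi> = f j \<psi>" if "\<phi> \<in> conf" "\<psi> \<in> conf" "\<And>x. x \<in> carrier \<Gamma> - B j \<Longrightarrow> \<phi> x = \<psi> x" for j \<phi> \<psi>
    using P[of j, unfolded P_def, THEN conjunct2, THEN conjunct2, THEN conjunct1, rule_format, OF that(1,2)] that(3)
    by simp
  have fm[measurable]: "f j \<in> borel_measurable \<nu>" for j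
    using f(1)[of j] by (simp add: measurable_cong_sets[OF sets_\<nu> refl])
  have fam: "(\<lambda>\<phi>. f j (act z \<phi>)) \<in> borel_measurable \<nu>" if "z \<in> carrier G" for j z
    by (rule measurable_compose[OF conf.meas_act[OF that] fm])
  \<comment> \<open>This is the mean of \<open>f j\<close> under the translate of \<nu> by
    \<open>z\<close>; stationarity makes it harmonic in \<open>z\<close>.\<close>
  define h where "h j z = (\<integral>\<phi>. f j (act z \<phi>) \<partial>\<nu>)" for j z
  have h_bound: "\<bar>h j z\<bar> \<le> 1" if z: "z \<in> carrier G" for j z
  proof -
    have int: "integrable \<nu> (\<lambda>\<phi>. f j (act z \<phi>))"
      using f(2) fam[OF z] by (intro conf.integrable_const_bound[where B=1]) auto
    have "h j z \<le> (\<integral>\<phi>. 1 \<partial>\<nu>)" "(\<integral>\<phi>. - 1 \<partial>\<nu>) \<le> h j z"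
      unfolding h_def using f(2) by (intro integral_mono int; simp add: abs_le_iff minus_le_iff)+
    then show ?thesis by (simp add: abs_le_iff conf.prob_space)
  qed
  have h_harm: "h j z = measure_pmf.expectation \<mu> (\<lambda>s. h j (z \<otimes>\<^bsub>G\<^esub> s))" if z: "z \<in> carrier G" for j z
  proof -
    have "h j z = measure_pmf.expectation \<mu> (\<lambda>s. \<integral>\<phi>. f j (act z (act s \<phi>)) \<partial>\<nu>)"
      unfolding h_def using f(2) by (intro conf.integral_stationary[OF fam[OF z]])
    also have "\<dots> = measure_pmf.expectation \<mu> (\<lambda>s. h j (z \<otimes>\<^bsub>G\<^esub> s))"
    proof (rule integral_cong_AE)
      show "AE s in measure_pmf \<mu>. (\<integral>\<phi>. f j (act z (act s \<phi>)) \<partial>\<nu>) = h j (z \<otimes>\<^bsub>G\<^esub> s)"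
        using conf.AE_carrier
      proof eventually_elim
        case (elim s)
        then show ?case
          unfolding h_def using z by (intro Bochner_Integration.integral_cong) (simp_all add: conf.act_mult)
      qed
    qed simp_all
    finally show ?thesis .
  qed
  obtain k where k: "strict_mono k" "\<And>z. z \<in> carrier G \<Longrightarrow> \<exists>l. (\<lambda>n. h (k n) z) \<longlonglongrightarrow> l"
    using function_convergent_subsequence[OF countable_G, of h 1] h_bound by auto
  obtain H where lim: "\<And>z. z \<in> carrier G \<Longrightarrow> (\<lambda>n. h (k n) z) \<longlonglongrightarrow> H z"
    using k(2) by metis
  have H_bound: "\<bar>H z\<bar> \<le> 1" if "z \<in> carrier G" for z
    using tendsto_rabs[OF lim[OF that]] h_bound[OF that] by (intro LIMSEQ_le_const2) auto
  have H_harm: "H z = measure_pmf.expectation \<mu> (\<lambda>s. H (z \<otimes>\<^bsub>G\<^esub> s))" if z: "z \<in> carrier G" for z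
  proof -
    have "(\<lambda>n. measure_pmf.expectation \<mu> (\<lambda>s. h (k n) (z \<otimes>\<^bsub>G\<^esub> s))) \<longlonglongrightarrow> measure_pmf.expectation \<mu> (\<lambda>s. H (z \<otimes>\<^bsub>G\<^esub> s))"
    proof (rule integral_dominated_convergence[where w="\<lambda>_. 1"])
      show "AE s in measure_pmf \<mu>. (\<lambda>n. h (k n) (z \<otimes>\<^bsub>G\<^esub> s)) \<longlonglongrightarrow> H (z \<otimes>\<^bsub>G\<^esub> s)"
        using conf.AE_carrier by eventually_elim (use z lim in auto)
      show "AE s in measure_pmf \<mu>. norm (h (k n) (z \<otimes>\<^bsub>G\<^esub> s)) \<le> 1" for n
        using conf.AE_carrier by eventually_elim (use z h_bound in auto)
    qed auto
    then show ?thesis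
      using lim[OF z] LIMSEQ_unique unfolding h_harm[OF z, symmetric] by blast
  qed
  let ?e = "\<lambda>x\<in>carrier \<Gamma>. \<one>\<^bsub>L\<^esub>"
  \<comment> \<open>The two elements translate configurations alike outside the finite support of
    \<zeta>. Once \<open>B j\<close> contains that support, \<open>f j\<close> cannot tell them
    apart.\<close>
  have H_base: "H (\<zeta>, a) = H (?e, a)" if z: "(\<zeta>, a) \<in> carrier G" for \<zeta> a
  proof -
    have e: "(?e, a) \<in> carrier G" using z one_lamp_configs by (simp add: carrier_G)
    have \<zeta>: "\<zeta> \<in> lamp_configs L \<Gamma>" "a \<in> carrier \<Gamma>" using z by (auto simp: carrier_G)
    let ?s = "{x \<in> carrier \<Gamma>. \<zeta> x \<noteq> \<one>\<^bsub>L\<^esub>}"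
    have "finite ?s" using \<zeta> by (simp add: lamp_configs_def)
    then have "\<forall>\<^sub>F j in sequentially. \<forall>x\<in>?s. x \<in> B j"
    proof (subst eventually_ball_finite_distrib, assumption, intro ballI)
      fix x assume "x \<in> ?s"
      then show "\<forall>\<^sub>F j in sequentially. x \<in> B j"
        unfolding eventually_sequentially B_def
        by (intro exI[of _ "Suc (to_nat_on (carrier \<Gamma>) x)"]) auto
    qed
    then have "\<forall>\<^sub>F j in sequentially. h j (\<zeta>, a) = h j (?e, a)"
    proof eventually_elim
      case (elim j)
      have "f j (act (\<zeta>, a) \<phi>) = f j (act (?e, a) \<phi>)" if "\<phi> \<in> conf" for \<phi>
      proof (rule f_far)
        show "act (\<zeta>, a) \<phi> \<in> conf" "act (?e, a) \<phi> \<in> conf"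
          using translate_conf z e that by (simp_all add: act_eq)
        fix x assume "x \<in> carrier \<Gamma> - B j"
        then show "act (\<zeta>, a) \<phi> x = act (?e, a) \<phi> x"
          using elim that \<zeta> by (auto simp: act_eq translate_def)
      qed
      then show ?case
        unfolding h_def by (intro Bochner_Integration.integral_cong) (simp_all add: space_\<nu>)
    qed
    then have "\<forall>\<^sub>F n in sequentially. h (k n) (\<zeta>, a) = h (k n) (?e, a)"
      by (rule eventually_subseq[OF k(1)])
    then have "(\<lambda>n. h (k n) (\<zeta>, a)) \<longlonglongrightarrow> H (?e, a)"
      using lim[OF e] by (simp add: tendsto_cong)
    then show ?thesis using lim[OF z] LIMSEQ_unique by blast
  qed
  have e_carrier: "(?e, a) \<in> carrier G" if "a \<in> carrier \<Gamma>" for a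
    using that one_lamp_configs by (simp add: carrier_G)
  \<comment> \<open>By \<open>H_base\<close> the limit \<open>H\<close> descends to a function on
    the base group, which is harmonic for the projected walk and hence constant.\<close>
  define K where "K a = H (?e, a)" for a
  have K_harm: "K a = measure_pmf.expectation (map_pmf snd \<mu>) (\<lambda>s. K (a \<otimes>\<^bsub>\<Gamma>\<^esub> s))" if a: "a \<in> carrier \<Gamma>" for a
  proof -
    have "K a = measure_pmf.expectation \<mu> (\<lambda>s. H ((?e, a) \<otimes>\<^bsub>G\<^esub> s))"
      unfolding K_def by (rule H_harm[OF e_carrier[OF a]])
    also have "\<dots> = measure_pmf.expectation \<mu> (\<lambda>s. K (a \<otimes>\<^bsub>\<Gamma>\<^esub> snd s))"
    proof (rule integral_cong_AE)
      show "AE s in measure_pmf \<mu>. H ((?e, a) \<otimes>\<^bsub>G\<^esub> s) = K (a \<otimes>\<^bsub>\<Gamma>\<^esub> snd s)"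
        using conf.AE_carrier
      proof eventually_elim
        case (elim s)
        obtain \<zeta> b where s: "s = (\<zeta>, b)" by fastforce
        have "(?e, a) \<otimes>\<^bsub>G\<^esub> s \<in> carrier G" using e_carrier[OF a] elim by simp
        then show ?case unfolding s mult_G K_def snd_conv by (rule H_base)
      qed
    qed simp_all
    finally show ?thesis by simp
  qed
  have K_const: "K a = K \<one>\<^bsub>\<Gamma>\<^esub>" if "a \<in> carrier \<Gamma>" for a
  proof (rule base.harmonic_constant[of K 1])
    show "\<bar>K x\<bar> \<le> 1" if "x \<in> carrier \<Gamma>" for x
      unfolding K_def by (rule H_bound[OF e_carrier[OF that]])
  qed (use that K_harm in auto)
  have "H g = K (snd g)"
    using H_base[of "fst g" "snd g"] g by (simp add: K_def)
  also have "\<dots> = K \<one>\<^bsub>\<Gamma>\<^esub>" using g by (intro K_const) (auto simp: carrier_G)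
  also have "\<dots> = H \<one>\<^bsub>G\<^esub>" by (simp add: K_def lamplighter_def)
  finally have eq: "H g = H \<one>\<^bsub>G\<^esub>" .
  have h1: "h j \<one>\<^bsub>G\<^esub> = (\<integral>\<phi>. f j \<phi> \<partial>\<nu>)" for j
    unfolding h_def by (intro Bochner_Integration.integral_cong) (simp_all add: conf.act_one)
  have "(\<lambda>n. \<bar>h (k n) g - h (k n) \<one>\<^bsub>G\<^esub>\<bar>) \<longlonglongrightarrow> \<bar>H g - H \<one>\<^bsub>G\<^esub>\<bar>"
    using g by (intro tendsto_intros lim) auto
  moreover have "\<delta> \<le> \<bar>h (k n) g - h (k n) \<one>\<^bsub>G\<^esub>\<bar>" for n
    using f(3)[of "k n"] unfolding h1 by (simp add: h_def)
  ultimately have "\<delta> \<le> \<bar>H g - H \<one>\<^bsub>G\<^esub>\<bar>"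
    by (intro LIMSEQ_le_const) auto
  then show False using eq \<delta> by simp
qed

end

section \<open>Random marks\<close>

text \<open>Fubini for the product of \<open>M\<close> with the pmf restricted to its support: only
  there are measurability and the bound available, and over a countable support joint measurability
  follows from that of each \<open>f s\<close>.\<close>

lemma
  fixes f :: "'a \<Rightarrow> 'x \<Rightarrow> real"
  assumes M: "prob_space M" and f: "\<And>s. s \<in> set_pmf p \<Longrightarrow> f s \<in> borel_measurable M"
    and bound: "\<And>s x. s \<in> set_pmf p \<Longrightarrow> x \<in> space M \<Longrightarrow> \<bar>f s x\<bar> \<le> C"
  shows borel_measurable_expectation: "(\<lambda>x. measure_pmf.expectation p (\<lambda>s. f s x)) \<in> borel_measurable M"
    and integral_expectation_swap:
      "(\<integral>x. measure_pmf.expectation p (\<lambda>s. f s x) \<partial>M) = measure_pmf.expectation p (\<lambda>s. \<integral>x. f s x \<partial>M)"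
proof -
  interpret prob_space M by fact
  let ?p = "restrict_space (measure_pmf p) (set_pmf p)"
  interpret p: prob_space ?p
    by (intro prob_space_restrict_space) (auto simp: measure_pmf.emeasure_eq_1_AE AE_measure_pmf_iff)
  interpret pair_prob_space ?p M by unfold_locales
  have sp: "space ?p = set_pmf p" by (simp add: space_restrict_space)
  have meas: "(\<lambda>(s, x). f s x) \<in> borel_measurable (?p \<Otimes>\<^sub>M M)"
    by (rule measurable_pair_restrict_pmf1) (simp_all add: f)
  have int: "integrable (?p \<Otimes>\<^sub>M M) (\<lambda>(s, x). f s x)"
    using meas bound by (intro integrable_const_bound[where B=C]) (auto intro!: AE_I2 simp: space_pair_measure sp)
  have restr: "measure_pmf.expectation p h = (\<integral>s. h s \<partial>?p)" for h :: "'a \<Rightarrow> real"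
    by (rule integral_pmf_restrict) simp
  show "(\<lambda>x. measure_pmf.expectation p (\<lambda>s. f s x)) \<in> borel_measurable M"
    unfolding restr using meas by measurable
  show "(\<integral>x. measure_pmf.expectation p (\<lambda>s. f s x) \<partial>M) = measure_pmf.expectation p (\<lambda>s. \<integral>x. f s x \<partial>M)"
    unfolding restr using Fubini_integral[OF int] by simp
qed

lemma abs_mult_le_one: "\<bar>x\<bar> \<le> 1 \<Longrightarrow> \<bar>y\<bar> \<le> 1 \<Longrightarrow> \<bar>x * y\<bar> \<le> 1" for x y :: real
  by (simp add: abs_mult mult_le_one)

lemma abs_exp_diff_le:
  fixes u v :: real
  assumes "0 \<le> u" "0 \<le> v"
  shows "\<bar>exp (- u) - exp (- v)\<bar> \<le> \<bar>u - v\<bar>"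
proof -
  have *: "exp (- u) - exp (- v) \<le> v - u" if "0 \<le> u" "u \<le> v" for u v :: real
  proof -
    have "1 + (u - v) \<le> exp (u - v)" by (rule exp_ge_add_one_self)
    then have "1 - exp (u - v) \<le> v - u" by linarith
    then have "exp (- u) * (1 - exp (u - v)) \<le> 1 * (v - u)"
      using that by (intro mult_mono) auto
    then show ?thesis by (simp add: right_diff_distrib exp_add[symmetric])
  qed
  show ?thesis
    using *[of u v] *[of v u] assms by (cases "u \<le> v") auto
qed

text \<open>The exponential law of rate 1: a label exceeds \<open>a \<ge> 0\<close> with probability
  \<open>exp (- a)\<close>, so for independent labels the thresholds add up in the exponent.\<close>

definition expo :: "real measure" where
  "expo = density lborel (exponential_density 1)"

lemma sets_expo [simp, measurable_cong]: "sets expo = sets borel"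
  by (simp add: expo_def)

lemma space_expo [simp]: "space expo = UNIV"
  by (simp add: expo_def)

lemma prob_space_expo: "prob_space expo"
  unfolding expo_def by (rule prob_space_exponential_density) simp

lemma emeasure_expo_greaterThan:
  assumes "0 \<le> a"
  shows "emeasure expo {a<..} = ennreal (exp (- a))"
proof -
  interpret prob_space expo by (rule prob_space_expo)
  have "distributed expo lborel (\<lambda>x. x) (exponential_density 1)"
    unfolding distributed_def by (simp add: expo_def distr_id2 exponential_density_nonneg)
  from exponential_distributedD_gt[OF this assms] show ?thesis
    by (simp add: emeasure_eq_measure greaterThan_def)
qed

section \<open>Exponential labels, marked sets and mixing\<close>

context Liouville_walk
begin

definition labels :: "('g \<Rightarrow> real) measure" where
  "labels = Pi\<^sub>M (carrier \<Gamma>) (\<lambda>_. expo)"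

definition shift :: "'g \<Rightarrow> ('g \<Rightarrow> real) \<Rightarrow> 'g \<Rightarrow> real" where
  "shift a U = (\<lambda>x\<in>carrier \<Gamma>. U (inv a \<otimes> x))"

sublocale labels: product_prob_space "\<lambda>_. expo" "carrier \<Gamma>"
proof -
  interpret prob_space expo by (rule prob_space_expo)
  show "product_prob_space (\<lambda>_. expo)" by unfold_locales
qed

lemma prob_space_labels: "prob_space labels"
  unfolding labels_def by (rule prob_space_PiM) (rule prob_space_expo)

lemma measurable_label [measurable]: "x \<in> carrier \<Gamma> \<Longrightarrow> (\<lambda>U. U x) \<in> borel_measurable labels"
proof -
  assume "x \<in> carrier \<Gamma>"
  then have "(\<lambda>U. U x) \<in> labels \<rightarrow>\<^sub>M expo"
    unfolding labels_def by (rule measurable_component_singleton)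
  then show ?thesis by (simp cong: measurable_cong_sets)
qed

lemma shift_measurable: "a \<in> carrier \<Gamma> \<Longrightarrow> shift a \<in> labels \<rightarrow>\<^sub>M labels"
  unfolding labels_def shift_def[abs_def] by (intro measurable_restrict measurable_component_singleton) auto

lemma distr_shift: "a \<in> carrier \<Gamma> \<Longrightarrow> distr labels labels (shift a) = labels"
  unfolding labels_def shift_def[abs_def]
  by (rule distr_PiM_reindex[of "carrier \<Gamma>" "\<lambda>_. expo" "\<lambda>x. inv a \<otimes> x" "carrier \<Gamma>"])
    (auto simp: prob_space_expo inj_on_def)

lemma space_labels: "space labels = carrier \<Gamma> \<rightarrow>\<^sub>E UNIV"
  by (simp add: labels_def space_PiM)

lemma shift_mult:
  assumes "a \<in> carrier \<Gamma>" "b \<in> carrier \<Gamma>"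
  shows "shift (a \<otimes> b) U = shift a (shift b U)"
  using assms by (auto simp: shift_def fun_eq_iff inv_mult_group m_assoc)

lemma shift_one: "U \<in> space labels \<Longrightarrow> shift \<one> U = U"
  by (auto simp: shift_def fun_eq_iff space_labels PiE_iff extensional_def)

lemma integral_shift:
  fixes f :: "_ \<Rightarrow> real"
  assumes "a \<in> carrier \<Gamma>" "f \<in> borel_measurable labels"
  shows "(\<integral>U. f (shift a U) \<partial>labels) = (\<integral>U. f U \<partial>labels)"
  using integral_distr[OF shift_measurable[OF assms(1)] assms(2)] distr_shift[OF assms(1)] by simp

text \<open>A position inspects right translates of itself, while the group shifts labels from the
  left. The two commute, which makes the random set equivariant.\<close>

definition marked :: "'g set \<Rightarrow> real \<Rightarrow> ('g \<Rightarrow> real) \<Rightarrow> ('g \<Rightarrow> real) \<Rightarrow> 'g set" where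
  "marked K t m U = {x \<in> carrier \<Gamma>. \<exists>k\<in>K. U (x \<otimes> k) \<le> t * m k}"

lemma marked_shift:
  assumes "a \<in> carrier \<Gamma>" "x \<in> carrier \<Gamma>" "K \<subseteq> carrier \<Gamma>"
  shows "x \<in> marked K t m (shift a U) \<longleftrightarrow> inv a \<otimes> x \<in> marked K t m U"
  using assms by (auto simp: marked_def shift_def m_assoc subset_iff)

lemma marked_sets:
  assumes "finite K" "K \<subseteq> carrier \<Gamma>" "x \<in> carrier \<Gamma>"
  shows "{U \<in> space labels. x \<in> marked K t m U} \<in> sets labels"
proof -
  have "{U \<in> space labels. U (x \<otimes> k) \<le> t * m k} \<in> sets labels" if "k \<in> K" for k
  proof -
    have [measurable]: "(\<lambda>U. U (x \<otimes> k)) \<in> borel_measurable labels"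
      using assms that by (intro measurable_label) auto
    show ?thesis by measurable
  qed
  then have "(\<Union>k\<in>K. {U \<in> space labels. U (x \<otimes> k) \<le> t * m k}) \<in> sets labels"
    using assms(1) by (intro sets.finite_UN) auto
  also have "(\<Union>k\<in>K. {U \<in> space labels. U (x \<otimes> k) \<le> t * m k}) = {U \<in> space labels. x \<in> marked K t m U}"
    using assms by (auto simp: marked_def)
  finally show ?thesis .
qed

text \<open>The label at \<open>a\<close> has to exceed the thresholds
  \<open>t * m (inv b \<otimes> a)\<close> of all \<open>b\<close> in \<open>B\<close>, that is, the
  largest of them; by independence the probabilities multiply.\<close>

lemma prob_unmarked:
  assumes K: "finite K" "K \<subseteq> carrier \<Gamma>" "K \<noteq> {}" and m: "\<And>x. 0 \<le> m x" "\<And>x. x \<notin> K \<Longrightarrow> m x = 0" and t: "0 \<le> t"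
    and B: "finite B" "B \<subseteq> carrier \<Gamma>" "B \<noteq> {}"
  shows "measure labels {U \<in> space labels. B \<inter> marked K t m U = {}} =
    exp (- (t * (\<Sum>a\<in>(\<lambda>(b, k). b \<otimes> k) ` (B \<times> K). MAX b\<in>B. m (inv b \<otimes> a))))"
proof -
  interpret prob_space labels by (rule prob_space_labels)
  let ?J = "(\<lambda>(b, k). b \<otimes> k) ` (B \<times> K)" and ?M = "\<lambda>a. MAX b\<in>B. m (inv b \<otimes> a)"
  have J: "?J \<subseteq> carrier \<Gamma>" "finite ?J" using K B by auto
  have M_ge: "m (inv b \<otimes> a) \<le> ?M a" if "b \<in> B" for a b
    using B that by (intro Max_ge) auto
  have M0: "0 \<le> ?M a" for a
    using B(3) M_ge m(1) by (metis all_not_in_conv order_trans)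
  have eq: "{U \<in> space labels. B \<inter> marked K t m U = {}} = {U \<in> space labels. \<forall>a\<in>?J. U a \<in> {t * ?M a<..}}"
  proof (intro Collect_cong conj_cong refl)
    fix U
    show "B \<inter> marked K t m U = {} \<longleftrightarrow> (\<forall>a\<in>?J. U a \<in> {t * ?M a<..})"
    proof
      assume un: "B \<inter> marked K t m U = {}"
      have gt: "t * m k < U (b \<otimes> k)" if "b \<in> B" "k \<in> K" for b k
        using un that B by (force simp: marked_def not_le)
      show "\<forall>a\<in>?J. U a \<in> {t * ?M a<..}"
      proof
        fix a assume "a \<in> ?J"
        then obtain b0 k0 where a: "a = b0 \<otimes> k0" "b0 \<in> B" "k0 \<in> K" by auto
        have "?M a \<in> (\<lambda>b. m (inv b \<otimes> a)) ` B" using B by (intro Max_in) auto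
        then obtain b where b: "b \<in> B" "?M a = m (inv b \<otimes> a)" by auto
        show "U a \<in> {t * ?M a<..}"
        proof (cases "inv b \<otimes> a \<in> K")
          case True
          have "b \<otimes> (inv b \<otimes> a) = a"
            using b(1) a B K by (auto simp: m_assoc[symmetric] subset_iff)
          then show ?thesis using gt[OF b(1) True] b(2) by simp
        next
          case False
          \<comment> \<open>Here the maximum is 0 and its maximizer imposes no condition; that the
            label is positive follows from the threshold at \<open>k0\<close>, for which
            \<open>a = b0 \<otimes> k0\<close>.\<close>
          have "t * ?M a = 0" using m(2)[OF False] b(2) by simp
          also have "\<dots> \<le> t * m k0" using t m by simp
          also have "\<dots> < U a" using gt a by simp
          finally show ?thesis by simp
        qed
      qed
    next
      assume gt: "\<forall>a\<in>?J. U a \<in> {t * ?M a<..}"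
      have "b \<notin> marked K t m U" if b: "b \<in> B" for b
      proof
        assume "b \<in> marked K t m U"
        then obtain k where k: "k \<in> K" "U (b \<otimes> k) \<le> t * m k" by (auto simp: marked_def)
        have "inv b \<otimes> (b \<otimes> k) = k" using b k B K by (auto simp: m_assoc[symmetric] subset_iff)
        then have "t * m k \<le> t * ?M (b \<otimes> k)"
          using M_ge[OF b, of "b \<otimes> k"] t by (intro mult_left_mono) auto
        also have "\<dots> < U (b \<otimes> k)" using gt b k by auto
        finally show False using k by simp
      qed
      then show "B \<inter> marked K t m U = {}" by blast
    qed
  qed
  have "emeasure labels {U \<in> space labels. \<forall>a\<in>?J. U a \<in> {t * ?M a<..}} = (\<Prod>a\<in>?J. emeasure expo {t * ?M a<..})"
    unfolding labels_def by (rule labels.emeasure_PiM_Collect) (use J in auto)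
  also have "\<dots> = (\<Prod>a\<in>?J. ennreal (exp (- (t * ?M a))))"
    using t M0 by (intro prod.cong refl emeasure_expo_greaterThan) simp
  also have "\<dots> = ennreal (exp (- (t * (\<Sum>a\<in>?J. ?M a))))"
    using J by (simp add: prod_ennreal exp_sum[symmetric] sum_negf sum_distrib_left)
  finally have "emeasure labels {U \<in> space labels. \<forall>a\<in>?J. U a \<in> {t * ?M a<..}} = ennreal (exp (- (t * (\<Sum>a\<in>?J. ?M a))))" .
  then show ?thesis unfolding eq by (simp add: emeasure_eq_measure)
qed

text \<open>All nonempty parts of \<open>B\<close> are unmarked with probability close to
  \<open>1 - q\<close>. Comparing singletons with pairs, two points of \<open>B\<close> rarely
  differ in their marks, and a union bound over pairs leaves two cases: all marked or none.\<close>

lemma marked_all_or_nothing: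
  assumes q: "0 < q" "q < 1" and B: "finite B" "B \<subseteq> carrier \<Gamma>" "B \<noteq> {}" and \<eta>: "\<eta> > 0"
  obtains K t and m :: "'g \<Rightarrow> real" where "finite K" "K \<subseteq> carrier \<Gamma>"
    "1 - q - \<eta> \<le> measure labels {U \<in> space labels. B \<inter> marked K t m U = {}}"
    "\<bar>measure labels {U \<in> space labels. B \<subseteq> marked K t m U} - q\<bar> \<le> \<eta>"
proof -
  interpret prob_space labels by (rule prob_space_labels)
  \<comment> \<open>A weight of total mass 1 leaves a point unmarked with probability
    \<open>exp (- t)\<close>, which is to be \<open>1 - q\<close>.\<close>
  define t where "t = - ln (1 - q)"
  have t: "t > 0" "exp (- t) = 1 - q" using q by (simp_all add: t_def)
  \<comment> \<open>The error budget: \<open>e\<close> for \<open>B\<close> itself and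
    \<open>2 * e\<close> for each ordered pair of its points.\<close>
  define e where "e = \<eta> / (2 * (real (card B))\<^sup>2 + 1)"
  have e: "e > 0" "e \<le> \<eta>" "e + 2 * (real (card B))\<^sup>2 * e = \<eta>"
  proof -
    have pos: "2 * (real (card B))\<^sup>2 + 1 > 0" by (simp add: add_nonneg_pos)
    show "e > 0" unfolding e_def using \<eta> pos by simp
    show *: "e + 2 * (real (card B))\<^sup>2 * e = \<eta>"
    proof -
      have "e * (2 * (real (card B))\<^sup>2 + 1) = \<eta>" using pos by (simp add: e_def)
      then show ?thesis by (simp add: algebra_simps)
    qed
    have "0 \<le> 2 * (real (card B))\<^sup>2 * e" using \<open>e > 0\<close> by simp
    then show "e \<le> \<eta>" using * by linarith
  qed
  \<comment> \<open>\<open>t * \<delta> \<le> e\<close> lets the error of the weights pass through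
    the exponential, and \<open>\<delta> < 1\<close> makes their mass positive, so that
    \<open>K\<close> is nonempty.\<close>
  define \<delta> where "\<delta> = min (1/2) (e / t)"
  have \<delta>: "\<delta> > 0" "\<delta> < 1" "t * \<delta> \<le> e"
  proof -
    show "\<delta> > 0" "\<delta> < 1" using e t by (auto simp: \<delta>_def)
    have "t * \<delta> \<le> t * (e / t)" unfolding \<delta>_def using t by (intro mult_left_mono) auto
    then show "t * \<delta> \<le> e" using t by simp
  qed
  obtain K and m :: "'g \<Rightarrow> real" where K: "finite K" "K \<subseteq> carrier \<Gamma>"
    and m: "\<And>x. 0 \<le> m x" "\<And>x. x \<notin> K \<Longrightarrow> m x = 0" and mK: "1 - \<delta> \<le> (\<Sum>x\<in>K. m x)"
    and mJ: "\<And>J B'. finite J \<Longrightarrow> J \<subseteq> carrier \<Gamma> \<Longrightarrow> B' \<subseteq> B \<Longrightarrow> B' \<noteq> {} \<Longrightarrow>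
      (\<Sum>a\<in>J. MAX b\<in>B'. m (inv b \<otimes> a)) \<le> 1 + \<delta>"
    using almost_invariant_weights[OF B(1,2) \<delta>(1)] by blast
  have Kne: "K \<noteq> {}" using mK \<delta> by auto
  let ?p = "\<lambda>B'. measure labels {U \<in> space labels. B' \<inter> marked K t m U = {}}"
  have unm_sets: "{U \<in> space labels. B' \<inter> marked K t m U = {}} \<in> sets labels" if "B' \<subseteq> B" for B'
  proof -
    have "{U \<in> space labels. B' \<inter> marked K t m U = {}} = space labels - (\<Union>b\<in>B'. {U \<in> space labels. b \<in> marked K t m U})"
      by auto
    moreover have "(\<Union>b\<in>B'. {U \<in> space labels. b \<in> marked K t m U}) \<in> sets labels"
      using that B K finite_subset[OF that] by (intro sets.finite_UN marked_sets) auto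
    ultimately show ?thesis by simp
  qed
  have p: "\<bar>?p B' - (1 - q)\<bar> \<le> e" if B': "B' \<subseteq> B" "B' \<noteq> {}" for B'
  proof -
    have fB': "finite B'" "B' \<subseteq> carrier \<Gamma>" using B' B finite_subset by auto
    let ?J = "(\<lambda>(b, k). b \<otimes> k) ` (B' \<times> K)" and ?M = "\<lambda>a. MAX b\<in>B'. m (inv b \<otimes> a)"
    have J: "?J \<subseteq> carrier \<Gamma>" "finite ?J" using K fB' by auto
    obtain b where b: "b \<in> B'" using B' by blast
    have bc: "b \<in> carrier \<Gamma>" using b fB' by blast
    have M_ge: "m (inv b \<otimes> a) \<le> ?M a" for a
      using fB' b by (intro Max_ge) auto
    have inj: "inj_on (\<lambda>k. b \<otimes> k) K" using K bc by (auto simp: inj_on_def subset_iff)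
    have "(\<Sum>x\<in>K. m x) = (\<Sum>a\<in>(\<lambda>k. b \<otimes> k) ` K. m (inv b \<otimes> a))"
      unfolding sum.reindex[OF inj] using K bc by (intro sum.cong) (auto simp: m_assoc[symmetric] subset_iff)
    also have "\<dots> \<le> (\<Sum>a\<in>(\<lambda>k. b \<otimes> k) ` K. ?M a)" by (intro sum_mono M_ge)
    also have "\<dots> \<le> (\<Sum>a\<in>?J. ?M a)"
      using b J by (intro sum_mono2) (auto intro: order_trans[OF m(1) M_ge])
    finally have "1 - \<delta> \<le> (\<Sum>a\<in>?J. ?M a)" using mK by simp
    moreover have "(\<Sum>a\<in>?J. ?M a) \<le> 1 + \<delta>" using J B' by (intro mJ)
    ultimately have sJ: "\<bar>(\<Sum>a\<in>?J. ?M a) - 1\<bar> \<le> \<delta>" "0 \<le> (\<Sum>a\<in>?J. ?M a)" using \<delta> by auto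
    have "?p B' = exp (- (t * (\<Sum>a\<in>?J. ?M a)))"
      by (rule prob_unmarked) (use K Kne m t fB' B' in auto)
    then have "\<bar>?p B' - (1 - q)\<bar> \<le> \<bar>t * (\<Sum>a\<in>?J. ?M a) - t\<bar>"
      using abs_exp_diff_le[of "t * (\<Sum>a\<in>?J. ?M a)" t] t sJ by simp
    also have "\<dots> = t * \<bar>(\<Sum>a\<in>?J. ?M a) - 1\<bar>"
    proof -
      have "t * x - t = t * (x - 1)" for x by (simp add: right_diff_distrib)
      then show ?thesis using t(1) by (simp only: abs_mult abs_of_pos)
    qed
    also have "\<dots> \<le> t * \<delta>" using t sJ by (intro mult_left_mono) auto
    finally show ?thesis using \<delta> by simp
  qed
  let ?All = "{U \<in> space labels. B \<subseteq> marked K t m U}"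
  \<comment> \<open>The event that \<open>b\<close> is marked and \<open>b'\<close> is not: a
    difference of nested events, both of probability within \<open>e\<close> of
    \<open>1 - q\<close>.\<close>
  let ?mix = "\<lambda>(b, b'). {U \<in> space labels. {b'} \<inter> marked K t m U = {}} - {U \<in> space labels. {b, b'} \<inter> marked K t m U = {}}"
  have All: "?All \<in> sets labels"
  proof -
    have "?All = space labels \<inter> (\<Inter>b\<in>B. {U \<in> space labels. b \<in> marked K t m U})" using B by auto
    then show ?thesis using B K by (auto intro!: sets.Int sets.finite_INT marked_sets)
  qed
  have mix: "measure labels (?mix bb) \<le> 2 * e" "?mix bb \<in> sets labels" if "bb \<in> B \<times> B" for bb
  proof -
    obtain b b' where bb: "bb = (b, b')" "b \<in> B" "b' \<in> B" using \<open>bb \<in> B \<times> B\<close> by blast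
    have "measure labels (?mix bb) = ?p {b'} - ?p {b, b'}"
      unfolding bb using bb by (simp, subst finite_measure_Diff) (use bb in \<open>auto intro!: unm_sets[of "{b'}", simplified] unm_sets[of "{b, b'}", simplified]\<close>)
    then show "measure labels (?mix bb) \<le> 2 * e" using p[of "{b'}"] p[of "{b, b'}"] bb by auto
    show "?mix bb \<in> sets labels" using bb unm_sets[of "{b'}"] unm_sets[of "{b, b'}"] by auto
  qed
  have sub: "space labels - ?All \<subseteq> {U \<in> space labels. B \<inter> marked K t m U = {}} \<union> (\<Union>bb\<in>B \<times> B. ?mix bb)"
  proof
    fix U assume U: "U \<in> space labels - ?All"
    then obtain b' where b': "b' \<in> B" "b' \<notin> marked K t m U" by auto
    show "U \<in> {U \<in> space labels. B \<inter> marked K t m U = {}} \<union> (\<Union>bb\<in>B \<times> B. ?mix bb)"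
    proof (cases "B \<inter> marked K t m U = {}")
      case False
      then obtain b where "b \<in> B" "b \<in> marked K t m U" by blast
      then have "U \<in> ?mix (b, b')" "(b, b') \<in> B \<times> B" using U b' by auto
      then show ?thesis by (intro UnI2 UN_I)
    qed (use U in simp)
  qed
  have mixU: "(\<Union>bb\<in>B \<times> B. ?mix bb) \<in> sets labels"
    using B(1) by (intro sets.finite_UN mix(2)) simp_all
  have "measure labels (space labels - ?All) \<le> measure labels ({U \<in> space labels. B \<inter> marked K t m U = {}} \<union> (\<Union>bb\<in>B \<times> B. ?mix bb))"
    by (rule finite_measure_mono[OF sub sets.Un[OF unm_sets[OF order_refl] mixU]])
  also have "\<dots> \<le> ?p B + measure labels (\<Union>bb\<in>B \<times> B. ?mix bb)"
    by (rule measure_Un_le[OF unm_sets[OF order_refl] mixU])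
  also have "measure labels (\<Union>bb\<in>B \<times> B. ?mix bb) \<le> (\<Sum>bb\<in>B \<times> B. measure labels (?mix bb))"
    using B(1) by (intro measure_UNION_le mix(2)) simp_all
  also have "\<dots> \<le> (\<Sum>bb\<in>B \<times> B. 2 * e)" by (intro sum_mono mix)
  also have "\<dots> = 2 * (real (card B))\<^sup>2 * e"
    by (simp add: card_cartesian_product power2_eq_square)
  finally have up: "1 - measure labels ?All \<le> ?p B + 2 * (real (card B))\<^sup>2 * e"
    using prob_compl[OF All] by simp
  have "?p B \<le> measure labels (space labels - ?All)"
    using B All by (intro finite_measure_mono) auto
  then have low: "?p B \<le> 1 - measure labels ?All" using prob_compl[OF All] by simp
  show ?thesis
  proof (rule that[OF K, of t m])
    show "1 - q - \<eta> \<le> ?p B" using p[of B] B e by auto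
    show "\<bar>measure labels ?All - q\<bar> \<le> \<eta>" using p[of B] B e up low by (auto simp: abs_le_iff)
  qed
qed

text \<open>Independence of the labels over disjoint finite sets, by Fubini on the finite product
  over their union.\<close>

lemma integral_disjoint_cylinders:
  fixes h h' :: "('g \<Rightarrow> real) \<Rightarrow> real"
  assumes B: "finite B" "B \<subseteq> carrier \<Gamma>" and B': "finite B'" "B' \<subseteq> carrier \<Gamma>" and disj: "B \<inter> B' = {}"
    and h: "h \<in> borel_measurable (Pi\<^sub>M B (\<lambda>_. expo))" "\<And>x. \<bar>h x\<bar> \<le> 1"
    and h': "h' \<in> borel_measurable (Pi\<^sub>M B' (\<lambda>_. expo))" "\<And>x. \<bar>h' x\<bar> \<le> 1"
  shows "(\<integral>U. h (restrict U B) * h' (restrict U B') \<partial>labels) =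
    (\<integral>U. h (restrict U B) \<partial>labels) * (\<integral>U. h' (restrict U B') \<partial>labels)"
proof -
  let ?P = "\<lambda>B :: 'g set. Pi\<^sub>M B (\<lambda>_. expo)"
  interpret P: prob_space "?P C" for C by (rule prob_space_PiM) (rule prob_space_expo)
  have restr: "(\<integral>U. f (restrict U C) \<partial>labels) = (\<integral>x. f x \<partial>?P C)"
    if "finite C" "C \<subseteq> carrier \<Gamma>" "f \<in> borel_measurable (?P C)" for C and f :: "_ \<Rightarrow> real"
  proof -
    have "(\<integral>x. f x \<partial>?P C) = (\<integral>x. f x \<partial>distr labels (?P C) (\<lambda>x. restrict x C))"
      unfolding labels_def labels.distr_PiM_restrict_finite[OF that(1,2)] ..
    also have "\<dots> = (\<integral>U. f (restrict U C) \<partial>labels)"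
      unfolding labels_def by (intro integral_distr measurable_restrict_subset that)
    finally show ?thesis by simp
  qed
  define f where "f x = h (restrict x B) * h' (restrict x B')" for x :: "'g \<Rightarrow> real"
  have fm: "f \<in> borel_measurable (?P (B \<union> B'))"
    unfolding f_def
    by (intro borel_measurable_times measurable_compose[OF measurable_restrict_subset h(1)]
        measurable_compose[OF measurable_restrict_subset h'(1)]) auto
  have f_bound: "\<bar>f x\<bar> \<le> 1" for x
    unfolding f_def using h(2) h'(2) by (intro abs_mult_le_one)
  have "(\<integral>U. h (restrict U B) * h' (restrict U B') \<partial>labels) = (\<integral>U. f (restrict U (B \<union> B')) \<partial>labels)"
    by (simp add: f_def Int_absorb1 Int_absorb2 restrict_restrict)
  also have "\<dots> = (\<integral>x. f x \<partial>?P (B \<union> B'))"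
    using B B' fm by (intro restr) auto
  also have "\<dots> = (\<integral>x. (\<integral>y. f (merge B B' (x, y)) \<partial>?P B') \<partial>?P B)"
    using B B' disj fm f_bound
    by (intro labels.product_integral_fold P.integrable_const_bound[where B=1]) auto
  also have "\<dots> = (\<integral>x. (\<integral>y. h x * h' y \<partial>?P B') \<partial>?P B)"
  proof (intro Bochner_Integration.integral_cong refl)
    fix x y assume "x \<in> space (?P B)" "y \<in> space (?P B')"
    then have "restrict (merge B B' (x, y)) B = x" "restrict (merge B B' (x, y)) B' = y"
      using disj by (auto simp: restrict_merge space_PiM PiE_iff extensional_restrict Int_commute)
    then show "f (merge B B' (x, y)) = h x * h' y" by (simp add: f_def)
  qed
  also have "\<dots> = (\<integral>x. h x \<partial>?P B) * (\<integral>y. h' y \<partial>?P B')" by simp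
  finally show ?thesis using restr[OF B h(1)] restr[OF B' h'(1)] by simp
qed

text \<open>\<open>F\<close> is nearly a function of the labels in a finite set, and in an infinite
  group some translate of this set is disjoint from it. So \<open>F\<close>, being equal to its
  translate, is nearly independent of itself and has variance 0.\<close>

lemma shift_invariant_constant:
  fixes F :: "('g \<Rightarrow> real) \<Rightarrow> real"
  assumes inf: "infinite (carrier \<Gamma>)" and F: "F \<in> borel_measurable labels" "\<And>U. \<bar>F U\<bar> \<le> 1"
    and inv: "\<And>a. a \<in> carrier \<Gamma> \<Longrightarrow> AE U in labels. F (shift a U) = F U"
  shows "AE U in labels. F U = (\<integral>U. F U \<partial>labels)"
proof -
  interpret prob_space labels by (rule prob_space_labels)
  let ?c = "\<integral>U. F U \<partial>labels"
  have Fint: "integrable labels F" using F by (intro integrable_const_bound[where B=1]) auto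
  have F2int: "integrable labels (\<lambda>U. F U * F U)"
    using F(1) by (intro integrable_const_bound[where B=1] AE_I2) (simp_all only: real_norm_def abs_mult_le_one F(2) borel_measurable_times)
  \<comment> \<open>Approximation of \<open>F\<close> costs \<open>2 * \<epsilon>\<close> in the
    correlation with its translate and \<open>2 * \<epsilon>\<close> in the square of the
    mean.\<close>
  have main: "\<bar>(\<integral>U. F U * F U \<partial>labels) - ?c * ?c\<bar> \<le> 4 * \<epsilon>" if \<epsilon>: "\<epsilon> > 0" for \<epsilon>
  proof -
    have "cylinder_approximable (carrier \<Gamma>) expo labels F"
      by (rule cylinder_approximableI[OF _ _ Fint]) (simp_all add: finite_measure_axioms labels_def)
    then obtain B h0 where B: "finite B" "B \<subseteq> carrier \<Gamma>" and h0: "h0 \<in> borel_measurable (Pi\<^sub>M B (\<lambda>_. expo))"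
      and "integrable labels (\<lambda>x. h0 (restrict x B))" and h0e: "(\<integral>x. \<bar>F x - h0 (restrict x B)\<bar> \<partial>labels) < \<epsilon>"
      using \<epsilon> unfolding cylinder_approximable_def by blast
    \<comment> \<open>Truncation to the interval from -1 to 1, which contains the values of
      \<open>F\<close>, does not increase the distance to \<open>F\<close>.\<close>
    define h where "h x = max (- 1) (min 1 (h0 x))" for x
    have h: "h \<in> borel_measurable (Pi\<^sub>M B (\<lambda>_. expo))" "\<bar>h x\<bar> \<le> 1" for x
    proof -
      show "h \<in> borel_measurable (Pi\<^sub>M B (\<lambda>_. expo))"
        using h0 unfolding h_def[abs_def] by measurable
    qed (auto simp: h_def abs_le_iff)
    let ?H = "\<lambda>U. h (restrict U B)"
    have rm: "(\<lambda>U. restrict U C) \<in> labels \<rightarrow>\<^sub>M Pi\<^sub>M C (\<lambda>_. expo)" if "C \<subseteq> carrier \<Gamma>" for C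
      unfolding labels_def by (rule measurable_restrict_subset[OF that])
    have Hm[measurable]: "?H \<in> borel_measurable labels"
      by (rule measurable_compose[OF rm[OF B(2)] h(1)])
    have Hint: "integrable labels ?H" using h(2) by (intro integrable_const_bound[where B=1]) auto
    have He: "(\<integral>U. \<bar>F U - ?H U\<bar> \<partial>labels) \<le> \<epsilon>"
    proof -
      have "(\<integral>U. \<bar>F U - ?H U\<bar> \<partial>labels) \<le> (\<integral>x. \<bar>F x - h0 (restrict x B)\<bar> \<partial>labels)"
      proof (rule integral_mono)
        fix U show "\<bar>F U - ?H U\<bar> \<le> \<bar>F U - h0 (restrict U B)\<bar>"
          using F(2)[of U] by (auto simp: h_def max_def min_def abs_le_iff)
      qed (use Fint Hint \<open>integrable labels (\<lambda>x. h0 (restrict x B))\<close> in auto)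
      then show ?thesis using h0e by simp
    qed
    have "finite ((\<lambda>(x, y). x \<otimes> inv y) ` (B \<times> B))" using B by simp
    \<comment> \<open>Avoiding the finitely many quotients \<open>x \<otimes> inv y\<close> of
      elements of \<open>B\<close> keeps \<open>B\<close> and its translate disjoint.\<close>
    then obtain a where a: "a \<in> carrier \<Gamma>" "a \<notin> (\<lambda>(x, y). x \<otimes> inv y) ` (B \<times> B)"
      using inf by (meson finite_subset subsetI)
    let ?B' = "(\<lambda>x. inv a \<otimes> x) ` B"
    have B': "finite ?B'" "?B' \<subseteq> carrier \<Gamma>" using B a by auto
    have disj: "B \<inter> ?B' = {}"
    proof (rule ccontr)
      assume "B \<inter> ?B' \<noteq> {}"
      then obtain x y where xy: "x \<in> B" "y \<in> B" "y = inv a \<otimes> x" by auto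
      then have c: "x \<in> carrier \<Gamma>" "y \<in> carrier \<Gamma>" using B by auto
      have "a \<otimes> y = x" using xy(3) a c by (simp add: m_assoc[symmetric])
      then have eq: "a = x \<otimes> inv y" using a c by (metis inv_solve_right)
      have "x \<otimes> inv y \<in> (\<lambda>(x, y). x \<otimes> inv y) ` (B \<times> B)"
        using xy(1,2) by (intro image_eqI[of _ _ "(x, y)"]) auto
      then show False using a(2) unfolding eq[symmetric] by blast
    qed
    define h' where "h' V = h (\<lambda>x\<in>B. V (inv a \<otimes> x))" for V
    have h': "h' \<in> borel_measurable (Pi\<^sub>M ?B' (\<lambda>_. expo))"
      unfolding h'_def by (intro measurable_compose[OF _ h(1)] measurable_restrict measurable_component_singleton) auto
    have h'_eq: "h' (restrict U ?B') = ?H (shift a U)" for U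
      unfolding h'_def using B by (intro arg_cong[where f=h]) (auto simp: shift_def fun_eq_iff restrict_def subset_iff)
    let ?Fa = "\<lambda>U. F (shift a U)" and ?Ha = "\<lambda>U. ?H (shift a U)"
    have Fam[measurable]: "?Fa \<in> borel_measurable labels" by (rule measurable_compose[OF shift_measurable[OF a(1)] F(1)])
    have Ham[measurable]: "?Ha \<in> borel_measurable labels" by (rule measurable_compose[OF shift_measurable[OF a(1)] Hm])
    have HHa: "(\<integral>U. ?H U * ?Ha U \<partial>labels) = (\<integral>U. ?H U \<partial>labels) * (\<integral>U. ?H U \<partial>labels)"
      using integral_disjoint_cylinders[OF B B' disj h h'] integral_shift[OF a(1) Hm] h(2)
      by (simp add: h'_eq) (simp add: h'_def)
    have FFa: "(\<integral>U. F U * F U \<partial>labels) = (\<integral>U. F U * ?Fa U \<partial>labels)"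
      using inv[OF a(1)] F(1) by (intro integral_cong_AE) (auto elim: eventually_mono)
    have b1: "integrable labels (\<lambda>U. F U * ?Fa U)" "integrable labels (\<lambda>U. ?H U * ?Ha U)"
    proof -
      show "integrable labels (\<lambda>U. F U * ?Fa U)"
        using F(1) Fam by (intro integrable_const_bound[where B=1] AE_I2) (simp_all only: real_norm_def abs_mult_le_one F(2) borel_measurable_times)
      show "integrable labels (\<lambda>U. ?H U * ?Ha U)"
        using Hm Ham by (intro integrable_const_bound[where B=1] AE_I2) (simp_all only: real_norm_def abs_mult_le_one h(2) borel_measurable_times)
    qed
    have b2: "integrable labels ?Fa" "integrable labels ?Ha"
      using F h(2) by (intro integrable_const_bound[where B=1]; auto)+
    have "\<bar>(\<integral>U. F U * ?Fa U \<partial>labels) - (\<integral>U. ?H U * ?Ha U \<partial>labels)\<bar> = \<bar>\<integral>U. F U * ?Fa U - ?H U * ?Ha U \<partial>labels\<bar>"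
      using b1 by simp
    also have "\<dots> \<le> (\<integral>U. \<bar>F U * ?Fa U - ?H U * ?Ha U\<bar> \<partial>labels)"
      by (rule integral_abs_bound)
    also have "\<dots> \<le> (\<integral>U. \<bar>F U - ?H U\<bar> + \<bar>?Fa U - ?Ha U\<bar> \<partial>labels)"
    proof (rule integral_mono)
      fix U
      have *: "\<bar>u * v - x * y\<bar> \<le> \<bar>u - x\<bar> + \<bar>v - y\<bar>" if "\<bar>v\<bar> \<le> 1" "\<bar>x\<bar> \<le> 1" for u v x y :: real
      proof -
        have eq: "u * v - x * y = (u - x) * v + x * (v - y)" by (simp add: algebra_simps)
        have "\<bar>(u - x) * v + x * (v - y)\<bar> \<le> \<bar>u - x\<bar> * \<bar>v\<bar> + \<bar>x\<bar> * \<bar>v - y\<bar>"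
          using abs_triangle_ineq[of "(u - x) * v" "x * (v - y)"] by (simp only: abs_mult)
        moreover have "\<bar>u - x\<bar> * \<bar>v\<bar> \<le> \<bar>u - x\<bar> * 1" by (rule mult_left_mono[OF that(1)]) simp
        moreover have "\<bar>x\<bar> * \<bar>v - y\<bar> \<le> 1 * \<bar>v - y\<bar>" by (rule mult_right_mono[OF that(2)]) simp
        ultimately show ?thesis unfolding eq by linarith
      qed
      show "\<bar>F U * ?Fa U - ?H U * ?Ha U\<bar> \<le> \<bar>F U - ?H U\<bar> + \<bar>?Fa U - ?Ha U\<bar>"
        by (rule *[OF F(2) h(2)])
    qed (use b1 b2 Fint Hint in auto)
    also have "\<dots> = (\<integral>U. \<bar>F U - ?H U\<bar> \<partial>labels) + (\<integral>U. \<bar>?Fa U - ?Ha U\<bar> \<partial>labels)"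
      using b2 Fint Hint by (intro Bochner_Integration.integral_add) auto
    also have "(\<integral>U. \<bar>?Fa U - ?Ha U\<bar> \<partial>labels) = (\<integral>U. \<bar>F U - ?H U\<bar> \<partial>labels)"
      using integral_shift[OF a(1), of "\<lambda>U. \<bar>F U - ?H U\<bar>"] F(1) by simp
    finally have 1: "\<bar>(\<integral>U. F U * F U \<partial>labels) - (\<integral>U. ?H U \<partial>labels) * (\<integral>U. ?H U \<partial>labels)\<bar> \<le> 2 * \<epsilon>"
      using He unfolding FFa HHa by linarith
    have 2: "\<bar>(\<integral>U. ?H U \<partial>labels) - ?c\<bar> \<le> \<epsilon>"
    proof -
      have "\<bar>(\<integral>U. ?H U \<partial>labels) - ?c\<bar> = \<bar>\<integral>U. F U - ?H U \<partial>labels\<bar>"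
        using Fint Hint by simp
      also have "\<dots> \<le> (\<integral>U. \<bar>F U - ?H U\<bar> \<partial>labels)" by (rule integral_abs_bound)
      finally show ?thesis using He by simp
    qed
    have bound1: "\<bar>?c\<bar> \<le> 1" "\<bar>\<integral>U. ?H U \<partial>labels\<bar> \<le> 1"
    proof -
      have "\<bar>\<integral>U. f U \<partial>labels\<bar> \<le> 1" if "integrable labels f" "\<And>U. \<bar>f U\<bar> \<le> 1" for f :: "_ \<Rightarrow> real"
      proof -
        have "\<bar>\<integral>U. f U \<partial>labels\<bar> \<le> (\<integral>U. \<bar>f U\<bar> \<partial>labels)" by (rule integral_abs_bound)
        also have "\<dots> \<le> (\<integral>U. 1 \<partial>labels)" using that by (intro integral_mono) auto
        finally show ?thesis by (simp add: prob_space)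
      qed
      then show "\<bar>?c\<bar> \<le> 1" "\<bar>\<integral>U. ?H U \<partial>labels\<bar> \<le> 1" using Fint Hint F h by auto
    qed
    have "\<bar>(\<integral>U. ?H U \<partial>labels) * (\<integral>U. ?H U \<partial>labels) - ?c * ?c\<bar> = \<bar>(\<integral>U. ?H U \<partial>labels) - ?c\<bar> * \<bar>(\<integral>U. ?H U \<partial>labels) + ?c\<bar>"
      by (simp add: abs_mult[symmetric] algebra_simps)
    also have "\<dots> \<le> \<epsilon> * 2"
      using 2 bound1 \<epsilon> by (intro mult_mono) auto
    finally show ?thesis using 1 by linarith
  qed
  have eq: "(\<integral>U. F U * F U \<partial>labels) = ?c * ?c"
  proof (rule ccontr)
    assume "(\<integral>U. F U * F U \<partial>labels) \<noteq> ?c * ?c"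
    then have "\<bar>(\<integral>U. F U * F U \<partial>labels) - ?c * ?c\<bar> / 8 > 0" by simp
    from main[OF this] this show False by simp
  qed
  have int: "integrable labels (\<lambda>U. (F U - ?c) * (F U - ?c))"
    using Fint F2int by (simp add: algebra_simps)
  have "(\<integral>U. (F U - ?c) * (F U - ?c) \<partial>labels) = (\<integral>U. F U * F U - 2 * ?c * F U + ?c * ?c \<partial>labels)"
    by (intro Bochner_Integration.integral_cong) (auto simp: algebra_simps)
  also have "\<dots> = 0"
    using Fint F2int eq by (simp add: prob_space)
  finally have "AE U in labels. (F U - ?c) * (F U - ?c) = 0"
    using integral_nonneg_eq_0_iff_AE[OF int] by simp
  then show ?thesis by eventually_elim simp
qed

end

section \<open>Masked configurations\<close>

locale masked_lamplighter = Liouville_lamplighter L \<Gamma> \<mu>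
  for L :: "('l, 'a) monoid_scheme" and \<Gamma> :: "('g, 'b) monoid_scheme"
    and \<mu> :: "(('g \<Rightarrow> 'l) \<times> 'g) pmf" +
  fixes K :: "'g set" and t :: real and m :: "'g \<Rightarrow> real"
  assumes K: "finite K" "K \<subseteq> carrier \<Gamma>"
begin

abbreviation "labels \<equiv> base.labels"
abbreviation "marks \<equiv> base.marked K t m"
abbreviation "values \<equiv> insert None (Some ` carrier L)"
abbreviation "mconf \<equiv> carrier \<Gamma> \<rightarrow>\<^sub>E values"
abbreviation "MX \<equiv> Pi\<^sub>M (carrier \<Gamma>) (\<lambda>_. count_space values)"

text \<open>Positions outside the random set of marked ones are erased, that is, set to \<open>None\<close>.\<close>

definition mask :: "('g \<Rightarrow> real) \<Rightarrow> ('g \<Rightarrow> 'l) \<Rightarrow> 'g \<Rightarrow> 'l option" where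
  "mask U \<phi> = (\<lambda>x\<in>carrier \<Gamma>. if x \<in> marks U then Some (\<phi> x) else None)"

text \<open>\<open>None\<close> is fixed, so the base part of the group element moves the visible
  set and the lamp part changes only the visible values.\<close>

definition mact :: "('g \<Rightarrow> 'l) \<times> 'g \<Rightarrow> ('g \<Rightarrow> 'l option) \<Rightarrow> 'g \<Rightarrow> 'l option" where
  "mact g = (\<lambda>\<psi>\<in>mconf. \<lambda>x\<in>carrier \<Gamma>.
     map_option (\<lambda>l. fst g x \<otimes>\<^bsub>L\<^esub> l) (\<psi> (inv\<^bsub>\<Gamma>\<^esub> (snd g) \<otimes>\<^bsub>\<Gamma>\<^esub> x)))"

definition \<kappa> :: "('g \<Rightarrow> 'l option) measure" where
  "\<kappa> = distr (labels \<Otimes>\<^sub>M \<nu>) MX (\<lambda>(U, \<phi>). mask U \<phi>)"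

lemma countable_values: "countable values"
  using countable_L by simp

lemma space_MX: "space MX = mconf" by (simp add: space_PiM)

lemma mask_mconf: "\<phi> \<in> conf \<Longrightarrow> mask U \<phi> \<in> mconf"
  by (auto simp: mask_def PiE_iff)

lemma mask_measurable: "(\<lambda>(U, \<phi>). mask U \<phi>) \<in> labels \<Otimes>\<^sub>M \<nu> \<rightarrow>\<^sub>M MX"
proof -
  have "(\<lambda>p. \<lambda>x\<in>carrier \<Gamma>. if x \<in> marks (fst p) then Some (snd p x) else None) \<in> labels \<Otimes>\<^sub>M \<nu> \<rightarrow>\<^sub>M MX"
  proof (rule measurable_restrict)
    fix x assume x: "x \<in> carrier \<Gamma>"
    have c: "(\<lambda>\<phi>. \<phi> x) \<in> \<nu> \<rightarrow>\<^sub>M count_space (carrier L)"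
      using measurable_component_singleton[OF x, of "\<lambda>_. count_space (carrier L)"]
      by (simp add: measurable_cong_sets[OF sets_\<nu> refl])
    show "(\<lambda>p. if x \<in> marks (fst p) then Some (snd p x) else None) \<in> labels \<Otimes>\<^sub>M \<nu> \<rightarrow>\<^sub>M count_space values"
    proof (rule measurable_If)
      show "(\<lambda>p. Some (snd p x)) \<in> labels \<Otimes>\<^sub>M \<nu> \<rightarrow>\<^sub>M count_space values"
        by (rule measurable_compose[OF measurable_compose[OF measurable_snd c]]) auto
      have "{p \<in> space (labels \<Otimes>\<^sub>M \<nu>). x \<in> marks (fst p)} = fst -` {U \<in> space labels. x \<in> marks U} \<inter> space (labels \<Otimes>\<^sub>M \<nu>)"
        by (auto simp: space_pair_measure)
      then show "{p \<in> space (labels \<Otimes>\<^sub>M \<nu>). x \<in> marks (fst p)} \<in> sets (labels \<Otimes>\<^sub>M \<nu>)"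
        using measurable_sets[OF measurable_fst base.marked_sets[OF K x]] by simp
    qed simp
  qed
  then show ?thesis by (simp add: mask_def split_beta')
qed

lemma mask_measurable2: "U \<in> space labels \<Longrightarrow> mask U \<in> \<nu> \<rightarrow>\<^sub>M MX"
  using measurable_compose[OF measurable_Pair1' mask_measurable, of U] by simp

lemma mact_mconf: "g \<in> carrier G \<Longrightarrow> \<psi> \<in> mconf \<Longrightarrow> mact g \<psi> \<in> mconf"
proof -
  assume g: "g \<in> carrier G" and \<psi>: "\<psi> \<in> mconf"
  have "map_option (\<lambda>l. fst g x \<otimes>\<^bsub>L\<^esub> l) (\<psi> (inv\<^bsub>\<Gamma>\<^esub> (snd g) \<otimes>\<^bsub>\<Gamma>\<^esub> x)) \<in> values" if x: "x \<in> carrier \<Gamma>" for x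
  proof -
    have "inv\<^bsub>\<Gamma>\<^esub> (snd g) \<otimes>\<^bsub>\<Gamma>\<^esub> x \<in> carrier \<Gamma>" "fst g x \<in> carrier L"
      using g x lamp_closed by (auto simp: carrier_G)
    moreover from this have "\<psi> (inv\<^bsub>\<Gamma>\<^esub> (snd g) \<otimes>\<^bsub>\<Gamma>\<^esub> x) \<in> values" using \<psi> by (auto simp: PiE_iff)
    ultimately show ?thesis by auto
  qed
  then show "mact g \<psi> \<in> mconf" using \<psi> by (simp add: mact_def PiE_iff)
qed

lemma group_action_mconf: "group_action G mconf mact"
proof (rule group_actionI)
  show "group G" by (rule G.is_group)
next
  fix g \<psi> assume "g \<in> carrier G" "\<psi> \<in> mconf"
  then show "mact g \<psi> \<in> mconf" by (rule mact_mconf)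
next
  fix \<psi> assume \<psi>: "\<psi> \<in> mconf"
  show "mact \<one>\<^bsub>G\<^esub> \<psi> = \<psi>"
  proof
    fix x show "mact \<one>\<^bsub>G\<^esub> \<psi> x = \<psi> x"
    proof (cases "x \<in> carrier \<Gamma>")
      case True
      then have "\<psi> x \<in> values" using \<psi> by (auto simp: PiE_iff)
      then show ?thesis using \<psi> True by (auto simp: mact_def lamplighter_def)
    next
      case False
      then show ?thesis using \<psi> by (simp add: mact_def PiE_iff extensional_def)
    qed
  qed
next
  fix g h \<psi> assume gh: "g \<in> carrier G" "h \<in> carrier G" and \<psi>: "\<psi> \<in> mconf"
  obtain f1 a1 f2 a2 where gh': "g = (f1, a1)" "h = (f2, a2)" by fastforce
  have c: "f1 \<in> lamp_configs L \<Gamma>" "f2 \<in> lamp_configs L \<Gamma>" "a1 \<in> carrier \<Gamma>" "a2 \<in> carrier \<Gamma>"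
    using gh by (auto simp: gh' carrier_G)
  have m: "mact h \<psi> \<in> mconf" by (rule mact_mconf[OF gh(2) \<psi>])
  show "mact (g \<otimes>\<^bsub>G\<^esub> h) \<psi> = mact g (mact h \<psi>)"
  proof
    fix x show "mact (g \<otimes>\<^bsub>G\<^esub> h) \<psi> x = mact g (mact h \<psi>) x"
    proof (cases "x \<in> carrier \<Gamma>")
      case True
      let ?y = "inv\<^bsub>\<Gamma>\<^esub> a1 \<otimes>\<^bsub>\<Gamma>\<^esub> x"
      have y: "?y \<in> carrier \<Gamma>" "inv\<^bsub>\<Gamma>\<^esub> a2 \<otimes>\<^bsub>\<Gamma>\<^esub> ?y \<in> carrier \<Gamma>" using True c by auto
      have eq: "inv\<^bsub>\<Gamma>\<^esub> (a1 \<otimes>\<^bsub>\<Gamma>\<^esub> a2) \<otimes>\<^bsub>\<Gamma>\<^esub> x = inv\<^bsub>\<Gamma>\<^esub> a2 \<otimes>\<^bsub>\<Gamma>\<^esub> ?y"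
        using True c by (simp add: \<Gamma>.inv_mult_group \<Gamma>.m_assoc)
      have v: "\<psi> (inv\<^bsub>\<Gamma>\<^esub> a2 \<otimes>\<^bsub>\<Gamma>\<^esub> ?y) \<in> values" using \<psi> y by (auto simp: PiE_iff)
      have f: "f1 x \<in> carrier L" "f2 ?y \<in> carrier L" using lamp_closed c True y by auto
      have "mact (g \<otimes>\<^bsub>G\<^esub> h) \<psi> x = map_option (\<lambda>l. (f1 x \<otimes>\<^bsub>L\<^esub> f2 ?y) \<otimes>\<^bsub>L\<^esub> l) (\<psi> (inv\<^bsub>\<Gamma>\<^esub> a2 \<otimes>\<^bsub>\<Gamma>\<^esub> ?y))"
        using True \<psi> by (simp add: mact_def gh' mult_G translate_def eq)
      also have "\<dots> = map_option (\<lambda>l. f1 x \<otimes>\<^bsub>L\<^esub> l) (map_option (\<lambda>l. f2 ?y \<otimes>\<^bsub>L\<^esub> l) (\<psi> (inv\<^bsub>\<Gamma>\<^esub> a2 \<otimes>\<^bsub>\<Gamma>\<^esub> ?y)))"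
        using v f by (auto simp: L.m_assoc)
      also have "\<dots> = mact g (mact h \<psi>) x"
        using True m y \<psi> by (simp add: mact_def gh')
      finally show ?thesis .
    next
      case False
      then show ?thesis using \<psi> m by (simp add: mact_def)
    qed
  qed
qed (simp add: mact_def)

lemma mact_measurable:
  assumes g: "g \<in> carrier G"
  shows "mact g \<in> MX \<rightarrow>\<^sub>M MX"
proof -
  have "(\<lambda>\<psi>. \<lambda>x\<in>carrier \<Gamma>. map_option (\<lambda>l. fst g x \<otimes>\<^bsub>L\<^esub> l) (\<psi> (inv\<^bsub>\<Gamma>\<^esub> (snd g) \<otimes>\<^bsub>\<Gamma>\<^esub> x))) \<in> MX \<rightarrow>\<^sub>M MX"
  proof (rule measurable_restrict)
    fix x assume x: "x \<in> carrier \<Gamma>"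
    have y: "inv\<^bsub>\<Gamma>\<^esub> (snd g) \<otimes>\<^bsub>\<Gamma>\<^esub> x \<in> carrier \<Gamma>" "fst g x \<in> carrier L"
      using g x lamp_closed by (auto simp: carrier_G)
    have "(\<lambda>\<psi>. \<psi> (inv\<^bsub>\<Gamma>\<^esub> (snd g) \<otimes>\<^bsub>\<Gamma>\<^esub> x)) \<in> MX \<rightarrow>\<^sub>M count_space values"
      by (rule measurable_component_singleton[OF y(1)])
    then show "(\<lambda>\<psi>. map_option (\<lambda>l. fst g x \<otimes>\<^bsub>L\<^esub> l) (\<psi> (inv\<^bsub>\<Gamma>\<^esub> (snd g) \<otimes>\<^bsub>\<Gamma>\<^esub> x))) \<in> MX \<rightarrow>\<^sub>M count_space values"
      by (rule measurable_compose) (use y in auto)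
  qed
  moreover have "mact g \<psi> = (\<lambda>x\<in>carrier \<Gamma>. map_option (\<lambda>l. fst g x \<otimes>\<^bsub>L\<^esub> l) (\<psi> (inv\<^bsub>\<Gamma>\<^esub> (snd g) \<otimes>\<^bsub>\<Gamma>\<^esub> x)))" if "\<psi> \<in> space MX" for \<psi>
    using that unfolding space_MX mact_def by (simp only: restrict_apply')
  ultimately show ?thesis
    by (simp cong: measurable_cong)
qed

text \<open>Shifting the labels by the base part of \<open>g\<close> moves the marked set along with
  the configuration. The masked system is thus a factor of the product of labels and
  configurations.\<close>

lemma mask_equivariant:
  assumes g: "g \<in> carrier G" and \<phi>: "\<phi> \<in> conf"
  shows "mask (base.shift (snd g) U) (act g \<phi>) = mact g (mask U \<phi>)"
proof
  fix x
  have a: "snd g \<in> carrier \<Gamma>" using g by (auto simp: carrier_G)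
  show "mask (base.shift (snd g) U) (act g \<phi>) x = mact g (mask U \<phi>) x"
  proof (cases "x \<in> carrier \<Gamma>")
    case True
    have y: "inv\<^bsub>\<Gamma>\<^esub> (snd g) \<otimes>\<^bsub>\<Gamma>\<^esub> x \<in> carrier \<Gamma>" using a True by simp
    show ?thesis
      using True y mask_mconf[OF \<phi>, of U] base.marked_shift[OF a True K(2), of t m U] \<phi>
      by (cases g) (simp add: mact_def mask_def act_eq translate_def)
  next
    case False
    then show ?thesis using mask_mconf[OF \<phi>] by (simp add: mact_def mask_def)
  qed
qed

sublocale labels: prob_space labels by (rule base.prob_space_labels)
sublocale lc: pair_prob_space labels \<nu> by unfold_locales

lemma sets_\<kappa>: "sets \<kappa> = sets MX" and space_\<kappa>: "space \<kappa> = mconf"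
  by (simp_all add: \<kappa>_def space_PiM)

lemma prob_space_\<kappa>: "prob_space \<kappa>"
  unfolding \<kappa>_def by (rule lc.prob_space_distr[OF mask_measurable])

lemma integral_\<kappa>_pair:
  fixes f :: "_ \<Rightarrow> real"
  assumes "f \<in> borel_measurable MX"
  shows "(\<integral>\<psi>. f \<psi> \<partial>\<kappa>) = (\<integral>p. f (mask (fst p) (snd p)) \<partial>(labels \<Otimes>\<^sub>M \<nu>))"
  unfolding \<kappa>_def by (subst integral_distr[OF mask_measurable assms]) (simp add: split_beta')

lemma pair_measurable:
  fixes f :: "_ \<Rightarrow> real"
  assumes "f \<in> borel_measurable MX"
  shows "(\<lambda>p. f (mask (fst p) (snd p))) \<in> borel_measurable (labels \<Otimes>\<^sub>M \<nu>)"
  using measurable_compose[OF mask_measurable assms] by (simp add: split_beta')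

lemma pair_act_measurable:
  fixes f :: "_ \<Rightarrow> real"
  assumes f: "f \<in> borel_measurable MX" and g: "g \<in> carrier G"
  shows "(\<lambda>p. f (mask (fst p) (act g (snd p)))) \<in> borel_measurable (labels \<Otimes>\<^sub>M \<nu>)"
proof -
  have "(\<lambda>p. (fst p, act g (snd p))) \<in> labels \<Otimes>\<^sub>M \<nu> \<rightarrow>\<^sub>M labels \<Otimes>\<^sub>M \<nu>"
    by (intro measurable_Pair measurable_fst measurable_compose[OF measurable_snd conf.meas_act[OF g]])
  from measurable_compose[OF this pair_measurable[OF f]] show ?thesis by simp
qed

lemma integral_\<kappa>:
  fixes f :: "_ \<Rightarrow> real"
  assumes f: "f \<in> borel_measurable MX" and bound: "\<And>\<psi>. \<bar>f \<psi>\<bar> \<le> C"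
  shows "(\<integral>\<psi>. f \<psi> \<partial>\<kappa>) = (\<integral>U. \<integral>\<phi>. f (mask U \<phi>) \<partial>\<nu> \<partial>labels)"
proof -
  have "integrable (labels \<Otimes>\<^sub>M \<nu>) (\<lambda>p. f (mask (fst p) (snd p)))"
    using bound by (intro lc.integrable_const_bound[where B=C] pair_measurable f) auto
  from lc.integral_fst'[OF this] show ?thesis
    by (simp add: integral_\<kappa>_pair[OF f])
qed

text \<open>Acting on \<open>\<kappa>\<close> amounts to acting on the unmasked configuration only, as the labels are
  invariant in law.\<close>

lemma integral_\<kappa>_act:
  fixes f :: "_ \<Rightarrow> real"
  assumes f: "f \<in> borel_measurable MX" and bound: "\<And>\<psi>. \<bar>f \<psi>\<bar> \<le> C" and g: "g \<in> carrier G"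
  shows "(\<integral>\<psi>. f (mact g \<psi>) \<partial>\<kappa>) = (\<integral>U. \<integral>\<phi>. f (mask U (act g \<phi>)) \<partial>\<nu> \<partial>labels)"
proof -
  have a: "snd g \<in> carrier \<Gamma>" using g by (auto simp: carrier_G)
  have fg: "(\<lambda>\<psi>. f (mact g \<psi>)) \<in> borel_measurable MX"
    by (rule measurable_compose[OF mact_measurable[OF g] f])
  have Fm: "(\<lambda>U. \<integral>\<phi>. f (mask U (act g \<phi>)) \<partial>\<nu>) \<in> borel_measurable labels"
    using pair_act_measurable[OF f g] by (intro conf.borel_measurable_lebesgue_integral) (simp add: split_beta')
  have "(\<integral>\<psi>. f (mact g \<psi>) \<partial>\<kappa>) = (\<integral>U. \<integral>\<phi>. f (mact g (mask U \<phi>)) \<partial>\<nu> \<partial>labels)"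
    by (rule integral_\<kappa>[OF fg bound])
  also have "\<dots> = (\<integral>U. \<integral>\<phi>. f (mask (base.shift (snd g) U) (act g \<phi>)) \<partial>\<nu> \<partial>labels)"
    by (intro Bochner_Integration.integral_cong refl) (simp add: mask_equivariant[OF g] space_\<nu>)
  also have "\<dots> = (\<integral>U. \<integral>\<phi>. f (mask U (act g \<phi>)) \<partial>\<nu> \<partial>labels)"
    by (rule base.integral_shift[OF a Fm])
  finally show ?thesis .
qed

lemma abs_integral_\<nu>_le:
  fixes f :: "_ \<Rightarrow> real"
  assumes "\<And>\<phi>. \<bar>f \<phi>\<bar> \<le> C"
  shows "\<bar>\<integral>\<phi>. f \<phi> \<partial>\<nu>\<bar> \<le> C"
proof (cases "integrable \<nu> f")
  case True
  have "\<bar>\<integral>\<phi>. f \<phi> \<partial>\<nu>\<bar> \<le> (\<integral>\<phi>. \<bar>f \<phi>\<bar> \<partial>\<nu>)" by (rule integral_abs_bound)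
  also have "\<dots> \<le> (\<integral>\<phi>. C \<partial>\<nu>)" using True assms by (intro integral_mono) auto
  finally show ?thesis by (simp add: conf.prob_space)
next
  case False
  then show ?thesis using assms[of undefined] by (simp add: not_integrable_integral_eq)
qed

lemma expectation_integral_act:
  fixes f :: "_ \<Rightarrow> real"
  assumes f: "f \<in> borel_measurable MX" and bound: "\<And>\<psi>. \<bar>f \<psi>\<bar> \<le> C" and U: "U \<in> space labels"
  shows "(\<integral>\<phi>. f (mask U \<phi>) \<partial>\<nu>) = measure_pmf.expectation \<mu> (\<lambda>g. \<integral>\<phi>. f (mask U (act g \<phi>)) \<partial>\<nu>)"
  using bound by (intro conf.integral_stationary measurable_compose[OF mask_measurable2[OF U] f])

text \<open>By \<open>integral_\<kappa>_act\<close> only the configuration has to be translated, so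
  for each fixed \<open>U\<close> the claim is stationarity of \<nu>; the averages over labels and
  over the group are exchanged by Fubini.\<close>

sublocale \<kappa>: stationary_action G \<mu> \<kappa> mact
proof (intro stationary_action.intro stationary_action_axioms.intro gen prob_space_\<kappa>)
  show "group_action G (space \<kappa>) mact" unfolding space_\<kappa> by (rule group_action_mconf)
  show m: "mact g \<in> \<kappa> \<rightarrow>\<^sub>M \<kappa>" if "g \<in> carrier G" for g
    using mact_measurable[OF that] by (simp add: measurable_cong_sets[OF sets_\<kappa> sets_\<kappa>])
  interpret \<kappa>: prob_space \<kappa> by (rule prob_space_\<kappa>)
  fix E assume E: "E \<in> sets \<kappa>"
  let ?f = "indicator E :: _ \<Rightarrow> real"
  have f: "?f \<in> borel_measurable MX" using E by (simp add: sets_\<kappa>)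
  have bound: "\<bar>?f \<psi>\<bar> \<le> 1" for \<psi> by (simp add: indicator_def)
  have "measure_pmf.expectation \<mu> (\<lambda>g. measure \<kappa> (mact g -` E \<inter> space \<kappa>)) =
      measure_pmf.expectation \<mu> (\<lambda>g. \<integral>U. \<integral>\<phi>. ?f (mask U (act g \<phi>)) \<partial>\<nu> \<partial>labels)"
  proof (rule integral_cong_AE)
    show "AE g in measure_pmf \<mu>. measure \<kappa> (mact g -` E \<inter> space \<kappa>) = (\<integral>U. \<integral>\<phi>. ?f (mask U (act g \<phi>)) \<partial>\<nu> \<partial>labels)"
      using conf.AE_carrier
    proof eventually_elim
      case (elim g)
      have "measure \<kappa> (mact g -` E \<inter> space \<kappa>) = (\<integral>\<psi>. indicator (mact g -` E \<inter> space \<kappa>) \<psi> \<partial>\<kappa>)"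
        by (simp add: Int_absorb2)
      also have "\<dots> = (\<integral>\<psi>. ?f (mact g \<psi>) \<partial>\<kappa>)"
        by (intro Bochner_Integration.integral_cong refl) (simp add: indicator_def)
      also have "\<dots> = (\<integral>U. \<integral>\<phi>. ?f (mask U (act g \<phi>)) \<partial>\<nu> \<partial>labels)"
        by (rule integral_\<kappa>_act[OF f bound elim])
      finally show ?case .
    qed
  qed simp_all
  also have "\<dots> = (\<integral>U. measure_pmf.expectation \<mu> (\<lambda>g. \<integral>\<phi>. ?f (mask U (act g \<phi>)) \<partial>\<nu>) \<partial>labels)"
  proof (rule integral_expectation_swap[symmetric, OF base.prob_space_labels])
    fix g assume "g \<in> set_pmf \<mu>"
    then have g: "g \<in> carrier G" using conf.set_pmf_subset by blast
    show "(\<lambda>U. \<integral>\<phi>. ?f (mask U (act g \<phi>)) \<partial>\<nu>) \<in> borel_measurable labels"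
      using pair_act_measurable[OF f g] by (intro conf.borel_measurable_lebesgue_integral) (simp add: split_beta')
    show "\<bar>\<integral>\<phi>. ?f (mask U (act g \<phi>)) \<partial>\<nu>\<bar> \<le> 1" for U
      by (rule abs_integral_\<nu>_le[OF bound])
  qed
  also have "\<dots> = (\<integral>U. \<integral>\<phi>. ?f (mask U \<phi>) \<partial>\<nu> \<partial>labels)"
    by (intro Bochner_Integration.integral_cong refl expectation_integral_act[symmetric, OF f bound])
  also have "\<dots> = (\<integral>\<psi>. ?f \<psi> \<partial>\<kappa>)" by (rule integral_\<kappa>[symmetric, OF f bound])
  also have "\<dots> = measure \<kappa> E"
    using E sets.sets_into_space[OF E] by (simp add: Int_absorb2)
  finally show "measure_pmf.expectation \<mu> (\<lambda>g. measure \<kappa> (mact g -` E \<inter> space \<kappa>)) = measure \<kappa> E" .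
qed

text \<open>For an invariant \<open>E\<close> let \<open>F U\<close> be its conditional probability
  given the labels. \<open>F\<close> is an average of shifts of itself with the same L2 norm, so it
  is invariant under them, and mixing makes it constant. For a suitable fixed \<open>U\<close>, the
  configurations whose mask lies in \<open>E\<close> then have the same measure under all translates
  of \<nu>, hence measure 0 or 1.\<close>

lemma ergodic_\<kappa>:
  assumes inf: "infinite (carrier \<Gamma>)"
  shows "ergodic_action G \<kappa> mact"
  unfolding ergodic_action_def
proof (intro ballI impI)
  fix E assume E: "E \<in> sets \<kappa>" and inv: "\<forall>g\<in>carrier G. mact g ` E = E"
  let ?f = "indicator E :: _ \<Rightarrow> real"
  have f: "?f \<in> borel_measurable MX" using E by (simp add: sets_\<kappa>)
  have bound: "\<bar>?f \<psi>\<bar> \<le> 1" for \<psi> by (simp add: indicator_def)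
  have EM: "E \<subseteq> mconf" using sets.sets_into_space[OF E] by (simp add: space_\<kappa>)
  have f_inv: "?f (mact g \<psi>) = ?f \<psi>" if g: "g \<in> carrier G" and \<psi>: "\<psi> \<in> mconf" for g \<psi>
  proof -
    have "\<psi> \<in> E" if "mact g \<psi> \<in> E"
    proof -
      from that inv g obtain \<psi>' where \<psi>': "\<psi>' \<in> E" "mact g \<psi> = mact g \<psi>'" by blast
      have "\<psi> = mact (inv\<^bsub>G\<^esub> g) (mact g \<psi>)" using \<kappa>.act_inv[OF g] \<psi> by (simp add: space_\<kappa>)
      also have "\<dots> = \<psi>'" using \<kappa>.act_inv[OF g] \<psi>' EM by (auto simp: space_\<kappa>)
      finally show ?thesis using \<psi>' by simp
    qed
    moreover have "mact g \<psi> \<in> E" if "\<psi> \<in> E" using inv g that by blast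
    ultimately show ?thesis by (auto simp: indicator_def)
  qed
  define F where "F U = (\<integral>\<phi>. ?f (mask U \<phi>) \<partial>\<nu>)" for U
  have F_bound: "\<bar>F U\<bar> \<le> 1" for U unfolding F_def by (rule abs_integral_\<nu>_le[OF bound])
  have Fm[measurable]: "F \<in> borel_measurable labels"
    unfolding F_def using pair_measurable[OF f]
    by (intro conf.borel_measurable_lebesgue_integral) (simp add: split_beta')
  \<comment> \<open>By invariance of \<open>E\<close>, acting with \<open>g\<close> on the
    configuration alone amounts to undoing \<open>g\<close> on the labels, hence the
    inverse.\<close>
  let ?\<sigma> = "\<lambda>g. base.shift (inv\<^bsub>\<Gamma>\<^esub> (snd g))"
  have snd_G: "snd g \<in> carrier \<Gamma>" "inv\<^bsub>\<Gamma>\<^esub> (snd g) \<in> carrier \<Gamma>" if "g \<in> carrier G" for g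
    using that by (auto simp: carrier_G)
  have F_shift: "F (?\<sigma> g U) = (\<integral>\<phi>. ?f (mask U (act g \<phi>)) \<partial>\<nu>)" if g: "g \<in> carrier G" and U: "U \<in> space labels" for g U
  proof -
    have undo: "base.shift (snd g) (?\<sigma> g U) = U"
      using snd_G[OF g] U by (simp add: base.shift_mult[symmetric] base.shift_one)
    show ?thesis
      unfolding F_def
    proof (intro Bochner_Integration.integral_cong refl)
      fix \<phi> assume "\<phi> \<in> space \<nu>"
      then have \<phi>: "\<phi> \<in> conf" by (simp add: space_\<nu>)
      show "?f (mask (?\<sigma> g U) \<phi>) = ?f (mask U (act g \<phi>))"
        using f_inv[OF g mask_mconf[OF \<phi>]] mask_equivariant[OF g \<phi>, of "?\<sigma> g U"] undo by simp
    qed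
  qed
  have F_harm: "F U = measure_pmf.expectation \<mu> (\<lambda>g. F (?\<sigma> g U))" if U: "U \<in> space labels" for U
  proof -
    have "F U = measure_pmf.expectation \<mu> (\<lambda>g. \<integral>\<phi>. ?f (mask U (act g \<phi>)) \<partial>\<nu>)"
      unfolding F_def by (rule expectation_integral_act[OF f bound U])
    also have "\<dots> = measure_pmf.expectation \<mu> (\<lambda>g. F (?\<sigma> g U))"
    proof (rule integral_cong_AE)
      show "AE g in measure_pmf \<mu>. (\<integral>\<phi>. ?f (mask U (act g \<phi>)) \<partial>\<nu>) = F (?\<sigma> g U)"
        using conf.AE_carrier by eventually_elim (rule F_shift[OF _ U, symmetric])
    qed simp_all
    finally show ?thesis .
  qed
  have F\<sigma>m: "(\<lambda>U. F (?\<sigma> g U)) \<in> borel_measurable labels" if "g \<in> carrier G" for g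
    by (rule measurable_compose[OF base.shift_measurable[OF snd_G(2)[OF that]] Fm])
  let ?I = "\<integral>U. F U * F U \<partial>labels"
  \<comment> \<open>The squared L2 distance of \<open>F\<close> to its shift. Its \<mu>-average
    vanishes, since the shifts preserve the norm of \<open>F\<close> and average to
    \<open>F\<close>.\<close>
  define d where "d g = (\<integral>U. (F (?\<sigma> g U) - F U) * (F (?\<sigma> g U) - F U) \<partial>labels)" for g :: "('g \<Rightarrow> 'l) \<times> 'g"
  define c where "c g = (\<integral>U. F (?\<sigma> g U) * F U \<partial>labels)" for g :: "('g \<Rightarrow> 'l) \<times> 'g"
  have int_prod: "integrable labels (\<lambda>U. u U * v U)"
    if "u \<in> borel_measurable labels" "v \<in> borel_measurable labels" "\<And>U. \<bar>u U\<bar> \<le> 1" "\<And>U. \<bar>v U\<bar> \<le> 1" for u v :: "_ \<Rightarrow> real"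
    using that(1,2) by (intro labels.integrable_const_bound[where B=1] AE_I2) (simp_all only: real_norm_def abs_mult_le_one that borel_measurable_times)
  have d_eq: "d g = 2 * ?I - 2 * c g" if g: "g \<in> carrier G" for g
  proof -
    note ints = int_prod[OF F\<sigma>m[OF g] F\<sigma>m[OF g] F_bound F_bound] int_prod[OF F\<sigma>m[OF g] Fm F_bound F_bound]
      int_prod[OF Fm Fm F_bound F_bound]
    have "d g = (\<integral>U. F (?\<sigma> g U) * F (?\<sigma> g U) - 2 * (F (?\<sigma> g U) * F U) + F U * F U \<partial>labels)"
      unfolding d_def by (intro Bochner_Integration.integral_cong refl) (simp add: algebra_simps)
    also have "\<dots> = (\<integral>U. F (?\<sigma> g U) * F (?\<sigma> g U) \<partial>labels) - 2 * c g + ?I"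
      unfolding c_def using ints by simp
    also have "(\<integral>U. F (?\<sigma> g U) * F (?\<sigma> g U) \<partial>labels) = ?I"
      by (rule base.integral_shift[OF snd_G(2)[OF g]]) measurable
    finally show ?thesis by simp
  qed
  have "measure_pmf.expectation \<mu> c = (\<integral>U. measure_pmf.expectation \<mu> (\<lambda>g. F (?\<sigma> g U) * F U) \<partial>labels)"
    unfolding c_def
  proof (rule integral_expectation_swap[symmetric, OF base.prob_space_labels])
    fix g assume "g \<in> set_pmf \<mu>"
    then have "g \<in> carrier G" using conf.set_pmf_subset by blast
    then show "(\<lambda>U. F (?\<sigma> g U) * F U) \<in> borel_measurable labels" by (intro borel_measurable_times F\<sigma>m Fm)
    show "\<bar>F (?\<sigma> g U) * F U\<bar> \<le> 1" for U by (intro abs_mult_le_one F_bound)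
  qed
  also have "\<dots> = ?I"
    by (intro Bochner_Integration.integral_cong refl) (simp add: F_harm[symmetric])
  finally have c_avg: "measure_pmf.expectation \<mu> c = ?I" .
  have I_le: "\<bar>c g\<bar> \<le> 1" for g
  proof (cases "integrable labels (\<lambda>U. F (?\<sigma> g U) * F U)")
    case True
    have "\<bar>c g\<bar> \<le> (\<integral>U. \<bar>F (?\<sigma> g U) * F U\<bar> \<partial>labels)" unfolding c_def by (rule integral_abs_bound)
    also have "\<dots> \<le> (\<integral>U. 1 \<partial>labels)" using True by (intro integral_mono abs_mult_le_one F_bound) auto
    finally show ?thesis by (simp add: labels.prob_space)
  qed (simp add: c_def not_integrable_integral_eq)
  have c_int: "integrable (measure_pmf \<mu>) c" using I_le by (intro measure_pmf.integrable_const_bound[where B=1]) auto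
  have d_int: "integrable (measure_pmf \<mu>) (\<lambda>g. 2 * ?I - 2 * c g)" using c_int by auto
  have "AE g in measure_pmf \<mu>. 2 * ?I - 2 * c g = 0"
  proof (subst integral_nonneg_eq_0_iff_AE[symmetric, OF d_int])
    show "AE g in measure_pmf \<mu>. 0 \<le> 2 * ?I - 2 * c g"
      using conf.AE_carrier
    proof eventually_elim
      case (elim g)
      have "0 \<le> d g" unfolding d_def by (intro Bochner_Integration.integral_nonneg) simp
      then show ?case by (simp add: d_eq[OF elim])
    qed
    show "measure_pmf.expectation \<mu> (\<lambda>g. 2 * ?I - 2 * c g) = 0"
      using c_int c_avg by simp
  qed
  then have d0: "d g = 0" if "g \<in> set_pmf \<mu>" for g
    using that d_eq[OF subsetD[OF conf.set_pmf_subset that]] unfolding AE_measure_pmf_iff by metis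
  have F_inv: "AE U in labels. F (?\<sigma> g U) = F U" if "g \<in> carrier G" for g
    using that
  proof (induction rule: conf.generating_induct)
    case (incl s)
    then have s: "s \<in> carrier G" using conf.set_pmf_subset by blast
    have i: "integrable labels (\<lambda>U. (F (?\<sigma> s U) - F U) * (F (?\<sigma> s U) - F U))"
    proof -
      have "integrable labels (\<lambda>U. F (?\<sigma> s U) * F (?\<sigma> s U) - 2 * (F (?\<sigma> s U) * F U) + F U * F U)"
        using int_prod[OF F\<sigma>m[OF s] F\<sigma>m[OF s] F_bound F_bound] int_prod[OF F\<sigma>m[OF s] Fm F_bound F_bound]
          int_prod[OF Fm Fm F_bound F_bound]
        by (intro Bochner_Integration.integrable_add Bochner_Integration.integrable_diff integrable_mult_right)
      moreover have "(\<lambda>U. (F (?\<sigma> s U) - F U) * (F (?\<sigma> s U) - F U)) =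
          (\<lambda>U. F (?\<sigma> s U) * F (?\<sigma> s U) - 2 * (F (?\<sigma> s U) * F U) + F U * F U)"
        by (simp add: fun_eq_iff algebra_simps)
      ultimately show ?thesis by (simp only:)
    qed
    have "AE U in labels. (F (?\<sigma> s U) - F U) * (F (?\<sigma> s U) - F U) = 0"
      using integral_nonneg_eq_0_iff_AE[OF i] d0[OF incl] by (simp add: d_def)
    then show ?case by eventually_elim simp
  next
    case (mult a b)
    \<comment> \<open>The almost sure identity for \<open>b\<close> is evaluated at a shifted label
      field, which is allowed as the shift by \<open>a\<close> preserves the law of the
      labels.\<close>
    have "AE U in distr labels labels (?\<sigma> a). F (?\<sigma> b U) = F U"
      unfolding base.distr_shift[OF snd_G(2)[OF mult(1)]] by (rule mult(4))
    then have ab: "AE U in labels. F (?\<sigma> b (?\<sigma> a U)) = F (?\<sigma> a U)"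
      by (rule AE_distrD[OF base.shift_measurable[OF snd_G(2)[OF mult(1)]]])
    have \<sigma>_mult: "?\<sigma> (a \<otimes>\<^bsub>G\<^esub> b) U = ?\<sigma> b (?\<sigma> a U)" for U
    proof -
      have "snd (a \<otimes>\<^bsub>G\<^esub> b) = snd a \<otimes>\<^bsub>\<Gamma>\<^esub> snd b" by (cases a; cases b) (simp add: mult_G)
      then show ?thesis
        using snd_G[OF mult(1)] snd_G[OF mult(2)] by (simp add: \<Gamma>.inv_mult_group base.shift_mult)
    qed
    from ab mult(3) show ?case
      unfolding \<sigma>_mult by eventually_elim simp
  qed
  have F_inv': "AE U in labels. F (base.shift a U) = F U" if a: "a \<in> carrier \<Gamma>" for a
  proof -
    have "(\<lambda>x\<in>carrier \<Gamma>. \<one>\<^bsub>L\<^esub>, inv\<^bsub>\<Gamma>\<^esub> a) \<in> carrier G" using a one_lamp_configs by (simp add: carrier_G)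
    from F_inv[OF this] show ?thesis using a by simp
  qed
  let ?c = "\<integral>U. F U \<partial>labels"
  have const: "AE U in labels. F U = ?c"
    by (rule base.shift_invariant_constant[OF inf Fm F_bound F_inv'])
  \<comment> \<open>The group is countable, so a single label field \<open>U\<close> serves all its
    elements.\<close>
  have "AE U in labels. \<forall>g\<in>carrier G. F (?\<sigma> g U) = ?c"
  proof (subst AE_ball_countable[OF countable_G], intro ballI)
    fix g assume "g \<in> carrier G"
    from F_inv[OF this] const show "AE U in labels. F (?\<sigma> g U) = ?c" by eventually_elim simp
  qed
  then have "AE U in labels. U \<in> space labels \<and> (\<forall>g\<in>carrier G. F (?\<sigma> g U) = ?c)" by simp
  then obtain U where U: "U \<in> space labels" "\<And>g. g \<in> carrier G \<Longrightarrow> F (?\<sigma> g U) = ?c"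
    using eventually_happens'[OF labels.ae_filter_bot] by fastforce
  define D where "D = mask U -` E \<inter> conf"
  have D: "D \<in> sets CX"
    using measurable_sets[OF mask_measurable2[OF U(1)], of E] E by (simp add: D_def sets_\<kappa> sets_\<nu> space_\<nu>)
  have "measure \<nu> (act g -` D \<inter> conf) = ?c" if g: "g \<in> carrier G" for g
  proof -
    have "measure \<nu> (act g -` D \<inter> conf) = (\<integral>\<phi>. indicator (act g -` D \<inter> conf) \<phi> \<partial>\<nu>)"
      by (simp add: space_\<nu> Int_absorb2)
    also have "\<dots> = (\<integral>\<phi>. ?f (mask U (act g \<phi>)) \<partial>\<nu>)"
      using conf.act_space[OF g]
      by (intro Bochner_Integration.integral_cong refl) (auto simp: D_def indicator_def space_\<nu>)
    also have "\<dots> = ?c" using U g F_shift by simp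
    finally show ?thesis .
  qed
  then have "?c = 0 \<or> ?c = 1" by (rule constant_translates_imp_trivial[OF D])
  moreover have "measure \<kappa> E = ?c"
  proof -
    have "measure \<kappa> E = (\<integral>\<psi>. ?f \<psi> \<partial>\<kappa>)" using EM by (simp add: space_\<kappa> Int_absorb2)
    also have "\<dots> = ?c" unfolding F_def by (rule integral_\<kappa>[OF f bound])
    finally show ?thesis .
  qed
  ultimately show "measure \<kappa> E = 0 \<or> measure \<kappa> E = 1" by simp
qed

section \<open>Relative entropy of the translates of the masked law\<close>

lemma integrable_snd:
  fixes k :: "_ \<Rightarrow> real"
  assumes k: "integrable \<nu> k"
  shows "integrable (labels \<Otimes>\<^sub>M \<nu>) (\<lambda>p. k (snd p))" "(\<integral>p. k (snd p) \<partial>(labels \<Otimes>\<^sub>M \<nu>)) = (\<integral>\<phi>. k \<phi> \<partial>\<nu>)"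
proof -
  have [measurable]: "k \<in> borel_measurable \<nu>" using k by simp
  show int: "integrable (labels \<Otimes>\<^sub>M \<nu>) (\<lambda>p. k (snd p))"
  proof (rule lc.Fubini_integrable)
    show "(\<lambda>p. k (snd p)) \<in> borel_measurable (labels \<Otimes>\<^sub>M \<nu>)" by measurable
  qed (use k in simp_all)
  show "(\<integral>p. k (snd p) \<partial>(labels \<Otimes>\<^sub>M \<nu>)) = (\<integral>\<phi>. k \<phi> \<partial>\<nu>)"
    using lc.integral_fst'[OF int] by (simp add: labels.prob_space)
qed

text \<open>The density \<open>s\<close> of the masked translate is close in L1 to \<open>T\<close>,
  which is \<open>r\<close> if \<open>B\<close> is visible and 1 otherwise. A visible
  \<open>B\<close> costs \<delta> twice, for replacing \<open>s\<close> and \<open>r\<close> by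
  \<open>h\<close>, an erased \<open>B\<close> costs \<delta>, and the remaining labels, of
  probability at most \<open>2 * \<delta>\<close>, cost at most \<open>M g\<close> each: in all
  \<open>(3 + 2 * M g) * \<delta>\<close>. Then \<open>modulus\<close> passes from the densities to
  \<open>x * ln x\<close>.\<close>

lemma kl_estimate:
  fixes h :: "('g \<Rightarrow> 'l) \<Rightarrow> real"
  defines "M \<equiv> \<lambda>g. 1 / pmf \<mu> g"
  assumes g: "g \<in> set_pmf \<mu>" and B: "finite B" "B \<subseteq> carrier \<Gamma>" "B \<noteq> {}"
    and far: "\<And>f :: _ \<Rightarrow> real. f \<in> borel_measurable CX \<Longrightarrow> (\<And>\<phi>. \<bar>f \<phi>\<bar> \<le> 1) \<Longrightarrow>
      (\<And>\<phi> \<psi>. \<phi> \<in> conf \<Longrightarrow> \<psi> \<in> conf \<Longrightarrow> (\<And>x. x \<in> carrier \<Gamma> - B \<Longrightarrow> \<phi> x = \<psi> x) \<Longrightarrow> f \<phi> = f \<psi>) \<Longrightarrow>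
      \<bar>(\<integral>\<phi>. f (act g \<phi>) \<partial>\<nu>) - (\<integral>\<phi>. f \<phi> \<partial>\<nu>)\<bar> \<le> \<delta>"
    and r: "r \<in> borel_measurable \<nu>" "\<And>x. 0 < r x" "\<And>x. r x \<le> M g" "push act g \<nu> = density \<nu> (\<lambda>x. ennreal (r x))"
    and h: "h \<in> borel_measurable (Pi\<^sub>M B (\<lambda>_. count_space (carrier L)))" "integrable \<nu> (\<lambda>\<phi>. h (restrict \<phi> B))"
      "(\<integral>\<phi>. \<bar>r \<phi> - h (restrict \<phi> B)\<bar> \<partial>\<nu>) \<le> \<delta>"
    and p0: "1 - q - \<delta> \<le> measure labels {U \<in> space labels. B \<inter> marks U = {}}"
    and p1: "\<bar>measure labels {U \<in> space labels. B \<subseteq> marks U} - q\<bar> \<le> \<delta>"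
    and modulus: "\<And>x y. x \<in> {0..M g} \<Longrightarrow> y \<in> {0..M g} \<Longrightarrow> \<bar>x * ln x - y * ln y\<bar> \<le> \<eta> + C * \<bar>x - y\<bar>"
    and C: "0 \<le> C"
  shows "\<bar>\<kappa>.kl g - q * conf.kl g\<bar> \<le> \<eta> + C * ((3 + 2 * M g) * \<delta>) + conf.kl g * \<delta>"
proof -
  have gG: "g \<in> carrier G" using g conf.set_pmf_subset by blast
  have M1: "1 \<le> M g" using pmf_positive[OF g] pmf_le_1[of \<mu> g] by (simp add: M_def)
  obtain s where s: "s \<in> borel_measurable \<kappa>" "\<And>x. 0 < s x" "\<And>x. s x \<le> M g"
    and s_push: "push mact g \<kappa> = density \<kappa> (\<lambda>x. ennreal (s x))"
    using \<kappa>.push_density[OF g] unfolding M_def by blast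
  have sm: "s \<in> borel_measurable MX" using s(1) by (simp add: measurable_cong_sets[OF sets_\<kappa> refl])
  let ?P = "labels \<Otimes>\<^sub>M \<nu>" and ?k = "\<lambda>p. mask (fst p) (snd p)"
  have spP: "fst p \<in> space labels" "snd p \<in> conf" if "p \<in> space ?P" for p
    using that by (auto simp: space_pair_measure space_\<nu>)
  have sb: "\<bar>s x\<bar> \<le> M g" "\<bar>r y\<bar> \<le> M g" for x y
    using s(2,3)[of x] r(2,3)[of y] by auto
  have rm[measurable]: "r \<in> borel_measurable \<nu>" by (rule r(1))
  have rint: "integrable \<nu> r" using sb(2) by (intro conf.integrable_const_bound[where B="M g"]) auto
  let ?h = "\<lambda>\<phi>. h (restrict \<phi> B)"
  have rh: "integrable \<nu> (\<lambda>\<phi>. \<bar>r \<phi> - ?h \<phi>\<bar>)" using rint h(2) by auto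
  note rh_pair = integrable_snd[OF rh]

  define A1 where "A1 = {\<psi> \<in> mconf. \<forall>b\<in>B. \<psi> b \<noteq> None}"
  define A0 where "A0 = {\<psi> \<in> mconf. \<forall>b\<in>B. \<psi> b = None}"
  have A1_iff: "mask U \<phi> \<in> A1 \<longleftrightarrow> B \<subseteq> marks U" and A0_iff: "mask U \<phi> \<in> A0 \<longleftrightarrow> B \<inter> marks U = {}"
    if "\<phi> \<in> conf" for U \<phi>
  proof -
    have mv: "mask U \<phi> b = (if b \<in> marks U then Some (\<phi> b) else None)" if "b \<in> B" for b
      unfolding mask_def using subsetD[OF B(2) that] by (rule restrict_apply')
    have "(\<forall>b\<in>B. mask U \<phi> b \<noteq> None) = (\<forall>b\<in>B. b \<in> marks U)"
      by (intro ball_cong refl) (simp add: mv)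
    then show "mask U \<phi> \<in> A1 \<longleftrightarrow> B \<subseteq> marks U"
      unfolding A1_def subset_eq mem_Collect_eq using mask_mconf[OF that, of U] by (simp only: simp_thms)
    have "(\<forall>b\<in>B. mask U \<phi> b = None) = (\<forall>b\<in>B. b \<notin> marks U)"
      by (intro ball_cong refl) (simp add: mv)
    then show "mask U \<phi> \<in> A0 \<longleftrightarrow> B \<inter> marks U = {}"
      unfolding A0_def disjoint_iff Ball_def mem_Collect_eq using mask_mconf[OF that, of U] by (simp only: simp_thms)
  qed
  have cm: "(\<lambda>\<psi>. \<psi> b) \<in> MX \<rightarrow>\<^sub>M count_space values" if "b \<in> B" for b
    using that B by (intro measurable_component_singleton) auto
  have As: "A1 \<in> sets MX" "A0 \<in> sets MX"
  proof -
    have none: "{\<psi> \<in> space MX. \<psi> b = None} \<in> sets MX" if "b \<in> B" for b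
    proof -
      have "{\<psi> \<in> space MX. \<psi> b = None} = (\<lambda>\<psi>. \<psi> b) -` {None} \<inter> space MX" by blast
      then show ?thesis using measurable_sets[OF cm[OF that], of "{None}"] by simp
    qed
    have "{\<psi> \<in> space MX. \<forall>b\<in>B. \<psi> b = None} \<in> sets MX"
      by (rule sets.sets_Collect_finite_All[OF none B(1)])
    then show "A0 \<in> sets MX" unfolding A0_def space_MX .
    have "{\<psi> \<in> space MX. \<forall>b\<in>B. \<psi> b \<noteq> None} \<in> sets MX"
      by (rule sets.sets_Collect_finite_All[OF sets.sets_Collect_neg[OF none] B(1)])
    then show "A1 \<in> sets MX" unfolding A1_def space_MX .
  qed
  have As\<kappa>: "A1 \<in> sets \<kappa>" "A0 \<in> sets \<kappa>" using As by (simp_all add: sets_\<kappa>)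

  \<comment> \<open>\<open>h\<close> read off a masked configuration. The default
    \<open>\<one>\<close> never enters on \<open>A1\<close>, where all of \<open>B\<close> is
    visible.\<close>
  define hX where "hX \<psi> = indicator A1 \<psi> * h (\<lambda>x\<in>B. case \<psi> x of None \<Rightarrow> \<one>\<^bsub>L\<^esub> | Some l \<Rightarrow> l)" for \<psi>
  have hXm: "hX \<in> borel_measurable MX"
  proof -
    have "(\<lambda>\<psi>. \<lambda>x\<in>B. case \<psi> x of None \<Rightarrow> \<one>\<^bsub>L\<^esub> | Some l \<Rightarrow> l) \<in> MX \<rightarrow>\<^sub>M Pi\<^sub>M B (\<lambda>_. count_space (carrier L))"
      by (intro measurable_restrict measurable_compose[OF cm]) auto
    from measurable_compose[OF this h(1)] show ?thesis
      unfolding hX_def[abs_def] by (intro borel_measurable_times borel_measurable_indicator As)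
  qed
  have hX_mask: "hX (mask U \<phi>) = indicator A1 (mask U \<phi>) * ?h \<phi>" if \<phi>: "\<phi> \<in> conf" for U \<phi>
  proof (cases "B \<subseteq> marks U")
    case True
    then have "(\<lambda>x\<in>B. case mask U \<phi> x of None \<Rightarrow> \<one>\<^bsub>L\<^esub> | Some l \<Rightarrow> l) = restrict \<phi> B"
      using B by (auto simp: fun_eq_iff mask_def)
    then show ?thesis by (simp add: hX_def)
  next
    case False
    then show ?thesis using A1_iff[OF \<phi>, of U] by (simp add: hX_def)
  qed

  \<comment> \<open>Apart from its bounds, \<open>s\<close> is accessible only through these
    integrals over the translated masked law, hence the duality arguments below.\<close>
  have int_vs: "(\<integral>\<psi>. v \<psi> * s \<psi> \<partial>\<kappa>) = (\<integral>\<psi>. v (mact g \<psi>) \<partial>\<kappa>)" if v: "v \<in> borel_measurable \<kappa>" for v :: "_ \<Rightarrow> real"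
  proof -
    have "(\<integral>\<psi>. v (mact g \<psi>) \<partial>\<kappa>) = (\<integral>\<psi>. v \<psi> \<partial>(push mact g \<kappa>))"
      unfolding push_def by (rule integral_distr[symmetric, OF \<kappa>.meas_act[OF gG] v])
    also have "\<dots> = (\<integral>\<psi>. s \<psi> * v \<psi> \<partial>\<kappa>)"
      unfolding s_push using s(2) by (subst integral_density[OF v s(1)]) (auto intro!: AE_I2 less_imp_le)
    finally show ?thesis by (simp add: mult.commute)
  qed
  have v_bound_int: "integrable ?P (\<lambda>p. v (?k p) * u (snd p))" "integrable ?P (\<lambda>p. v (?k p))"
    if v: "v \<in> borel_measurable MX" "\<And>\<psi>. \<bar>v \<psi>\<bar> \<le> 1" and u: "integrable \<nu> u" for v u :: "_ \<Rightarrow> real"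
  proof -
    show "integrable ?P (\<lambda>p. v (?k p))"
      using v(2) by (intro lc.integrable_const_bound[where B=1] pair_measurable v(1)) auto
    show "integrable ?P (\<lambda>p. v (?k p) * u (snd p))"
    proof (rule Bochner_Integration.integrable_bound[OF integrable_snd(1)[OF u]])
      show "(\<lambda>p. v (?k p) * u (snd p)) \<in> borel_measurable ?P"
        by (intro borel_measurable_times pair_measurable v(1) borel_measurable_integrable[OF integrable_snd(1)[OF u]])
      have "\<bar>v x\<bar> * \<bar>y\<bar> \<le> 1 * \<bar>y\<bar>" for x y by (rule mult_right_mono[OF v(2)]) simp
      then show "AE p in ?P. norm (v (?k p) * u (snd p)) \<le> norm (u (snd p))"
        by (intro AE_I2) (simp add: abs_mult)
    qed
  qed
  have s\<kappa>int: "integrable \<kappa> (\<lambda>\<psi>. v \<psi> * s \<psi>)" if "v \<in> borel_measurable \<kappa>" "\<And>\<psi>. \<bar>v \<psi>\<bar> \<le> 1" for v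
  proof (rule \<kappa>.integrable_const_bound[where B="M g"])
    show "AE \<psi> in \<kappa>. norm (v \<psi> * s \<psi>) \<le> M g"
    proof (intro AE_I2)
      fix \<psi>
      have "\<bar>v \<psi>\<bar> * \<bar>s \<psi>\<bar> \<le> 1 * M g" using that(2) sb(1) by (intro mult_mono) auto
      then show "norm (v \<psi> * s \<psi>) \<le> M g" by (simp add: abs_mult)
    qed
  qed (use that s(1) in measurable)

  \<comment> \<open>For \<open>v\<close> supported on \<open>A1\<close> the integral lifts to labels
    and configurations, where \<open>s\<close> may be replaced by \<open>r\<close> and
    \<open>hX\<close> by \<open>h\<close>. So the L1 distance of \<open>r\<close> and
    \<open>h\<close> bounds it.\<close>
  have E1: "(\<integral>\<psi>. indicator A1 \<psi> * \<bar>s \<psi> - hX \<psi>\<bar> \<partial>\<kappa>) \<le> \<delta>"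
  proof (rule integral_abs_le_dual[OF _ As\<kappa>(1)])
    show "(\<lambda>\<psi>. s \<psi> - hX \<psi>) \<in> borel_measurable \<kappa>"
      using sm hXm by (simp add: measurable_cong_sets[OF sets_\<kappa> refl])
    fix v :: "_ \<Rightarrow> real" assume v: "v \<in> borel_measurable \<kappa>" "\<And>\<psi>. \<bar>v \<psi>\<bar> \<le> 1" "\<And>\<psi>. \<psi> \<notin> A1 \<Longrightarrow> v \<psi> = 0"
    have vm: "v \<in> borel_measurable MX" using v(1) by (simp add: measurable_cong_sets[OF sets_\<kappa> refl])
    have v_hX: "v (mask U \<phi>) * hX (mask U \<phi>) = v (mask U \<phi>) * ?h \<phi>" if "\<phi> \<in> conf" for U \<phi>
      using v(3)[of "mask U \<phi>"] hX_mask[OF that, of U] by (cases "mask U \<phi> \<in> A1") auto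
    have vhm: "(\<lambda>\<psi>. v \<psi> * hX \<psi>) \<in> borel_measurable MX" using vm hXm by (rule borel_measurable_times)
    have iP: "integrable ?P (\<lambda>p. v (?k p) * hX (?k p))"
      using v_bound_int(1)[OF vm v(2) h(2)]
      by (subst Bochner_Integration.integrable_cong[OF refl, where g="\<lambda>p. v (?k p) * ?h (snd p)"])
        (simp_all add: v_hX spP)
    have "integrable \<kappa> (\<lambda>\<psi>. v \<psi> * hX \<psi>)"
      unfolding \<kappa>_def using iP by (subst integrable_distr_eq[OF mask_measurable vhm]) (simp add: split_beta')
    then have "(\<integral>\<psi>. v \<psi> * (s \<psi> - hX \<psi>) \<partial>\<kappa>) = (\<integral>\<psi>. v \<psi> * s \<psi> \<partial>\<kappa>) - (\<integral>\<psi>. v \<psi> * hX \<psi> \<partial>\<kappa>)"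
      using s\<kappa>int[OF v(1,2)] by (simp add: right_diff_distrib)
    also have "(\<integral>\<psi>. v \<psi> * s \<psi> \<partial>\<kappa>) = (\<integral>U. \<integral>\<phi>. v (mask U (act g \<phi>)) \<partial>\<nu> \<partial>labels)"
      unfolding int_vs[OF v(1)] by (rule integral_\<kappa>_act[OF vm v(2) gG])
    also have "\<dots> = (\<integral>U. \<integral>\<phi>. v (mask U \<phi>) * r \<phi> \<partial>\<nu> \<partial>labels)"
    proof (rule Bochner_Integration.integral_cong[OF refl])
      fix U assume U: "U \<in> space labels"
      have vU: "(\<lambda>\<phi>. v (mask U \<phi>)) \<in> borel_measurable \<nu>" by (rule measurable_compose[OF mask_measurable2[OF U] vm])
      have "(\<integral>\<phi>. v (mask U (act g \<phi>)) \<partial>\<nu>) = (\<integral>\<phi>. v (mask U \<phi>) \<partial>(push act g \<nu>))"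
        unfolding push_def by (rule integral_distr[symmetric, OF conf.meas_act[OF gG] vU])
      also have "\<dots> = (\<integral>\<phi>. r \<phi> * v (mask U \<phi>) \<partial>\<nu>)"
        unfolding r(4) using r(2) by (subst integral_density[OF vU r(1)]) (auto intro!: AE_I2 less_imp_le)
      finally show "(\<integral>\<phi>. v (mask U (act g \<phi>)) \<partial>\<nu>) = (\<integral>\<phi>. v (mask U \<phi>) * r \<phi> \<partial>\<nu>)"
        by (simp add: mult.commute)
    qed
    also have "\<dots> = (\<integral>p. v (?k p) * r (snd p) \<partial>?P)"
      using lc.integral_fst'[OF v_bound_int(1)[OF vm v(2) rint]] by simp
    also have "(\<integral>\<psi>. v \<psi> * hX \<psi> \<partial>\<kappa>) = (\<integral>p. v (?k p) * ?h (snd p) \<partial>?P)"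
      unfolding integral_\<kappa>_pair[OF vhm] by (intro Bochner_Integration.integral_cong refl v_hX spP)
    also have "(\<integral>p. v (?k p) * r (snd p) \<partial>?P) - (\<integral>p. v (?k p) * ?h (snd p) \<partial>?P) =
        (\<integral>p. v (?k p) * r (snd p) - v (?k p) * ?h (snd p) \<partial>?P)"
      by (rule Bochner_Integration.integral_diff[symmetric] v_bound_int[OF vm v(2)] rint h(2))+
    also have "\<dots> \<le> (\<integral>p. \<bar>r (snd p) - ?h (snd p)\<bar> \<partial>?P)"
    proof (rule integral_mono)
      fix p
      have "v (?k p) * r (snd p) - v (?k p) * ?h (snd p) \<le> \<bar>v (?k p)\<bar> * \<bar>r (snd p) - ?h (snd p)\<bar>"
        unfolding right_diff_distrib[symmetric] abs_mult[symmetric] by (rule abs_ge_self)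
      also have "\<dots> \<le> 1 * \<bar>r (snd p) - ?h (snd p)\<bar>" by (rule mult_right_mono[OF v(2)]) simp
      finally show "v (?k p) * r (snd p) - v (?k p) * ?h (snd p) \<le> \<bar>r (snd p) - ?h (snd p)\<bar>" by simp
    qed (intro Bochner_Integration.integrable_diff v_bound_int[OF vm v(2)] rint h(2) rh_pair(1))+
    also have "\<dots> \<le> \<delta>" using rh_pair(2) h(3) by simp
    finally show "(\<integral>\<psi>. v \<psi> * (s \<psi> - hX \<psi>) \<partial>\<kappa>) \<le> \<delta>" .
  qed

  \<comment> \<open>For \<open>v\<close> supported on \<open>A0\<close> and fixed \<open>U\<close>,
    the function \<open>v (mask U \<phi>)\<close> ignores \<phi> on \<open>B\<close>: either all of
    \<open>B\<close> is erased or the function vanishes. So \<open>far\<close> applies for each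
    \<open>U\<close> separately.\<close>
  have E0: "(\<integral>\<psi>. indicator A0 \<psi> * \<bar>s \<psi> - 1\<bar> \<partial>\<kappa>) \<le> \<delta>"
  proof (rule integral_abs_le_dual[OF _ As\<kappa>(2)])
    show "(\<lambda>\<psi>. s \<psi> - 1) \<in> borel_measurable \<kappa>" using s(1) by measurable
    fix v :: "_ \<Rightarrow> real" assume v: "v \<in> borel_measurable \<kappa>" "\<And>\<psi>. \<bar>v \<psi>\<bar> \<le> 1" "\<And>\<psi>. \<psi> \<notin> A0 \<Longrightarrow> v \<psi> = 0"
    have vm: "v \<in> borel_measurable MX" using v(1) by (simp add: measurable_cong_sets[OF sets_\<kappa> refl])
    have vi: "integrable \<kappa> v" using v by (intro \<kappa>.integrable_const_bound[where B=1]) auto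
    have m1: "(\<lambda>U. \<integral>\<phi>. v (mask U (act g \<phi>)) \<partial>\<nu>) \<in> borel_measurable labels"
      using pair_act_measurable[OF vm gG] by (intro conf.borel_measurable_lebesgue_integral) (simp add: split_beta')
    have m2: "(\<lambda>U. \<integral>\<phi>. v (mask U \<phi>) \<partial>\<nu>) \<in> borel_measurable labels"
      using pair_measurable[OF vm] by (intro conf.borel_measurable_lebesgue_integral) (simp add: split_beta')
    have i1: "integrable labels (\<lambda>U. \<integral>\<phi>. v (mask U (act g \<phi>)) \<partial>\<nu>)"
      using m1 abs_integral_\<nu>_le[of _ 1] v(2) by (intro labels.integrable_const_bound[where B=1]) auto
    have i2: "integrable labels (\<lambda>U. \<integral>\<phi>. v (mask U \<phi>) \<partial>\<nu>)"
      using m2 abs_integral_\<nu>_le[of _ 1] v(2) by (intro labels.integrable_const_bound[where B=1]) auto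
    have "(\<integral>\<psi>. v \<psi> * (s \<psi> - 1) \<partial>\<kappa>) = (\<integral>\<psi>. v \<psi> * s \<psi> \<partial>\<kappa>) - (\<integral>\<psi>. v \<psi> \<partial>\<kappa>)"
      using s\<kappa>int[OF v(1,2)] vi by (simp add: right_diff_distrib)
    also have "\<dots> = (\<integral>U. \<integral>\<phi>. v (mask U (act g \<phi>)) \<partial>\<nu> \<partial>labels) - (\<integral>U. \<integral>\<phi>. v (mask U \<phi>) \<partial>\<nu> \<partial>labels)"
      unfolding int_vs[OF v(1)] integral_\<kappa>_act[OF vm v(2) gG] integral_\<kappa>[OF vm v(2)] ..
    also have "\<dots> = (\<integral>U. (\<integral>\<phi>. v (mask U (act g \<phi>)) \<partial>\<nu>) - (\<integral>\<phi>. v (mask U \<phi>) \<partial>\<nu>) \<partial>labels)"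
      using i1 i2 by simp
    also have "\<dots> \<le> (\<integral>U. \<delta> \<partial>labels)"
    proof (rule integral_mono)
      fix U assume U: "U \<in> space labels"
      have "\<bar>(\<integral>\<phi>. v (mask U (act g \<phi>)) \<partial>\<nu>) - (\<integral>\<phi>. v (mask U \<phi>) \<partial>\<nu>)\<bar> \<le> \<delta>"
      proof (rule far)
        show "(\<lambda>\<phi>. v (mask U \<phi>)) \<in> borel_measurable CX"
          using measurable_compose[OF mask_measurable2[OF U] vm] by (simp add: measurable_cong_sets[OF sets_\<nu> refl])
        fix \<phi> \<psi> assume c: "\<phi> \<in> conf" "\<psi> \<in> conf" "\<And>x. x \<in> carrier \<Gamma> - B \<Longrightarrow> \<phi> x = \<psi> x"
        show "v (mask U \<phi>) = v (mask U \<psi>)"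
        proof (cases "B \<inter> marks U = {}")
          case True
          then have "mask U \<phi> = mask U \<psi>"
            using c(3) by (auto simp: mask_def fun_eq_iff)
          then show ?thesis by simp
        next
          case False
          then show ?thesis using A0_iff[OF c(1), of U] A0_iff[OF c(2), of U] v(3) by simp
        qed
      qed (rule v(2))
      then show "(\<integral>\<phi>. v (mask U (act g \<phi>)) \<partial>\<nu>) - (\<integral>\<phi>. v (mask U \<phi>) \<partial>\<nu>) \<le> \<delta>" by linarith
    qed (use i1 i2 in simp_all)
    also have "\<dots> = \<delta>" by (simp add: labels.prob_space)
    finally show "(\<integral>\<psi>. v \<psi> * (s \<psi> - 1) \<partial>\<kappa>) \<le> \<delta>" .
  qed

  let ?All = "{U \<in> space labels. B \<subseteq> marks U}" and ?None = "{U \<in> space labels. B \<inter> marks U = {}}"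
  have mk: "{U \<in> space labels. b \<in> marks U} \<in> sets labels" if "b \<in> B" for b
    using that B base.marked_sets[OF K] by blast
  have AllS: "?All \<in> sets labels"
  proof -
    have "?All = (\<Inter>b\<in>B. {U \<in> space labels. b \<in> marks U})" using B(3) by auto
    also have "\<dots> \<in> sets labels" using B by (intro sets.finite_INT mk) auto
    finally show ?thesis .
  qed
  have NoneS: "?None \<in> sets labels"
  proof -
    have "?None = space labels - (\<Union>b\<in>B. {U \<in> space labels. b \<in> marks U})" by auto
    also have "\<dots> \<in> sets labels" using B by (intro sets.Diff sets.finite_UN mk) auto
    finally show ?thesis .
  qed
  define rest where "rest = space labels - (?All \<union> ?None)"
  have restS: "rest \<in> sets labels" unfolding rest_def using AllS NoneS by auto
  have "measure labels (?All \<union> ?None) = measure labels ?All + measure labels ?None"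
    using B(3) AllS NoneS by (intro labels.finite_measure_Union) auto
  \<comment> \<open>The two disjoint events have probabilities at least \<open>q - \<delta>\<close>
    and \<open>1 - q - \<delta>\<close>.\<close>
  then have rest: "measure labels rest \<le> 2 * \<delta>"
    unfolding rest_def using p0 p1 AllS NoneS by (subst labels.prob_compl) auto

  \<comment> \<open>The comparison density. Where it is 1 it contributes
    \<open>1 * ln 1 = 0\<close>, so its entropy integral is \<open>conf.kl g\<close> times the
    probability that \<open>B\<close> is visible.\<close>
  define T where "T p = (if B \<subseteq> marks (fst p) then r (snd p) else 1)" for p
  have T_eq: "T p = indicator ?All (fst p) * r (snd p) + (1 - indicator ?All (fst p))" if "p \<in> space ?P" for p
    using spP[OF that] by (auto simp: T_def indicator_def)
  have Tm: "T \<in> borel_measurable ?P"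
  proof -
    have "(\<lambda>p. indicator ?All (fst p) * r (snd p) + (1 - indicator ?All (fst p)) :: real) \<in> borel_measurable ?P"
      using AllS by measurable
    then show ?thesis by (simp add: T_eq cong: measurable_cong)
  qed
  have Tb: "T p \<in> {0..M g}" and skb: "s x \<in> {0..M g}" for p x
    using r(2,3)[of "snd p"] s(2,3)[of x] M1 by (auto simp: T_def less_imp_le)
  have skm: "(\<lambda>p. s (?k p)) \<in> borel_measurable ?P" by (rule pair_measurable[OF sm])
  have diff_int: "integrable ?P (\<lambda>p. \<bar>s (?k p) - T p\<bar>)"
  proof (rule lc.integrable_const_bound[where B="M g"])
    show "AE p in ?P. norm \<bar>s (?k p) - T p\<bar> \<le> M g"
    proof (intro AE_I2)
      fix p show "norm \<bar>s (?k p) - T p\<bar> \<le> M g" using Tb[of p] skb[of "?k p"] by auto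
    qed
  qed (use skm Tm in measurable)
  have e1m: "(\<lambda>\<psi>. indicator A1 \<psi> * \<bar>s \<psi> - hX \<psi>\<bar>) \<in> borel_measurable MX"
    using As sm hXm by measurable
  have e0m: "(\<lambda>\<psi>. indicator A0 \<psi> * \<bar>s \<psi> - 1\<bar>) \<in> borel_measurable MX"
    using As sm by measurable
  have e1i: "integrable ?P (\<lambda>p. indicator A1 (?k p) * \<bar>s (?k p) - hX (?k p)\<bar>)"
  proof (rule Bochner_Integration.integrable_bound)
    show "integrable ?P (\<lambda>p. M g + \<bar>?h (snd p)\<bar>)"
      using integrable_snd(1)[OF h(2)] by auto
    show "AE p in ?P. norm (indicator A1 (?k p) * \<bar>s (?k p) - hX (?k p)\<bar>) \<le> norm (M g + \<bar>?h (snd p)\<bar>)"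
    proof (intro AE_I2)
      fix p assume "p \<in> space ?P"
      then have "hX (?k p) = indicator A1 (?k p) * ?h (snd p)" using hX_mask spP by blast
      then show "norm (indicator A1 (?k p) * \<bar>s (?k p) - hX (?k p)\<bar>) \<le> norm (M g + \<bar>?h (snd p)\<bar>)"
        using sb(1)[of "?k p"] M1 by (auto simp: indicator_def)
    qed
  qed (rule pair_measurable[OF e1m])
  have e0i: "integrable ?P (\<lambda>p. indicator A0 (?k p) * \<bar>s (?k p) - 1\<bar>)"
  proof (rule lc.integrable_const_bound[where B="M g"])
    show "AE p in ?P. norm (indicator A0 (?k p) * \<bar>s (?k p) - 1\<bar>) \<le> M g"
    proof (intro AE_I2)
      fix p show "norm (indicator A0 (?k p) * \<bar>s (?k p) - 1\<bar>) \<le> M g"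
        using skb[of "?k p"] M1 by (auto simp: indicator_def)
    qed
  qed (rule pair_measurable[OF e0m])
  have ri: "integrable ?P (\<lambda>p. indicator rest (fst p) :: real)"
    using restS by (intro lc.integrable_const_bound[where B=1]) (auto simp: indicator_def)
  have "(\<integral>p. \<bar>s (?k p) - T p\<bar> \<partial>?P) \<le>
     (\<integral>p. ((indicator A1 (?k p) * \<bar>s (?k p) - hX (?k p)\<bar> + \<bar>r (snd p) - ?h (snd p)\<bar>)
         + indicator A0 (?k p) * \<bar>s (?k p) - 1\<bar>) + M g * indicator rest (fst p) \<partial>?P)"
  proof (rule integral_mono[OF diff_int])
    show "integrable ?P (\<lambda>p. ((indicator A1 (?k p) * \<bar>s (?k p) - hX (?k p)\<bar> + \<bar>r (snd p) - ?h (snd p)\<bar>)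
         + indicator A0 (?k p) * \<bar>s (?k p) - 1\<bar>) + M g * indicator rest (fst p))"
      by (intro Bochner_Integration.integrable_add e1i e0i rh_pair(1) integrable_mult_right ri)
    fix p assume p: "p \<in> space ?P"
    have U: "fst p \<in> space labels" and \<phi>: "snd p \<in> conf" using spP[OF p] by auto
    consider "B \<subseteq> marks (fst p)" | "B \<inter> marks (fst p) = {}" "\<not> B \<subseteq> marks (fst p)" | "fst p \<in> rest" "\<not> B \<subseteq> marks (fst p)"
      using U by (auto simp: rest_def)
    then show "\<bar>s (?k p) - T p\<bar> \<le> ((indicator A1 (?k p) * \<bar>s (?k p) - hX (?k p)\<bar> + \<bar>r (snd p) - ?h (snd p)\<bar>)
         + indicator A0 (?k p) * \<bar>s (?k p) - 1\<bar>) + M g * indicator rest (fst p)"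
    proof cases
      case 1
      then have "?k p \<in> A1" using A1_iff[OF \<phi>] by blast
      then have "indicator A1 (?k p) * \<bar>s (?k p) - hX (?k p)\<bar> = \<bar>s (?k p) - ?h (snd p)\<bar>"
        using hX_mask[OF \<phi>] by simp
      moreover have "T p = r (snd p)" using 1 by (simp add: T_def)
      moreover have "0 \<le> indicator A0 (?k p) * \<bar>s (?k p) - 1\<bar>" "0 \<le> M g * indicator rest (fst p)"
        using M1 by (auto simp: indicator_def)
      ultimately show ?thesis by linarith
    next
      case 2
      then have "?k p \<in> A0" "?k p \<notin> A1" using A0_iff[OF \<phi>] A1_iff[OF \<phi>] by auto
      moreover have "0 \<le> M g * indicator rest (fst p)" using M1 by (auto simp: indicator_def)
      ultimately show ?thesis using 2 by (simp add: T_def)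
    next
      case 3
      have "\<bar>s (?k p) - 1\<bar> \<le> M g" using skb[of "?k p"] M1 by auto
      moreover have "0 \<le> indicator A0 (?k p) * \<bar>s (?k p) - 1\<bar>" "0 \<le> indicator A1 (?k p) * \<bar>s (?k p) - hX (?k p)\<bar>"
        by (auto simp: indicator_def)
      moreover have "T p = 1" "M g * indicator rest (fst p) = M g" using 3 by (simp_all add: T_def)
      ultimately show ?thesis by linarith
    qed
  qed
  also have "\<dots> = (\<integral>p. indicator A1 (?k p) * \<bar>s (?k p) - hX (?k p)\<bar> \<partial>?P) + (\<integral>p. \<bar>r (snd p) - ?h (snd p)\<bar> \<partial>?P)
     + (\<integral>p. indicator A0 (?k p) * \<bar>s (?k p) - 1\<bar> \<partial>?P) + M g * (\<integral>p. indicator rest (fst p) \<partial>?P)"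
    using e1i e0i rh_pair(1) ri by simp
  also have "(\<integral>p. indicator rest (fst p) \<partial>?P) = measure labels rest"
    using lc.integral_fst'[OF ri] restS sets.sets_into_space[OF restS] by (simp add: conf.prob_space Int_absorb2)
  also have "(\<integral>p. indicator A1 (?k p) * \<bar>s (?k p) - hX (?k p)\<bar> \<partial>?P) = (\<integral>\<psi>. indicator A1 \<psi> * \<bar>s \<psi> - hX \<psi>\<bar> \<partial>\<kappa>)"
    by (rule integral_\<kappa>_pair[OF e1m, symmetric])
  also have "(\<integral>p. indicator A0 (?k p) * \<bar>s (?k p) - 1\<bar> \<partial>?P) = (\<integral>\<psi>. indicator A0 \<psi> * \<bar>s \<psi> - 1\<bar> \<partial>\<kappa>)"
    by (rule integral_\<kappa>_pair[OF e0m, symmetric])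
  also have "(\<integral>p. \<bar>r (snd p) - ?h (snd p)\<bar> \<partial>?P) = (\<integral>\<phi>. \<bar>r \<phi> - ?h \<phi>\<bar> \<partial>\<nu>)"
    by (rule rh_pair(2))
  finally have diff1: "(\<integral>p. \<bar>s (?k p) - T p\<bar> \<partial>?P) \<le>
      (\<integral>\<psi>. indicator A1 \<psi> * \<bar>s \<psi> - hX \<psi>\<bar> \<partial>\<kappa>) + (\<integral>\<phi>. \<bar>r \<phi> - ?h \<phi>\<bar> \<partial>\<nu>)
      + (\<integral>\<psi>. indicator A0 \<psi> * \<bar>s \<psi> - 1\<bar> \<partial>\<kappa>) + M g * measure labels rest" .
  have "M g * measure labels rest \<le> M g * (2 * \<delta>)" using rest M1 by (intro mult_left_mono) auto
  then have diff: "(\<integral>p. \<bar>s (?k p) - T p\<bar> \<partial>?P) \<le> (3 + 2 * M g) * \<delta>"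
    using diff1 E1 E0 h(3) by (simp add: algebra_simps)

  let ?\<Psi> = "\<lambda>x::real. x * ln x"
  \<comment> \<open>Comparison with the value 0 at the point 0 bounds \<open>?\<Psi>\<close> on the
    range of the densities, which gives integrability.\<close>
  have \<Psi>b: "\<bar>?\<Psi> x\<bar> \<le> \<eta> + C * M g" if "x \<in> {0..M g}" for x
  proof -
    have "\<bar>?\<Psi> x - ?\<Psi> 0\<bar> \<le> \<eta> + C * \<bar>x - 0\<bar>" using that M1 by (intro modulus) auto
    moreover have "C * x \<le> C * M g" using that C by (intro mult_left_mono) auto
    ultimately show ?thesis using that by simp
  qed
  have \<Psi>s: "integrable ?P (\<lambda>p. ?\<Psi> (s (?k p)))"
    using \<Psi>b[OF skb] skm by (intro lc.integrable_const_bound[where B="\<eta> + C * M g"]) auto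
  have \<Psi>T: "integrable ?P (\<lambda>p. ?\<Psi> (T p))"
    using \<Psi>b[OF Tb] Tm by (intro lc.integrable_const_bound[where B="\<eta> + C * M g"]) auto
  have \<Psi>sm: "(\<lambda>\<psi>. ?\<Psi> (s \<psi>)) \<in> borel_measurable MX" using sm by measurable
  have klk: "\<kappa>.kl g = (\<integral>p. ?\<Psi> (s (?k p)) \<partial>?P)"
    using \<kappa>.kl_eq[OF s(1) s(2) s_push] integral_\<kappa>_pair[OF \<Psi>sm] by simp
  have klc: "conf.kl g = (\<integral>\<phi>. ?\<Psi> (r \<phi>) \<partial>\<nu>)"
    by (rule conf.kl_eq[OF r(1) r(2) r(4)])
  have "(\<integral>p. ?\<Psi> (T p) \<partial>?P) = (\<integral>p. indicator ?All (fst p) * ?\<Psi> (r (snd p)) \<partial>?P)"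
  proof (intro Bochner_Integration.integral_cong refl)
    fix p assume "p \<in> space ?P"
    then show "?\<Psi> (T p) = indicator ?All (fst p) * ?\<Psi> (r (snd p))"
      using spP(1)[of p] by (simp add: T_def indicator_def)
  qed
  also have "\<dots> = (\<integral>U. \<integral>\<phi>. indicator ?All U * ?\<Psi> (r \<phi>) \<partial>\<nu> \<partial>labels)"
  proof -
    have "integrable ?P (\<lambda>p. indicator ?All (fst p) * ?\<Psi> (r (snd p)))"
    proof (rule lc.integrable_const_bound[where B="\<eta> + C * M g"])
      show "AE p in ?P. norm (indicator ?All (fst p) * ?\<Psi> (r (snd p))) \<le> \<eta> + C * M g"
      proof (intro AE_I2)
        fix p :: "('g \<Rightarrow> real) \<times> ('g \<Rightarrow> 'l)"
        have "r (snd p) \<in> {0..M g}" using r(2,3)[of "snd p"] by (auto simp: less_imp_le)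
        from \<Psi>b[OF this] show "norm (indicator ?All (fst p) * ?\<Psi> (r (snd p))) \<le> \<eta> + C * M g"
          by (auto simp: indicator_def)
      qed
    qed (use AllS in measurable)
    from lc.integral_fst'[OF this] show ?thesis by simp
  qed
  also have "\<dots> = measure labels ?All * conf.kl g"
    using AllS by (simp add: klc[symmetric] Int_absorb2 Collect_restrict)
  finally have klT: "(\<integral>p. ?\<Psi> (T p) \<partial>?P) = measure labels ?All * conf.kl g" .
  have "\<bar>\<kappa>.kl g - measure labels ?All * conf.kl g\<bar> = \<bar>\<integral>p. ?\<Psi> (s (?k p)) - ?\<Psi> (T p) \<partial>?P\<bar>"
    unfolding klk klT[symmetric] using \<Psi>s \<Psi>T by simp
  also have "\<dots> \<le> (\<integral>p. \<bar>?\<Psi> (s (?k p)) - ?\<Psi> (T p)\<bar> \<partial>?P)" by (rule integral_abs_bound)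
  also have "\<dots> \<le> (\<integral>p. \<eta> + C * \<bar>s (?k p) - T p\<bar> \<partial>?P)"
  proof (rule integral_mono)
    show "integrable ?P (\<lambda>p. \<bar>?\<Psi> (s (?k p)) - ?\<Psi> (T p)\<bar>)" using \<Psi>s \<Psi>T by auto
    show "integrable ?P (\<lambda>p. \<eta> + C * \<bar>s (?k p) - T p\<bar>)" using diff_int by auto
  qed (rule modulus[OF skb Tb])
  also have "\<dots> = \<eta> + C * (\<integral>p. \<bar>s (?k p) - T p\<bar> \<partial>?P)"
    using diff_int by (simp add: lc.prob_space)
  also have "\<dots> \<le> \<eta> + C * ((3 + 2 * M g) * \<delta>)"
    using diff C by (intro add_left_mono mult_left_mono)
  finally have 1: "\<bar>\<kappa>.kl g - measure labels ?All * conf.kl g\<bar> \<le> \<eta> + C * ((3 + 2 * M g) * \<delta>)" .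
  have "\<bar>measure labels ?All * conf.kl g - q * conf.kl g\<bar> = conf.kl g * \<bar>measure labels ?All - q\<bar>"
    unfolding left_diff_distrib[symmetric] abs_mult using conf.kl_bounds(1)[OF g] by simp
  also have "\<dots> \<le> conf.kl g * \<delta>" using p1 conf.kl_bounds(1)[OF g] by (intro mult_left_mono)
  finally show ?thesis using 1 by linarith
qed

end

section \<open>Choice of the mask and averaging over the group\<close>

context Liouville_lamplighter
begin

abbreviation "masked_kl K t m \<equiv>
  stationary_action.kl (masked_lamplighter.\<kappa> L \<Gamma> \<mu> K t m) (masked_lamplighter.mact L \<Gamma>)"

lemma masked_lamplighterI: "finite K \<Longrightarrow> K \<subseteq> carrier \<Gamma> \<Longrightarrow> masked_lamplighter L \<Gamma> \<mu> K"
  by (intro masked_lamplighter.intro masked_lamplighter_axioms.intro Liouville_lamplighter_axioms)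

text \<open>The order of the quantifiers matters: \<delta> and \<open>B\<close> depend on
  \<open>g\<close> and \<open>e\<close> only and precede the mask, so that one mask can serve
  finitely many \<open>g\<close>. \<open>B\<close> joins the set outside which the translates are
  indistinguishable and the coordinates on which the density is approximated.\<close>

lemma kl_approx:
  assumes g: "g \<in> set_pmf \<mu>" and e: "e > 0"
  shows "\<exists>\<delta>>0. \<exists>B. finite B \<and> B \<subseteq> carrier \<Gamma> \<and> (\<forall>K t m q B'.
    finite K \<longrightarrow> K \<subseteq> carrier \<Gamma> \<longrightarrow> finite B' \<longrightarrow> B' \<subseteq> carrier \<Gamma> \<longrightarrow> B' \<noteq> {} \<longrightarrow> B \<subseteq> B' \<longrightarrow>
    1 - q - \<delta> \<le> measure base.labels {U \<in> space base.labels. B' \<inter> base.marked K t m U = {}} \<longrightarrow>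
    \<bar>measure base.labels {U \<in> space base.labels. B' \<subseteq> base.marked K t m U} - q\<bar> \<le> \<delta> \<longrightarrow>
    \<bar>masked_kl K t m g - q * conf.kl g\<bar> \<le> e)"
proof -
  define M where "M = 1 / pmf \<mu> g"
  have M0: "M > 0" using pmf_positive[OF g] by (simp add: M_def)
  have gG: "g \<in> carrier G" using g conf.set_pmf_subset by blast
  obtain r where r: "r \<in> borel_measurable \<nu>" "\<And>x. 0 < r x" "\<And>x. r x \<le> 1 / pmf \<mu> g"
    "push act g \<nu> = density \<nu> (\<lambda>x. ennreal (r x))"
    using conf.push_density[OF g] by blast
  have "e / 2 > 0" using e by simp
  obtain C where C: "C \<ge> 0" "\<And>x y. x \<in> {0..M} \<Longrightarrow> y \<in> {0..M} \<Longrightarrow> \<bar>x * ln x - y * ln y\<bar> \<le> e / 2 + C * \<bar>x - y\<bar>"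
    using mult_ln_modulus[OF \<open>e / 2 > 0\<close>, of M] by blast
  \<comment> \<open>The errors of \<open>kl_estimate\<close> other than \<open>e / 2\<close> amount
    to \<open>(A - 1) * \<delta>\<close>, and \<delta> is chosen with
    \<open>A * \<delta> = e / 2\<close>; the summand 1 makes \<open>A\<close> positive.\<close>
  define A where "A = C * (3 + 2 * M) + conf.kl g + 1"
  have A: "A > 0" unfolding A_def using C(1) M0 conf.kl_bounds(1)[OF g] by (intro add_nonneg_pos add_nonneg_nonneg mult_nonneg_nonneg) auto
  define \<delta> where "\<delta> = e / (2 * A)"
  have \<delta>: "\<delta> > 0" using e A by (simp add: \<delta>_def)
  have A\<delta>: "A * \<delta> = e / 2" using A by (simp add: \<delta>_def)
  from translates_agree_far_away[OF gG \<delta>] obtain B1 where B1: "finite B1" "B1 \<subseteq> carrier \<Gamma>"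
    and far0: "\<forall>f\<in>borel_measurable CX. (\<forall>\<phi>. \<bar>f \<phi>\<bar> \<le> 1) \<longrightarrow>
      (\<forall>\<phi>\<in>conf. \<forall>\<psi>\<in>conf. (\<forall>x\<in>carrier \<Gamma> - B1. \<phi> x = \<psi> x) \<longrightarrow> f \<phi> = f \<psi>) \<longrightarrow>
      \<bar>(\<integral>\<phi>. f (act g \<phi>) \<partial>\<nu>) - (\<integral>\<phi>. f \<phi> \<partial>\<nu>)\<bar> \<le> \<delta>"
    by (elim exE conjE)
  have far: "\<bar>(\<integral>\<phi>. f (act g \<phi>) \<partial>\<nu>) - (\<integral>\<phi>. f \<phi> \<partial>\<nu>)\<bar> \<le> \<delta>"
    if "f \<in> borel_measurable CX" "\<And>\<phi>. \<bar>f \<phi>\<bar> \<le> 1"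
      "\<And>\<phi> \<psi>. \<phi> \<in> conf \<Longrightarrow> \<psi> \<in> conf \<Longrightarrow> (\<And>x. x \<in> carrier \<Gamma> - B1 \<Longrightarrow> \<phi> x = \<psi> x) \<Longrightarrow> f \<phi> = f \<psi>"
    for f :: "('g \<Rightarrow> 'l) \<Rightarrow> real"
  proof (rule far0[THEN bspec, OF that(1), THEN mp, THEN mp])
    show "\<forall>\<phi>. \<bar>f \<phi>\<bar> \<le> 1" by (rule allI) (rule that(2))
    show "\<forall>\<phi>\<in>conf. \<forall>\<psi>\<in>conf. (\<forall>x\<in>carrier \<Gamma> - B1. \<phi> x = \<psi> x) \<longrightarrow> f \<phi> = f \<psi>"
    proof (intro ballI impI)
      fix \<phi> \<psi> assume c: "\<phi> \<in> conf" "\<psi> \<in> conf" and eq: "\<forall>x\<in>carrier \<Gamma> - B1. \<phi> x = \<psi> x"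
      show "f \<phi> = f \<psi>" by (rule that(3)[OF c]) (rule bspec[OF eq])
    qed
  qed
  have rint: "integrable \<nu> r" using conf.density_integral_1(1)[OF gG r(1) less_imp_le[OF r(2)] r(4)] .
  have "cylinder_approximable (carrier \<Gamma>) (count_space (carrier L)) \<nu> r"
    by (rule cylinder_approximableI[OF _ _ rint]) (simp_all add: conf.finite_measure_axioms sets_\<nu>)
  then obtain B2 h where B2: "finite B2" "B2 \<subseteq> carrier \<Gamma>" and h: "h \<in> borel_measurable (Pi\<^sub>M B2 (\<lambda>_. count_space (carrier L)))"
    "integrable \<nu> (\<lambda>x. h (restrict x B2))" "(\<integral>x. \<bar>r x - h (restrict x B2)\<bar> \<partial>\<nu>) < \<delta>"
    using \<delta> unfolding cylinder_approximable_def by blast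
  have "\<bar>masked_kl K t m g - q * conf.kl g\<bar> \<le> e"
    if K: "finite K" "K \<subseteq> carrier \<Gamma>" and B': "finite B'" "B' \<subseteq> carrier \<Gamma>" "B' \<noteq> {}" "B1 \<union> B2 \<subseteq> B'"
      and p0: "1 - q - \<delta> \<le> measure base.labels {U \<in> space base.labels. B' \<inter> base.marked K t m U = {}}"
      and p1: "\<bar>measure base.labels {U \<in> space base.labels. B' \<subseteq> base.marked K t m U} - q\<bar> \<le> \<delta>"
    for K t m q B'
  proof -
    interpret masked_lamplighter L \<Gamma> \<mu> K t m by (rule masked_lamplighterI[OF K])
    have restr: "restrict (restrict \<phi> B') B2 = restrict \<phi> B2" for \<phi> :: "'g \<Rightarrow> 'l"
      using B'(4) by (simp add: Int_absorb1 restrict_restrict)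
    have "\<bar>\<kappa>.kl g - q * conf.kl g\<bar> \<le> e / 2 + C * ((3 + 2 * (1 / pmf \<mu> g)) * \<delta>) + conf.kl g * \<delta>"
    proof (rule kl_estimate[OF g B'(1-3), where h="\<lambda>\<phi>. h (restrict \<phi> B2)"])
      fix f :: "_ \<Rightarrow> real" assume f: "f \<in> borel_measurable CX" "\<And>\<phi>. \<bar>f \<phi>\<bar> \<le> 1"
        and ff: "\<And>\<phi> \<psi>. \<phi> \<in> conf \<Longrightarrow> \<psi> \<in> conf \<Longrightarrow> (\<And>x. x \<in> carrier \<Gamma> - B' \<Longrightarrow> \<phi> x = \<psi> x) \<Longrightarrow> f \<phi> = f \<psi>"
      show "\<bar>(\<integral>\<phi>. f (act g \<phi>) \<partial>\<nu>) - (\<integral>\<phi>. f \<phi> \<partial>\<nu>)\<bar> \<le> \<delta>"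
      proof (rule far[OF f])
        \<comment> \<open>A function that ignores the coordinates in \<open>B'\<close> also ignores
          those in the smaller set \<open>B1\<close>.\<close>
        fix \<phi> \<psi> assume c: "\<phi> \<in> conf" "\<psi> \<in> conf" "\<And>x. x \<in> carrier \<Gamma> - B1 \<Longrightarrow> \<phi> x = \<psi> x"
        show "f \<phi> = f \<psi>" by (rule ff[OF c(1,2)]) (use c(3) B'(4) in auto)
      qed
    next
      show "(\<lambda>\<phi>. h (restrict \<phi> B2)) \<in> borel_measurable (Pi\<^sub>M B' (\<lambda>_. count_space (carrier L)))"
        using B'(4) by (intro measurable_compose[OF measurable_restrict_subset h(1)]) auto
      show "integrable \<nu> (\<lambda>\<phi>. h (restrict (restrict \<phi> B') B2))" unfolding restr by (rule h(2))
      show "(\<integral>\<phi>. \<bar>r \<phi> - h (restrict (restrict \<phi> B') B2)\<bar> \<partial>\<nu>) \<le> \<delta>" unfolding restr using h(3) by simp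
      show "\<bar>x * ln x - y * ln y\<bar> \<le> e / 2 + C * \<bar>x - y\<bar>" if "x \<in> {0..1 / pmf \<mu> g}" "y \<in> {0..1 / pmf \<mu> g}" for x y
        using C(2) that by (simp add: M_def)
    qed (fact r p0 p1 C(1))+
    also have "\<dots> = e / 2 + (A - 1) * \<delta>"
      by (simp add: A_def M_def algebra_simps)
    also have "\<dots> \<le> e"
      using A\<delta> \<delta> by (simp add: left_diff_distrib)
    finally show ?thesis .
  qed
  then show ?thesis
    using \<delta> B1 B2 by (intro exI[of _ \<delta>] conjI exI[of _ "B1 \<union> B2"]) auto
qed

text \<open>Finitely many \<open>g\<close> carry all but \<open>e / 2\<close> of the integral of
  \<open>- ln (pmf \<mu> g)\<close>, and the mask is adapted to them. For the other \<open>g\<close>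
  both relative entropies lie between 0 and \<open>- ln (pmf \<mu> g)\<close>, so their difference
  is absorbed by the tail.\<close>

lemma entropy_realized_near:
  assumes inf: "infinite (carrier \<Gamma>)" and fin: "pmf_entropy \<mu> < \<infinity>" and q: "0 < q" "q < 1" and e: "e > 0"
  shows "\<exists>(\<nu>' :: real measure) act'. stationary_space G \<mu> \<nu>' act' \<and> ergodic_action G \<nu>' act' \<and>
    \<bar>furstenberg_entropy G \<mu> \<nu>' act' - q * config_entropy L \<Gamma> \<mu>\<bar> \<le> e"
proof -
  note ent = conf.furstenberg_entropy_eq[OF fin]
  let ?l = "\<lambda>g. - ln (pmf \<mu> g)"
  define A where "A n = {g \<in> carrier G. to_nat_on (carrier G) g < n}" for n
  have finA: "finite (A n)" for n unfolding A_def by (rule finite_to_nat_on_less[OF countable_G])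
  have "(\<lambda>n. measure_pmf.expectation \<mu> (\<lambda>g. indicator (- A n) g * ?l g)) \<longlonglongrightarrow> measure_pmf.expectation \<mu> (\<lambda>g. 0)"
  proof (rule integral_dominated_convergence[where w="\<lambda>g. \<bar>?l g\<bar>"])
    show "AE g in measure_pmf \<mu>. (\<lambda>n. indicator (- A n) g * ?l g) \<longlonglongrightarrow> 0"
      using conf.AE_carrier
    proof eventually_elim
      case (elim g)
      have "\<forall>\<^sub>F n in sequentially. indicator (- A n) g * ?l g = 0"
        unfolding eventually_sequentially A_def using elim
        by (intro exI[of _ "Suc (to_nat_on (carrier G) g)"]) (auto simp: indicator_def)
      then show ?case by (rule tendsto_eventually)
    qed
    show "AE g in measure_pmf \<mu>. norm (indicator (- A n) g * ?l g) \<le> \<bar>?l g\<bar>" for n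
      by (intro AE_I2) (auto simp: indicator_def)
  qed (use ent(1) in auto)
  then have "\<forall>\<^sub>F n in sequentially. measure_pmf.expectation \<mu> (\<lambda>g. indicator (- A n) g * ?l g) < e / 2"
    using e by (intro order_tendstoD(2)) auto
  then obtain n where n: "measure_pmf.expectation \<mu> (\<lambda>g. indicator (- A n) g * ?l g) < e / 2"
    by (auto simp: eventually_sequentially)
  let ?T = "A n \<inter> set_pmf \<mu>"
  have "\<forall>g\<in>?T. \<exists>\<delta> B. \<delta> > 0 \<and> finite B \<and> B \<subseteq> carrier \<Gamma> \<and> (\<forall>K t m q B'.
    finite K \<longrightarrow> K \<subseteq> carrier \<Gamma> \<longrightarrow> finite B' \<longrightarrow> B' \<subseteq> carrier \<Gamma> \<longrightarrow> B' \<noteq> {} \<longrightarrow> B \<subseteq> B' \<longrightarrow>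
    1 - q - \<delta> \<le> measure base.labels {U \<in> space base.labels. B' \<inter> base.marked K t m U = {}} \<longrightarrow>
    \<bar>measure base.labels {U \<in> space base.labels. B' \<subseteq> base.marked K t m U} - q\<bar> \<le> \<delta> \<longrightarrow>
    \<bar>masked_kl K t m g - q * conf.kl g\<bar> \<le> e / 2)"
    using kl_approx[of _ "e / 2"] e by fastforce
  from bchoice[OF this] obtain \<delta> where "\<forall>g\<in>?T. \<exists>B. \<delta> g > 0 \<and> finite B \<and> B \<subseteq> carrier \<Gamma> \<and> (\<forall>K t m q B'.
    finite K \<longrightarrow> K \<subseteq> carrier \<Gamma> \<longrightarrow> finite B' \<longrightarrow> B' \<subseteq> carrier \<Gamma> \<longrightarrow> B' \<noteq> {} \<longrightarrow> B \<subseteq> B' \<longrightarrow>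
    1 - q - \<delta> g \<le> measure base.labels {U \<in> space base.labels. B' \<inter> base.marked K t m U = {}} \<longrightarrow>
    \<bar>measure base.labels {U \<in> space base.labels. B' \<subseteq> base.marked K t m U} - q\<bar> \<le> \<delta> g \<longrightarrow>
    \<bar>masked_kl K t m g - q * conf.kl g\<bar> \<le> e / 2)" ..
  from bchoice[OF this] obtain B where "\<forall>g\<in>?T. \<delta> g > 0 \<and> finite (B g) \<and> B g \<subseteq> carrier \<Gamma> \<and> (\<forall>K t m q B'.
    finite K \<longrightarrow> K \<subseteq> carrier \<Gamma> \<longrightarrow> finite B' \<longrightarrow> B' \<subseteq> carrier \<Gamma> \<longrightarrow> B' \<noteq> {} \<longrightarrow> B g \<subseteq> B' \<longrightarrow>
    1 - q - \<delta> g \<le> measure base.labels {U \<in> space base.labels. B' \<inter> base.marked K t m U = {}} \<longrightarrow>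
    \<bar>measure base.labels {U \<in> space base.labels. B' \<subseteq> base.marked K t m U} - q\<bar> \<le> \<delta> g \<longrightarrow>
    \<bar>masked_kl K t m g - q * conf.kl g\<bar> \<le> e / 2)" ..
  note \<delta>B = this[THEN bspec]
  \<comment> \<open>One tolerance for all relevant \<open>g\<close>; the 1 keeps the minimum defined
    should there be none.\<close>
  define \<eta> where "\<eta> = Min (insert 1 (\<delta> ` ?T))"
  have \<eta>: "\<eta> > 0" "\<And>g. g \<in> ?T \<Longrightarrow> \<eta> \<le> \<delta> g"
    unfolding \<eta>_def using finA[of n] \<delta>B by (auto simp: Min_gr_iff)
  \<comment> \<open>The identity is added only to make the set nonempty.\<close>
  define B' where "B' = insert \<one>\<^bsub>\<Gamma>\<^esub> (\<Union>g\<in>?T. B g)"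
  have B': "finite B'" "B' \<subseteq> carrier \<Gamma>" "B' \<noteq> {}" "\<And>g. g \<in> ?T \<Longrightarrow> B g \<subseteq> B'"
  proof -
    have "finite (\<Union>g\<in>?T. B g)" using finA[of n] \<delta>B by (intro finite_UN_I) auto
    then show "finite B'" by (simp add: B'_def)
    have "(\<Union>g\<in>?T. B g) \<subseteq> carrier \<Gamma>" using \<delta>B by (intro UN_least) simp
    then show "B' \<subseteq> carrier \<Gamma>" by (simp add: B'_def)
    show "B' \<noteq> {}" by (simp add: B'_def)
    show "B g \<subseteq> B'" if "g \<in> ?T" for g using that unfolding B'_def by (intro subset_insertI2 UN_upper)
  qed
  obtain K t and m :: "'g \<Rightarrow> real" where K: "finite K" "K \<subseteq> carrier \<Gamma>"
    and p0: "1 - q - \<eta> \<le> measure base.labels {U \<in> space base.labels. B' \<inter> base.marked K t m U = {}}"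
    and p1: "\<bar>measure base.labels {U \<in> space base.labels. B' \<subseteq> base.marked K t m U} - q\<bar> \<le> \<eta>"
    using base.marked_all_or_nothing[OF q B'(1-3) \<eta>(1)] by blast
  interpret masked_lamplighter L \<Gamma> \<mu> K t m by (rule masked_lamplighterI[OF K])
  have near: "\<bar>\<kappa>.kl g - q * conf.kl g\<bar> \<le> e / 2" if g: "g \<in> ?T" for g
  proof -
    have "1 - q - \<delta> g \<le> measure base.labels {U \<in> space base.labels. B' \<inter> base.marked K t m U = {}}"
      using p0 \<eta>(2)[OF g] by linarith
    moreover have "\<bar>measure base.labels {U \<in> space base.labels. B' \<subseteq> base.marked K t m U} - q\<bar> \<le> \<delta> g"
      using p1 \<eta>(2)[OF g] by linarith
    ultimately show ?thesis
      using \<delta>B[OF g, THEN conjunct2, THEN conjunct2, THEN conjunct2, rule_format, OF K B'(1-3) B'(4)[OF g]] by blast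
  qed
  have klint: "integrable (measure_pmf \<mu>) \<kappa>.kl" "integrable (measure_pmf \<mu>) conf.kl"
  proof -
    show "integrable (measure_pmf \<mu>) \<kappa>.kl"
    proof (rule Bochner_Integration.integrable_bound[OF ent(1)])
      show "AE g in measure_pmf \<mu>. norm (\<kappa>.kl g) \<le> norm (?l g)"
        unfolding AE_measure_pmf_iff
      proof
        fix g assume "g \<in> set_pmf \<mu>"
        from \<kappa>.kl_bounds[OF this] show "norm (\<kappa>.kl g) \<le> norm (?l g)" by simp
      qed
    qed simp
    show "integrable (measure_pmf \<mu>) conf.kl"
    proof (rule Bochner_Integration.integrable_bound[OF ent(1)])
      show "AE g in measure_pmf \<mu>. norm (conf.kl g) \<le> norm (?l g)"
        unfolding AE_measure_pmf_iff
      proof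
        fix g assume "g \<in> set_pmf \<mu>"
        from conf.kl_bounds[OF this] show "norm (conf.kl g) \<le> norm (?l g)" by simp
      qed
    qed simp
  qed
  have tail_int: "integrable (measure_pmf \<mu>) (\<lambda>g. indicator (- A n) g * ?l g)"
    by (rule Bochner_Integration.integrable_bound[OF ent(1)]) (auto simp: indicator_def)
  have "\<bar>furstenberg_entropy G \<mu> \<kappa> mact - q * config_entropy L \<Gamma> \<mu>\<bar> =
      \<bar>measure_pmf.expectation \<mu> (\<lambda>g. \<kappa>.kl g - q * conf.kl g)\<bar>"
    unfolding config_entropy_def ent(2) \<kappa>.furstenberg_entropy_eq(2)[OF fin] using klint by simp
  also have "\<dots> \<le> measure_pmf.expectation \<mu> (\<lambda>g. \<bar>\<kappa>.kl g - q * conf.kl g\<bar>)"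
    by (rule integral_abs_bound)
  also have "\<dots> \<le> measure_pmf.expectation \<mu> (\<lambda>g. e / 2 + indicator (- A n) g * ?l g)"
  proof (rule integral_mono_AE)
    show "AE g in measure_pmf \<mu>. \<bar>\<kappa>.kl g - q * conf.kl g\<bar> \<le> e / 2 + indicator (- A n) g * ?l g"
      unfolding AE_measure_pmf_iff
    proof
      fix g assume g: "g \<in> set_pmf \<mu>"
      show "\<bar>\<kappa>.kl g - q * conf.kl g\<bar> \<le> e / 2 + indicator (- A n) g * ?l g"
      proof (cases "g \<in> A n")
        case True
        then show ?thesis using near[of g] g by simp
      next
        case False
        have "0 \<le> q * conf.kl g" using q conf.kl_bounds(1)[OF g] by simp
        moreover have "q * conf.kl g \<le> 1 * conf.kl g" using q conf.kl_bounds(1)[OF g] by (intro mult_right_mono) auto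
        ultimately have "\<bar>\<kappa>.kl g - q * conf.kl g\<bar> \<le> ?l g"
          using conf.kl_bounds[OF g] \<kappa>.kl_bounds[OF g] by linarith
        then show ?thesis using False e by simp
      qed
    qed
  qed (use klint tail_int in auto)
  also have "\<dots> = e / 2 + measure_pmf.expectation \<mu> (\<lambda>g. indicator (- A n) g * ?l g)"
    using tail_int by simp
  also have "\<dots> \<le> e" using n by simp
  finally have close: "\<bar>furstenberg_entropy G \<mu> \<kappa> mact - q * config_entropy L \<Gamma> \<mu>\<bar> \<le> e" .
  have sb: "standard_borel \<kappa>"
    by (rule standard_borel_PiM_count_space[OF countable_\<Gamma> countable_values sets_\<kappa>])
  obtain emb :: "('g \<Rightarrow> 'l option) \<Rightarrow> real" where "inj_on emb mconf"
    using PiE_countable_embedding[OF countable_\<Gamma> countable_values] by blast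
  then have "inj_on emb (space \<kappa>)" by (simp add: space_\<kappa>)
  from \<kappa>.embed_real[OF sb this ergodic_\<kappa>[OF inf] fin] obtain \<nu>' :: "real measure" and act'
    where \<nu>': "stationary_space G \<mu> \<nu>' act'" "ergodic_action G \<nu>' act'"
      "furstenberg_entropy G \<mu> \<nu>' act' = furstenberg_entropy G \<mu> \<kappa> mact"
    by (elim exE conjE)
  show ?thesis
    by (intro exI[of _ \<nu>'] exI[of _ act'] conjI \<nu>'(1,2)) (use close in \<open>simp only: \<nu>'(3)\<close>)
qed

end

text \<open>Over a finite base the configurations form a countable homogeneous space, on which a stationary
  probability is uniform by the maximum principle.\<close>

lemma (in lamplighter_walk) finite_base_invariant:
  assumes fin: "finite (carrier \<Gamma>)" and g: "g \<in> carrier G"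
  shows "push act g \<nu> = \<nu>"
proof -
  have count: "countable conf" using fin countable_L by (intro countable_PiE) auto
  have single: "{\<phi>} \<in> sets CX" if "\<phi> \<in> conf" for \<phi>
  proof -
    have "{\<phi>} = (\<Pi>\<^sub>E x\<in>carrier \<Gamma>. {\<phi> x})" using that by (intro PiE_singleton[symmetric]) (simp add: PiE_iff)
    moreover have "(\<Pi>\<^sub>E x\<in>carrier \<Gamma>. {\<phi> x}) \<in> sets CX"
      using fin that by (intro sets_PiM_I_finite) auto
    ultimately show ?thesis by simp
  qed
  have setsP: "sets \<nu> = Pow conf"
  proof
    show "sets \<nu> \<subseteq> Pow conf" using sets.sets_into_space[of _ \<nu>] by (auto simp: space_\<nu>)
    show "Pow conf \<subseteq> sets \<nu>"
    proof
      fix D assume "D \<in> Pow conf"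
      then have "(\<Union>\<phi>\<in>D. {\<phi>}) \<in> sets \<nu>"
        using count single by (intro sets.countable_UN'') (auto simp: sets_\<nu> intro: countable_subset)
      then show "D \<in> sets \<nu>" by simp
    qed
  qed
  define w where "w \<phi> = measure \<nu> {\<phi>}" for \<phi>
  have vim: "act s -` {\<phi>} \<inter> conf = {act (inv\<^bsub>G\<^esub> s) \<phi>}" if "s \<in> carrier G" "\<phi> \<in> conf" for s \<phi>
    using that conf.act_inv[of s] conf.act_inv'[of s \<phi>] conf.act_space[of "inv\<^bsub>G\<^esub> s" \<phi>] by (auto simp: space_\<nu>)
  have w_avg: "w \<phi> = measure_pmf.expectation \<mu> (\<lambda>s. w (act (inv\<^bsub>G\<^esub> s) \<phi>))" if \<phi>: "\<phi> \<in> conf" for \<phi>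
  proof -
    have "w \<phi> = measure_pmf.expectation \<mu> (\<lambda>s. measure \<nu> (act s -` {\<phi>} \<inter> conf))"
      unfolding w_def using conf.stationary[of "{\<phi>}"] \<phi> by (simp add: setsP space_\<nu>)
    also have "\<dots> = measure_pmf.expectation \<mu> (\<lambda>s. w (act (inv\<^bsub>G\<^esub> s) \<phi>))"
      using set_pmf_carrier \<phi> vim by (intro integral_cong_AE) (auto simp: AE_measure_pmf_iff w_def)
    finally show ?thesis .
  qed
  \<comment> \<open>A probability on a countable set has an atom.\<close>
  have "\<exists>\<phi>0\<in>conf. w \<phi>0 > 0"
  proof (rule ccontr)
    assume neg: "\<not> (\<exists>\<phi>0\<in>conf. w \<phi>0 > 0)"
    have "{\<phi>} \<in> null_sets \<nu>" if \<phi>: "\<phi> \<in> conf" for \<phi>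
    proof (rule null_setsI)
      have "w \<phi> = 0"
        using neg \<phi> measure_nonneg[of \<nu> "{\<phi>}"] unfolding w_def
        by (metis order.not_eq_order_implies_strict)
      then show "emeasure \<nu> {\<phi>} = 0" by (simp add: w_def conf.emeasure_eq_measure)
      show "{\<phi>} \<in> sets \<nu>" using \<phi> by (simp add: setsP)
    qed
    then have "(\<Union>\<phi>\<in>conf. {\<phi>}) \<in> null_sets \<nu>" by (rule null_sets_UN'[OF count])
    then have "emeasure \<nu> (space \<nu>) = 0" by (simp add: space_\<nu> null_setsD1)
    then show False using conf.emeasure_space_1 by simp
  qed
  then obtain \<phi>0 where \<phi>0: "\<phi>0 \<in> conf" "w \<phi>0 > 0" by blast
  \<comment> \<open>At most \<open>1 / w \<phi>0\<close> configurations can weigh as much as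
    \<open>w \<phi>0\<close>, so a largest weight exists.\<close>
  have "finite {\<phi> \<in> conf. w \<phi>0 \<le> w \<phi>}"
  proof (rule ccontr)
    assume "infinite {\<phi> \<in> conf. w \<phi>0 \<le> w \<phi>}"
    from infinite_arbitrarily_large[OF this, of "Suc (nat \<lceil>1 / w \<phi>0\<rceil>)"]
    obtain F where F: "finite F" "card F = Suc (nat \<lceil>1 / w \<phi>0\<rceil>)" "F \<subseteq> {\<phi> \<in> conf. w \<phi>0 \<le> w \<phi>}"
      by (elim exE conjE)
    have "1 < real (card F) * w \<phi>0"
    proof -
      have "1 / w \<phi>0 < real (card F)" unfolding F(2) by linarith
      then show ?thesis using \<phi>0 by (simp add: field_simps)
    qed
    also have "\<dots> \<le> (\<Sum>\<phi>\<in>F. w \<phi>)" using F by (intro sum_bounded_below) auto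
    also have "\<dots> = measure \<nu> F"
      using F unfolding w_def by (intro conf.finite_measure_eq_sum_singleton[symmetric]) (auto simp: setsP)
    finally show False using conf.prob_le_1[of F] by simp
  qed
  then obtain \<phi>1 where \<phi>1: "\<phi>1 \<in> conf" "\<And>\<phi>. \<phi> \<in> conf \<Longrightarrow> w \<phi> \<le> w \<phi>1"
  proof -
    assume fin0: "finite {\<phi> \<in> conf. w \<phi>0 \<le> w \<phi>}"
    obtain \<phi>1 where m: "\<phi>1 \<in> {\<phi> \<in> conf. w \<phi>0 \<le> w \<phi>}" "\<And>\<phi>. \<phi> \<in> {\<phi> \<in> conf. w \<phi>0 \<le> w \<phi>} \<Longrightarrow> w \<phi> \<le> w \<phi>1"
    proof -
      have "Max (w ` {\<phi> \<in> conf. w \<phi>0 \<le> w \<phi>}) \<in> w ` {\<phi> \<in> conf. w \<phi>0 \<le> w \<phi>}"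
        using fin0 \<phi>0 by (intro Max_in) auto
      then obtain \<phi>1 where "\<phi>1 \<in> {\<phi> \<in> conf. w \<phi>0 \<le> w \<phi>}" "w \<phi>1 = Max (w ` {\<phi> \<in> conf. w \<phi>0 \<le> w \<phi>})" by auto
      then show ?thesis using fin0 by (intro that[of \<phi>1]) auto
    qed
    show ?thesis
    proof (rule that[of \<phi>1])
      fix \<phi> assume "\<phi> \<in> conf"
      then show "w \<phi> \<le> w \<phi>1" using m by (cases "w \<phi>0 \<le> w \<phi>") auto
    qed (use m in simp)
  qed
  \<comment> \<open>Maximum principle: a maximal weight is an average of weights that do not exceed
    it, so those over the support of \<mu> equal it; this propagates through the semigroup they
    generate.\<close>
  have maxed: "w (act (inv\<^bsub>G\<^esub> h) \<phi>) = w \<phi>1" if "h \<in> carrier G" "\<phi> \<in> conf" "w \<phi> = w \<phi>1" for h \<phi>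
    using that
  proof (induction arbitrary: \<phi> rule: conf.generating_induct)
    case (incl s)
    have inC: "act (inv\<^bsub>G\<^esub> u) \<phi> \<in> conf" if "u \<in> carrier G" for u
      using conf.act_space[of "inv\<^bsub>G\<^esub> u" \<phi>] that incl by (simp add: space_\<nu>)
    have wb: "integrable (measure_pmf \<mu>) (\<lambda>u. w (act (inv\<^bsub>G\<^esub> u) \<phi>))"
      unfolding w_def by (intro measure_pmf.integrable_const_bound[where B=1]) auto
    have "AE u in measure_pmf \<mu>. w \<phi>1 - w (act (inv\<^bsub>G\<^esub> u) \<phi>) = 0"
    proof (subst integral_nonneg_eq_0_iff_AE[symmetric])
      show "measure_pmf.expectation \<mu> (\<lambda>u. w \<phi>1 - w (act (inv\<^bsub>G\<^esub> u) \<phi>)) = 0"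
        using wb w_avg[OF incl(2)] incl(3) by simp
      show "AE u in measure_pmf \<mu>. 0 \<le> w \<phi>1 - w (act (inv\<^bsub>G\<^esub> u) \<phi>)"
        using conf.AE_carrier
      proof eventually_elim
        case (elim u)
        from \<phi>1(2)[OF inC[OF elim]] show ?case by simp
      qed
    qed (use wb in simp)
    then show ?case using incl(1) by (simp add: AE_measure_pmf_iff)
  next
    case (mult a b)
    have "act (inv\<^bsub>G\<^esub> a) \<phi> \<in> conf" using conf.act_space[of "inv\<^bsub>G\<^esub> a" \<phi>] mult.hyps mult.prems by (simp add: space_\<nu>)
    moreover have "act (inv\<^bsub>G\<^esub> (a \<otimes>\<^bsub>G\<^esub> b)) \<phi> = act (inv\<^bsub>G\<^esub> b) (act (inv\<^bsub>G\<^esub> a) \<phi>)"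
      using mult.hyps mult.prems by (simp add: G.inv_mult_group conf.act_mult space_\<nu>)
    ultimately show ?case using mult.IH mult.prems by simp
  qed
  have w_const: "w \<phi> = w \<phi>1" if \<phi>: "\<phi> \<in> conf" for \<phi>
  proof -
    \<comment> \<open>Over a finite base every configuration has finite support, so the pointwise
      quotient is a lamp configuration; as a group element it carries \<open>\<phi>1\<close> to
      \<phi>, which shows transitivity.\<close>
    let ?f = "\<lambda>x\<in>carrier \<Gamma>. \<phi> x \<otimes>\<^bsub>L\<^esub> inv\<^bsub>L\<^esub> \<phi>1 x"
    have f: "(?f, \<one>\<^bsub>\<Gamma>\<^esub>) \<in> carrier G"
      using fin \<phi> \<phi>1(1) by (auto simp: carrier_G lamp_configs_def PiE_iff)
    have "act (?f, \<one>\<^bsub>\<Gamma>\<^esub>) \<phi>1 = \<phi>"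
      using \<phi> \<phi>1(1) by (auto simp: act_eq translate_def fun_eq_iff PiE_iff extensional_def L.m_assoc)
    moreover have "inv\<^bsub>G\<^esub> (inv\<^bsub>G\<^esub> (?f, \<one>\<^bsub>\<Gamma>\<^esub>)) = (?f, \<one>\<^bsub>\<Gamma>\<^esub>)" using f by (rule G.inv_inv)
    ultimately show ?thesis using maxed[of "inv\<^bsub>G\<^esub> (?f, \<one>\<^bsub>\<Gamma>\<^esub>)" \<phi>1] f \<phi>1(1) by (simp only: G.inv_closed)
  qed
  interpret pushed: prob_space "push act g \<nu>" by (rule conf.prob_space_push[OF g])
  show ?thesis
  proof (rule measure_eqI_countable[OF _ setsP count])
    show "sets (push act g \<nu>) = Pow conf" by (simp add: setsP)
    fix \<phi> assume \<phi>: "\<phi> \<in> conf"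
    have "measure (push act g \<nu>) {\<phi>} = measure \<nu> (act g -` {\<phi>} \<inter> conf)"
      using conf.measure_push[OF g, of "{\<phi>}"] \<phi> by (simp add: setsP space_\<nu>)
    also have "\<dots> = w (act (inv\<^bsub>G\<^esub> g) \<phi>)" using vim[OF g \<phi>] by (simp add: w_def)
    also have "\<dots> = w \<phi>1"
      using conf.act_space[of "inv\<^bsub>G\<^esub> g" \<phi>] g \<phi> by (intro w_const) (simp add: space_\<nu>)
    also have "\<dots> = measure \<nu> {\<phi>}" using w_const[OF \<phi>] by (simp add: w_def)
    finally show "emeasure (push act g \<nu>) {\<phi>} = emeasure \<nu> {\<phi>}"
      by (simp add: conf.emeasure_eq_measure pushed.emeasure_eq_measure)
  qed
qed

lemma (in stationary_action) kl_invariant: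
  assumes "push act g \<nu> = \<nu>"
  shows "kl g = 0"
proof -
  have "push act g \<nu> = density \<nu> (\<lambda>_. ennreal 1)" using assms by (simp add: density_1)
  then have "kl g = (\<integral>x. 1 * ln 1 \<partial>\<nu>)" by (intro kl_eq) auto
  then show ?thesis by simp
qed

text \<open>All translates of \<nu> coincide with \<nu>, so every relative entropy in the average
  vanishes.\<close>

lemma (in lamplighter_walk) finite_base_entropy:
  assumes "finite (carrier \<Gamma>)" "pmf_entropy \<mu> < \<infinity>"
  shows "config_entropy L \<Gamma> \<mu> = 0"
proof -
  have "config_entropy L \<Gamma> \<mu> = measure_pmf.expectation \<mu> (\<lambda>_. 0)"
    unfolding config_entropy_def conf.furstenberg_entropy_eq(2)[OF assms(2)]
    using conf.set_pmf_subset conf.kl_invariant[OF finite_base_invariant[OF assms(1)]]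
    by (intro integral_cong_AE) (auto simp: AE_measure_pmf_iff)
  then show ?thesis by simp
qed

text \<open>The one-point space. It serves the case that the interval of entropies is just the point
  0, where an approximation from \<open>entropy_realized_near\<close> could fall outside.\<close>

lemma entropy_zero_realized:
  assumes "group G" "generating G \<mu>" "pmf_entropy \<mu> < \<infinity>"
  shows "\<exists>(\<nu> :: real measure) act. stationary_space G \<mu> \<nu> act \<and> ergodic_action G \<nu> act \<and>
    furstenberg_entropy G \<mu> \<nu> act = 0"
proof -
  let ?N = "count_space {0 :: real}"
  define a :: "'a \<Rightarrow> real \<Rightarrow> real" where "a g = (\<lambda>x\<in>{0}. x)" for g
  have a: "a g \<in> ?N \<rightarrow>\<^sub>M ?N" for g by (auto simp: a_def)
  have push: "push a g ?N = ?N" for g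
  proof -
    have "push a g ?N = distr ?N ?N (\<lambda>x. x)" unfolding push_def by (intro distr_cong) (auto simp: a_def)
    then show ?thesis by (simp add: distr_id2)
  qed
  interpret stationary_action G \<mu> ?N a
  proof (intro stationary_action.intro stationary_action_axioms.intro assms(2) a)
    show "group_action G (space ?N) a"
      by (rule group_actionI[OF assms(1)]) (auto simp: a_def)
    show "prob_space ?N" by (rule prob_spaceI) simp
    fix E assume "E \<in> sets ?N"
    then have "a g -` E \<inter> space ?N = E" for g by (auto simp: a_def)
    then show "measure_pmf.expectation \<mu> (\<lambda>g. measure ?N (a g -` E \<inter> space ?N)) = measure ?N E" by simp
  qed
  have "standard_borel ?N"
  proof (rule standard_borelI[of "discrete_topology {0 :: real}"])
    show "second_countable (discrete_topology {0 :: real})"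
      unfolding second_countable_def by (intro exI[of _ "{{0}}"]) auto
    show "sets ?N = sigma_sets (topspace (discrete_topology {0})) {U. openin (discrete_topology {0}) U}"
      using sigma_algebra.sigma_sets_eq[OF sigma_algebra_Pow, of "{0 :: real}"] by (simp add: Pow_def)
  qed (auto simp: completely_metrizable_space_discrete_topology)
  then have "stationary_space G \<mu> ?N a" by (rule stationary_spaceI)
  moreover have "ergodic_action G ?N a"
    unfolding ergodic_action_def
  proof (intro ballI impI)
    fix E assume "E \<in> sets ?N"
    then have "E = {} \<or> E = {0}" by auto
    then show "measure ?N E = 0 \<or> measure ?N E = 1" by (auto simp: measure_count_space)
  qed
  moreover have "furstenberg_entropy G \<mu> ?N a = 0"
  proof -
    have "kl = (\<lambda>_. 0)" by (rule ext) (rule kl_invariant[OF push])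
    then show ?thesis unfolding furstenberg_entropy_eq(2)[OF assms(3)] by simp
  qed
  ultimately show ?thesis by blast
qed

theorem theorem2:
  fixes L :: "('l, 'a) monoid_scheme" and \<Gamma> :: "('g, 'b) monoid_scheme"
    and \<mu> :: "(('g \<Rightarrow> 'l) \<times> 'g) pmf"
  assumes "group L" and "group \<Gamma>"
    and "finitely_generated (lamplighter L \<Gamma>)"
    and "generating (lamplighter L \<Gamma>) \<mu>"
    and "pmf_entropy \<mu> < \<infinity>"
    and "trivial_Poisson_boundary \<Gamma> (map_pmf snd \<mu>)"
    and "lamps_stabilize L \<Gamma> \<mu>"
  shows "\<exists>H \<subseteq> {0..config_entropy L \<Gamma> \<mu>}.
           {0..config_entropy L \<Gamma> \<mu>} \<subseteq> closure H \<and>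
           (\<forall>h\<in>H. \<exists>(\<nu> :: real measure) act.
              stationary_space (lamplighter L \<Gamma>) \<mu> \<nu> act \<and>
              ergodic_action (lamplighter L \<Gamma>) \<nu> act \<and>
              furstenberg_entropy (lamplighter L \<Gamma>) \<mu> \<nu> act = h)"
proof -
  interpret Liouville_lamplighter L \<Gamma> \<mu>
    by (intro Liouville_lamplighter.intro lamplighter_walk.intro Liouville_lamplighter_axioms.intro assms)
  let ?c = "config_entropy L \<Gamma> \<mu>"
  let ?real = "\<lambda>h. \<exists>(\<nu> :: real measure) act. stationary_space G \<mu> \<nu> act \<and> ergodic_action G \<nu> act \<and>
    furstenberg_entropy G \<mu> \<nu> act = h"
  \<comment> \<open>All attainable entropies in the interval are taken, so that only density remains
    to be shown.\<close>
  define H where "H = {h \<in> {0..?c}. ?real h}"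
  have "{0..?c} \<subseteq> closure H"
  proof
    fix x assume x: "x \<in> {0..?c}"
    show "x \<in> closure H"
    proof (cases "?c = 0")
      case True
      then have "x \<in> H"
        using x entropy_zero_realized[OF G.is_group gen assms(5)] by (simp add: H_def)
      then show ?thesis using closure_subset by blast
    next
      case False
      then have c: "?c > 0" using x by auto
      \<comment> \<open>Ergodicity of the masked system relies on an infinite base; a finite one
        would give entropy 0.\<close>
      have inf: "infinite (carrier \<Gamma>)" using False finite_base_entropy[OF _ assms(5)] by blast
      show ?thesis
        unfolding closure_approachable
      proof (intro allI impI)
        fix e :: real assume e: "e > 0"
        \<comment> \<open>The ratio \<open>y / ?c\<close> serves as \<open>q\<close> and must lie
          strictly between 0 and 1, so \<open>x\<close> is first moved into the open
          interval.\<close>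
        obtain y where y: "0 < y" "y < ?c" "\<bar>y - x\<bar> < e / 2"
        proof
          define d where "d = min (e / 4) (?c / 4)"
          define z where "z = (if x \<le> ?c / 2 then x + d else x - d)"
          have d: "0 < d" "d \<le> e / 4" "d \<le> ?c / 4" using e c by (auto simp: d_def)
          show "0 < z" "z < ?c" "\<bar>z - x\<bar> < e / 2" using d x c e by (auto simp: z_def)
        qed
        \<comment> \<open>Half the distance from \<open>y\<close> to either end keeps the realized
          entropy inside the interval.\<close>
        define \<epsilon> where "\<epsilon> = min (e / 4) (min (y / 2) ((?c - y) / 2))"
        have \<epsilon>: "0 < \<epsilon>" using e y by (simp add: \<epsilon>_def)
        have \<epsilon>': "\<epsilon> \<le> e / 4" "\<epsilon> \<le> y / 2" "\<epsilon> \<le> (?c - y) / 2"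
          unfolding \<epsilon>_def by (rule min.cobounded1 min.coboundedI2[OF min.cobounded1] min.coboundedI2[OF min.cobounded2])+
        obtain \<nu>' :: "real measure" and act' where \<nu>': "stationary_space G \<mu> \<nu>' act'" "ergodic_action G \<nu>' act'"
          "\<bar>furstenberg_entropy G \<mu> \<nu>' act' - y / ?c * ?c\<bar> \<le> \<epsilon>"
          using entropy_realized_near[OF inf assms(5), of "y / ?c" \<epsilon>] y \<epsilon> c by auto
        let ?h = "furstenberg_entropy G \<mu> \<nu>' act'"
        have h: "\<bar>?h - y\<bar> \<le> \<epsilon>" using \<nu>'(3) c by simp
        then have "?h \<in> H"
          unfolding H_def using \<nu>'(1,2) \<epsilon>' y by auto
        moreover have "dist ?h x < e" unfolding dist_real_def using h y(3) \<epsilon>'(1) e by linarith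
        ultimately show "\<exists>h\<in>H. dist h x < e" by blast
      qed
    qed
  qed
  then show ?thesis by (intro exI[of _ H]) (auto simp: H_def)
qed

end
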